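(* The three smallest values in $\mathcal{M}_i$ are $$\tfrac12\sqrt{21}<\tfrac23\sqrt{14}<\tfrac13(3+\sqrt{21})$$ (that is, every other element of $\mathcal{M}_i$ exceeds $\tfrac13(3+\sqrt{21})$). For $j=1,2,3$, the $j$-th of these values is attained by the billiard $\mathcal{C}_j$, and $\mathcal{C}_j$ is the unique modular billiard $\mathcal{B}$ with $\lambda_i(\mathcal{B})$ equal to that value, where $\mathcal{C}_1$ is induced by $\langle \frac{1}{2}(1-\sqrt{21}),\frac{1}{2}(1+\sqrt{21})\rangle$, $\mathcal{C}_2$ is induced by $\langle \frac{1}{2}(2-\sqrt{14}),\frac{1}{2}(2+\sqrt{14})\rangle$ and $\mathcal{C}_3$ is induced by $\langle \frac{1}{2}(3-\sqrt{21}),\frac{1}{2}(5+\sqrt{21})\rangle$. Each $\mathcal{C}_j$ is proper and non-orientable; $\mathcal{C}_1$ and $\mathcal{C}_2$ are periodic, while $\mathcal{C}_3$ is not periodic. Finally, $\tfrac13(3+\sqrt{21})$ is a limit point of $\mathcal{M}_i$.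
   Context: Let $\mathbb{H}$ be the upper half-plane with hyperbolic metric $ds=|dz|/y$. The group $\Gamma=\mathrm{PGL}(2,\mathbb{Z})$ acts on $\mathbb{H}$: $M=\pm\begin{pmatrix}a&b\\c&d\end{pmatrix}$ with $\det M=1$ acts by $z\mapsto \frac{az+b}{cz+d}$, and with $\det M=-1$ by $z\mapsto \frac{a\bar z+b}{c\bar z+d}$. Let $\mathcal{T}=\{z\in\mathbb{H}: 0\le \mathrm{Re}\,z\le \tfrac12,\ |z|\ge 1\}$. For distinct $\alpha,\beta\in\mathbb{R}\cup\{\infty\}$, $\langle\alpha,\beta\rangle$ denotes the oriented geodesic from $\alpha$ to $\beta$. For an oriented geodesic $S$, the modular billiard $\mathcal{B}$ induced by $S$ is the set of distinct directed geodesic segments in $\mathcal{T}$ of the orbit $\Gamma S$ (i.e. the intersections with $\mathcal{T}$ of the oriented geodesics $gS$, $g\in\Gamma$); geodesics in the same $\Gamma$-orbit induce the same billiard. If $\mathcal{B}$ is induced by $\langle\alpha,\beta\rangle$, its reversal $\mathcal{B}^*$ is the billiard induced by $\langle\beta,\alpha\rangle$; $\mathcal{B}$ is non-orientable if $\mathcal{B}=\mathcal{B}^*$. $\mathcal{B}$ is improper if it contains a vertical segment and proper otherwise; it is periodic if the total hyperbolic length of its segments is finite. For $z\in\mathcal{T}$, $\delta_z(\mathcal{B})$ is the infimum of the hyperbolic distance between points of $\mathcal{B}$ and $z$, $\lambda_z(\mathcal{B})=(\sinh\delta_z(\mathcal{B}))^{-1}$, and $\mathcal{M}_z=\{\lambda_z(\mathcal{B}):\mathcal{B}\text{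 a modular billiard}\}$. *)

theory Defs
  imports "HOL-Analysis.Analysis"
begin

section \<open>The hyperbolic plane\<close>

definition upper_half_plane :: "complex set" where
  "upper_half_plane = {z. Im z > 0}"

text \<open>The Riemannian distance of the metric \<open>ds = |dz| / y\<close>: the infimum of the lengths of
  piecewise C1 paths in the upper half-plane. A path satisfying \<^const>\<open>valid_path\<close> need not have
  finite length; \<^const>\<open>has_integral\<close> restricts the infimum to those that do.\<close>

definition hyp_dist :: "complex \<Rightarrow> complex \<Rightarrow> real" where
  "hyp_dist z w = Inf {L. \<exists>\<gamma>. valid_path \<gamma> \<and> path_image \<gamma> \<subseteq> upper_half_plane \<and>
      pathstart \<gamma> = z \<and> pathfinish \<gamma> = w \<and>
      ((\<lambda>t. norm (vector_derivative \<gamma> (at t)) / Im (\<gamma> t)) has_integral L) {0..1}}"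

text \<open>Boundary points in \<open>\<real> \<union> {\<infinity>}\<close> are elements of \<^typ>\<open>real option\<close>, with \<^const>\<open>None\<close>
  standing for \<open>\<infinity>\<close>.

  A directed curve is encoded as the set of pairs \<open>(z, w)\<close> of its points such that \<open>z\<close> does not
  come after \<open>w\<close>. The underlying point set is the \<^const>\<open>Field\<close> of this relation, and it is
  also its \<^const>\<open>Domain\<close>, since the relation is reflexive on the curve. This makes the image of a
  directed curve under a map and its restriction to a subset the obvious set operations.\<close>

type_synonym dcurve = "(complex \<times> complex) set"

definition semicircle :: "real \<Rightarrow> real \<Rightarrow> complex set" where
  "semicircle a b = {z \<in> upper_half_plane. dist z (of_real ((a + b) / 2)) = \<bar>b - a\<bar> / 2}"

definition vertical_line :: "real \<Rightarrow> complex set" where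
  "vertical_line a = {z \<in> upper_half_plane. Re z = a}"

text \<open>The oriented geodesic from \<open>\<alpha>\<close> to \<open>\<beta>\<close>; only meaningful for \<open>\<alpha> \<noteq> \<beta>\<close>.\<close>

fun geodesic :: "real option \<Rightarrow> real option \<Rightarrow> dcurve" where
  "geodesic (Some a) (Some b) = {(z, w). z \<in> semicircle a b \<and> w \<in> semicircle a b \<and>
     (if a < b then Re z \<le> Re w else Re w \<le> Re z)}"
| "geodesic (Some a) None = {(z, w). z \<in> vertical_line a \<and> w \<in> vertical_line a \<and> Im z \<le> Im w}"
| "geodesic None (Some b) = {(z, w). z \<in> vertical_line b \<and> w \<in> vertical_line b \<and> Im w \<le> Im z}"
| "geodesic None None = {}"

section \<open>The action of the modular group\<close>

text \<open>\<open>PGL(2, \<int>)\<close> is represented by \<open>GL(2, \<int>)\<close>; a matrix and its negative act in the same way.\<close>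

definition GL2Z :: "(int^2^2) set" where
  "GL2Z = {M. det M = 1 \<or> det M = -1}"

definition pgl_act :: "int^2^2 \<Rightarrow> complex \<Rightarrow> complex" where
  "pgl_act M z = (let u = (if det M = 1 then z else cnj z) in
     (of_int (M$1$1) * u + of_int (M$1$2)) / (of_int (M$2$1) * u + of_int (M$2$2)))"

definition act_dcurve :: "int^2^2 \<Rightarrow> dcurve \<Rightarrow> dcurve" where
  "act_dcurve M S = map_prod (pgl_act M) (pgl_act M) ` S"

definition mod_triangle :: "complex set" where
  "mod_triangle = {z \<in> upper_half_plane. 0 \<le> Re z \<and> Re z \<le> 1 / 2 \<and> norm z \<ge> 1}"

section \<open>Modular billiards\<close>

definition induced_billiard :: "dcurve \<Rightarrow> dcurve set" where
  "induced_billiard S =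
     {act_dcurve M S \<inter> (mod_triangle \<times> mod_triangle) | M. M \<in> GL2Z} - {{}}"

definition billiard :: "real option \<Rightarrow> real option \<Rightarrow> dcurve set" where
  "billiard \<alpha> \<beta> = induced_billiard (geodesic \<alpha> \<beta>)"

definition modular_billiards :: "dcurve set set" where
  "modular_billiards = {billiard \<alpha> \<beta> | \<alpha> \<beta>. \<alpha> \<noteq> \<beta>}"

definition reversal :: "dcurve set \<Rightarrow> dcurve set" where
  "reversal B = (THE B'. \<exists>\<alpha> \<beta>. \<alpha> \<noteq> \<beta> \<and> B = billiard \<alpha> \<beta> \<and> B' = billiard \<beta> \<alpha>)"

definition non_orientable :: "dcurve set \<Rightarrow> bool" where
  "non_orientable B \<longleftrightarrow> B = reversal B"

text \<open>A geodesic can meet the triangle in a single corner; such an intersection is not to be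
  counted as vertical, hence the requirement of two distinct points.\<close>

definition vertical_segment :: "dcurve \<Rightarrow> bool" where
  "vertical_segment s \<longleftrightarrow> (\<exists>(z, w)\<in>s. z \<noteq> w) \<and> (\<exists>x. Field s \<subseteq> vertical_line x)"

definition improper :: "dcurve set \<Rightarrow> bool" where
  "improper B \<longleftrightarrow> (\<exists>s\<in>B. vertical_segment s)"

definition proper :: "dcurve set \<Rightarrow> bool" where
  "proper B \<longleftrightarrow> \<not> improper B"

text \<open>The length of a geodesic segment is the distance of its endpoints, that is, the largest
  distance of two of its points; the supremum also covers segments going to the cusp.\<close>

definition segment_length :: "dcurve \<Rightarrow> ennreal" where
  "segment_length s = (SUP (z, w)\<in>s. ennreal (hyp_dist z w))"

definition periodic :: "dcurve set \<Rightarrow> bool" where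
  "periodic B \<longleftrightarrow> (\<Sum>\<^sub>\<infinity>s\<in>B. segment_length s) < \<infinity>"

definition billiard_points :: "dcurve set \<Rightarrow> complex set" where
  "billiard_points B = (\<Union>s\<in>B. Field s)"

definition delta :: "complex \<Rightarrow> dcurve set \<Rightarrow> real" where
  "delta z B = (INF w\<in>billiard_points B. hyp_dist z w)"

text \<open>\<open>lambda z B\<close> takes the value \<open>\<infinity>\<close> if \<open>delta z B = 0\<close>: for \<^typ>\<open>ereal\<close>, unlike for
  \<^typ>\<open>real\<close>, \<open>inverse 0 = \<infinity>\<close>.\<close>

definition lambda :: "complex \<Rightarrow> dcurve set \<Rightarrow> ereal" where
  "lambda z B = inverse (ereal (sinh (delta z B)))"

definition lambda_spectrum :: "complex \<Rightarrow> ereal set" where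
  "lambda_spectrum z = lambda z ` modular_billiards"

section \<open>The three extremal billiards\<close>

definition billiard_C1 :: "dcurve set" where
  "billiard_C1 = billiard (Some ((1 - sqrt 21) / 2)) (Some ((1 + sqrt 21) / 2))"

definition billiard_C2 :: "dcurve set" where
  "billiard_C2 = billiard (Some ((2 - sqrt 14) / 2)) (Some ((2 + sqrt 14) / 2))"

definition billiard_C3 :: "dcurve set" where
  "billiard_C3 = billiard (Some ((3 - sqrt 21) / 2)) (Some ((5 + sqrt 21) / 2))"

end

theory Submission
  imports Defs
begin

text \<open>
  If the geodesic from \<open>\<alpha>\<close> to \<open>\<beta>\<close> corresponds to the form \<open>f(x, y) = (x - \<alpha> y) (x - \<beta> y)\<close>, its distance \<open>\<delta>\<close>
  from \<open>\<i>\<close> satisfies \<open>sinh \<delta> = \<bar>f(1, 0) + f(0, 1)\<bar> / \<bar>\<alpha> - \<beta>\<bar>\<close>, and folding into the triangle does not increase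
  the distance from \<open>\<i>\<close>. So \<open>\<lambda>\<close> is the supremum of \<open>\<bar>\<alpha> - \<beta>\<bar> / \<bar>f(u) + f(v)\<bar>\<close> over the bases \<open>(u, v)\<close> of \<open>\<int>\<^sup>2\<close>.

  Suppose that \<open>\<lambda> \<le> (3 + sqrt 21) / 3\<close>. The orbit contains a geodesic from \<open>v \<in> [0, 1)\<close> to \<open>X > 1\<close> that passes
  above \<open>1 + \<i>\<close>, and the step \<open>(v, X) \<mapsto> (1 / (M - v), 1 / (M - X))\<close> with \<open>M = \<lceil>X\<rceil>\<close> preserves this property.
  The digits \<open>M\<close> form a doubly infinite minus continued fraction, and the bounds at the points \<open>\<i>\<close>, \<open>1 + \<i>\<close>,
  \<open>M - 1 + \<i>\<close>, \<open>M + \<i>\<close> leave only the sequences \<open>(5)\<close>, \<open>(4, 8)\<close> (both periodic) and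
  \<open>\<dots>, 5, 5, 6, 5, 5, \<dots>\<close>, which are the three billiards. Conversely, along a chain of such steps these four
  points already determine \<open>\<lambda>\<close>, since every other basis is a Farey edge that some step brings into a region where
  \<open>f\<close> is larger. Two digits \<open>6\<close> separated by a long block of fives give values tending to the third one from above.
\<close>

section \<open>The hyperbolic distance\<close>

text \<open>With \<open>kap\<close> the reciprocal of the third value,
  \<open>lambda \<le> 1 / kap\<close> reads kap |x - y| \<le> |x y + 1| for all finite endpoint
  pairs of the orbit. The absolute value is the obstacle: an arc may pass above or below a point of
  the orbit of \<i>. For arcs with X - v > 3 the left side exceeds 1, which fixes the sign at the
  points over the integers under the arc.

  Digit sequences never occur as objects. A tail is a real number, and each admissible tail is the
  image of another one under the step. Supremum and infimum of the tails therefore satisfy a fixed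
  point inequality, which pins them to a quadratic irrational.

  The digit 6 survives only as an equality case: without the digit 4 all tails are at most 1 - 2
  kap, and the bound at a 6 needs both tails to attain this. This isolates the third billiard.
  Between two sixes a long block of fives misses equality by an arbitrarily small amount, hence the
  limit point.

  Since lambda ignores orientation, the classification is only up to reversal; reflections x -> n -
  x show that the three billiards equal their reversals.\<close>

definition hyp_path :: "complex \<Rightarrow> complex \<Rightarrow> (real \<Rightarrow> complex) \<Rightarrow> real \<Rightarrow> bool" where
  "hyp_path z w \<gamma> L \<longleftrightarrow> valid_path \<gamma> \<and> path_image \<gamma> \<subseteq> upper_half_plane \<and>
     pathstart \<gamma> = z \<and> pathfinish \<gamma> = w \<and>
     ((\<lambda>t. norm (vector_derivative \<gamma> (at t)) / Im (\<gamma> t)) has_integral L) {0..1}"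

lemma hyp_dist_alt: "hyp_dist z w = Inf {L. \<exists>\<gamma>. hyp_path z w \<gamma> L}"
  by (simp add: hyp_dist_def hyp_path_def)

section \<open>Invariance of the distance under real Moebius maps\<close>

definition moebius :: "real \<Rightarrow> real \<Rightarrow> real \<Rightarrow> real \<Rightarrow> complex \<Rightarrow> complex" where
  "moebius a b c d z = (of_real a * z + of_real b) / (of_real c * z + of_real d)"

lemma moebius_denom_nonzero:
  assumes "a * d - b * c > 0" "Im z > 0"
  shows "of_real c * z + of_real d \<noteq> (0 :: complex)"
proof
  assume *: "of_real c * z + of_real d = (0 :: complex)"
  then have "c * Im z = 0" by (simp add: complex_eq_iff)
  then have "c = 0" using assms by simp
  then show False using * assms by auto
qed

lemma Im_moebius:
  assumes "a * d - b * c > 0" "Im z > 0"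
  shows "Im (moebius a b c d z) = (a * d - b * c) * Im z / (norm (of_real c * z + of_real d))\<^sup>2"
proof -
  have "Im (moebius a b c d z) = Im ((of_real a * z + of_real b) * cnj (of_real c * z + of_real d)) / (norm (of_real c * z + of_real d))\<^sup>2"
    unfolding moebius_def by (subst complex_div_cnj) (simp add: Im_divide_of_real flip: of_real_power)
  also have "Im ((of_real a * z + of_real b) * cnj (of_real c * z + of_real d)) = (a * d - b * c) * Im z"
    by (simp add: algebra_simps)
  finally show ?thesis .
qed

lemma Im_moebius_pos:
  assumes "a * d - b * c > 0" "Im z > 0"
  shows "Im (moebius a b c d z) > 0"
  using moebius_denom_nonzero[OF assms] by (simp only: Im_moebius[OF assms]) (simp add: assms del: diff_gt_0_iff_gt)

lemma moebius_has_field_derivative: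
  assumes "a * d - b * c > 0" "Im z > 0"
  shows "(moebius a b c d has_field_derivative of_real (a * d - b * c) / (of_real c * z + of_real d)\<^sup>2) (at z)"
  unfolding moebius_def [abs_def]
  using moebius_denom_nonzero[OF assms]
  by (auto intro!: derivative_eq_intros simp: power2_eq_square algebra_simps)

text \<open>As |m'(z)| = Im (m z) / Im z, both paths have the same integrand outside finitely many
  corners. Requiring only a positive determinant admits rotations about \<i> and affine maps without
  normalising square roots.\<close>

lemma hyp_path_moebius:
  assumes det: "a * d - b * c > 0" and \<gamma>: "hyp_path z w \<gamma> L"
  shows "hyp_path (moebius a b c d z) (moebius a b c d w) (moebius a b c d \<circ> \<gamma>) L"
proof -
  let ?m = "moebius a b c d"
  have v: "valid_path \<gamma>" and im: "path_image \<gamma> \<subseteq> upper_half_plane"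
    and I: "((\<lambda>t. norm (vector_derivative \<gamma> (at t)) / Im (\<gamma> t)) has_integral L) {0..1}"
    using \<gamma> by (auto simp: hyp_path_def)
  have pos: "Im (\<gamma> t) > 0" if "t \<in> {0..1}" for t
    using im that by (force simp: path_image_def upper_half_plane_def)
  have der: "(?m has_field_derivative of_real (a * d - b * c) / (of_real c * x + of_real d)\<^sup>2) (at x)"
    if "x \<in> path_image \<gamma>" for x
    using moebius_has_field_derivative[OF det] im that by (auto simp: upper_half_plane_def)
  have deriv: "deriv ?m x = of_real (a * d - b * c) / (of_real c * x + of_real d)\<^sup>2" if "Im x > 0" for x
    using moebius_has_field_derivative[OF det that] by (rule DERIV_imp_deriv)
  have "continuous_on (path_image \<gamma>) (\<lambda>x. of_real (a * d - b * c) / (of_real c * x + of_real d)\<^sup>2)"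
    using moebius_denom_nonzero[OF det] im
    by (intro continuous_intros) (auto simp: upper_half_plane_def)
  then have "continuous_on (path_image \<gamma>) (deriv ?m)"
    by (rule continuous_on_cong[THEN iffD1, rotated 2]) (use im in \<open>auto simp: deriv upper_half_plane_def\<close>)
  then have valid: "valid_path (?m \<circ> \<gamma>)"
    by (intro valid_path_compose[OF v]) (use der in \<open>auto simp: field_differentiable_def\<close>)
  obtain S where S: "finite S" "\<And>t. t \<in> {0..1} - S \<Longrightarrow> \<gamma> differentiable at t"
    using v unfolding valid_path_def piecewise_C1_differentiable_on_def
    by (meson C1_differentiable_on_eq)
  have "((\<lambda>t. norm (vector_derivative (?m \<circ> \<gamma>) (at t)) / Im ((?m \<circ> \<gamma>) t)) has_integral L) {0..1}"
  proof (rule has_integral_spike_finite[OF S(1) _ I])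
    fix t assume t: "t \<in> {0..1} - S"
    let ?N = "of_real c * \<gamma> t + of_real d"
    have N: "?N \<noteq> 0" using moebius_denom_nonzero[OF det] pos t by auto
    have "(\<gamma> has_vector_derivative vector_derivative \<gamma> (at t)) (at t)"
      using S(2)[OF t] vector_derivative_works by blast
    from field_vector_diff_chain_at[OF this moebius_has_field_derivative[OF det pos]] t
    have "vector_derivative (?m \<circ> \<gamma>) (at t) = vector_derivative \<gamma> (at t) * (of_real (a * d - b * c) / ?N\<^sup>2)"
      by (intro vector_derivative_at) auto
    then have "norm (vector_derivative (?m \<circ> \<gamma>) (at t)) = norm (vector_derivative \<gamma> (at t)) * (a * d - b * c) / (norm ?N)\<^sup>2"
      using det by (simp add: norm_mult norm_divide norm_power del: of_real_diff of_real_mult)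
    moreover have "Im ((?m \<circ> \<gamma>) t) = (a * d - b * c) * Im (\<gamma> t) / (norm ?N)\<^sup>2"
      using Im_moebius[OF det pos[of t]] t by simp
    ultimately show "norm (vector_derivative (?m \<circ> \<gamma>) (at t)) / Im ((?m \<circ> \<gamma>) t)
        = norm (vector_derivative \<gamma> (at t)) / Im (\<gamma> t)"
      using N det by simp
  qed
  moreover have "path_image (?m \<circ> \<gamma>) \<subseteq> upper_half_plane"
    using Im_moebius_pos[OF det] im by (auto simp: path_image_def upper_half_plane_def)
  ultimately show ?thesis
    using \<gamma> valid by (simp add: hyp_path_def pathstart_compose pathfinish_compose)
qed

lemma moebius_inverse:
  assumes det: "a * d - b * c > 0" and z: "Im z > 0"
  shows "moebius d (- b) (- c) a (moebius a b c d z) = z"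
proof -
  define N where "N = of_real c * z + of_real d"
  have N: "N \<noteq> 0" using moebius_denom_nonzero[OF det z] by (simp add: N_def)
  have "moebius d (- b) (- c) a (moebius a b c d z)
    = ((of_real d * (of_real a * z + of_real b) - of_real b * N) / N) / ((of_real a * N - of_real c * (of_real a * z + of_real b)) / N)"
    unfolding moebius_def N_def[symmetric] using N by (simp add: diff_divide_distrib)
  also have "\<dots> = (of_real (a * d - b * c) * z) / of_real (a * d - b * c)"
  proof -
    have "of_real d * (of_real a * z + of_real b) - of_real b * N = of_real (a * d - b * c) * z"
      "of_real a * N - of_real c * (of_real a * z + of_real b) = of_real (a * d - b * c)"
      by (simp_all add: N_def algebra_simps)
    then show ?thesis using N by (simp only:) (simp del: of_real_diff of_real_mult)
  qed
  also have "\<dots> = z" using det by (simp del: of_real_diff of_real_mult)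
  finally show ?thesis .
qed

lemma hyp_dist_moebius:
  assumes det: "a * d - b * c > 0" and "Im z > 0" "Im w > 0"
  shows "hyp_dist (moebius a b c d z) (moebius a b c d w) = hyp_dist z w"
proof -
  have "(\<exists>\<gamma>. hyp_path (moebius a b c d z) (moebius a b c d w) \<gamma> L) \<longleftrightarrow> (\<exists>\<gamma>. hyp_path z w \<gamma> L)" for L
    using hyp_path_moebius[OF det, of z w _ L]
      hyp_path_moebius[of d a "- b" "- c" "moebius a b c d z" "moebius a b c d w" _ L]
      moebius_inverse[OF det] assms by (auto simp: algebra_simps)
  then show ?thesis by (simp add: hyp_dist_alt)
qed

text \<open>The integrand dominates the derivative of ln (Im \<gamma>), whatever the path does
  horizontally. Reversing the path gives the opposite sign, and vertical segments attain the
  bound.\<close>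

lemma hyp_path_length_ge:
  assumes "hyp_path z w \<gamma> L"
  shows "ln (Im w) - ln (Im z) \<le> L"
proof -
  have v: "valid_path \<gamma>" and im: "path_image \<gamma> \<subseteq> upper_half_plane"
    and I: "((\<lambda>t. norm (vector_derivative \<gamma> (at t)) / Im (\<gamma> t)) has_integral L) {0..1}"
    using assms by (auto simp: hyp_path_def)
  have pos: "Im (\<gamma> t) > 0" if "t \<in> {0..1}" for t
    using im that by (force simp: path_image_def upper_half_plane_def)
  obtain S where S: "finite S" "\<And>t. t \<in> {0..1} - S \<Longrightarrow> \<gamma> differentiable at t"
    using v unfolding valid_path_def piecewise_C1_differentiable_on_def
    by (meson C1_differentiable_on_eq)
  have "continuous_on {0..1} \<gamma>" using v valid_path_imp_path path_def by blast
  then have cont: "continuous_on {0..1} (\<lambda>t. ln (Im (\<gamma> t)))"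
    using pos by (intro continuous_intros) force+
  have "((\<lambda>t. Im (vector_derivative \<gamma> (at t)) / Im (\<gamma> t)) has_integral (ln (Im (\<gamma> 1)) - ln (Im (\<gamma> 0)))) {0..1}"
  proof (rule fundamental_theorem_of_calculus_interior_strong[OF S(1) _ _ cont])
    fix t assume t: "t \<in> {0<..<1} - S"
    then have "(\<gamma> has_vector_derivative vector_derivative \<gamma> (at t)) (at t)"
      using S(2)[of t] vector_derivative_works by auto
    then have "((\<lambda>t. Im (\<gamma> t)) has_vector_derivative Im (vector_derivative \<gamma> (at t))) (at t)"
      by (rule bounded_linear.has_vector_derivative[OF bounded_linear_Im])
    then have "((\<lambda>t. Im (\<gamma> t)) has_real_derivative Im (vector_derivative \<gamma> (at t))) (at t)"
      by (simp add: has_real_derivative_iff_has_vector_derivative)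
    from DERIV_chain2[OF DERIV_ln this]
    have "((\<lambda>t. ln (Im (\<gamma> t))) has_real_derivative Im (vector_derivative \<gamma> (at t)) / Im (\<gamma> t)) (at t)"
      using pos[of t] t by (simp add: divide_inverse mult.commute)
    then show "((\<lambda>t. ln (Im (\<gamma> t))) has_vector_derivative Im (vector_derivative \<gamma> (at t)) / Im (\<gamma> t)) (at t)"
      by (simp add: has_real_derivative_iff_has_vector_derivative)
  qed simp
  then have "ln (Im (\<gamma> 1)) - ln (Im (\<gamma> 0)) \<le> L"
  proof (rule has_integral_le[OF _ I])
    fix t :: real assume "t \<in> {0..1}"
    then show "Im (vector_derivative \<gamma> (at t)) / Im (\<gamma> t) \<le> norm (vector_derivative \<gamma> (at t)) / Im (\<gamma> t)"
      using pos[of t] abs_Im_le_cmod[of "vector_derivative \<gamma> (at t)"] by (intro divide_right_mono) linarith+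
  qed
  then show ?thesis using assms by (simp add: hyp_path_def pathstart_def pathfinish_def)
qed

lemma hyp_path_reverse:
  assumes "hyp_path z w \<gamma> L"
  shows "hyp_path w z (reversepath \<gamma>) L"
proof -
  have v: "valid_path \<gamma>" and im: "path_image \<gamma> \<subseteq> upper_half_plane"
    and I: "((\<lambda>t. norm (vector_derivative \<gamma> (at t)) / Im (\<gamma> t)) has_integral L) {0..1}"
    using assms by (auto simp: hyp_path_def)
  obtain S where S: "finite S" "\<And>t. t \<in> {0..1} - S \<Longrightarrow> \<gamma> differentiable at t"
    using v unfolding valid_path_def piecewise_C1_differentiable_on_def
    by (meson C1_differentiable_on_eq)
  have "((\<lambda>t. norm (vector_derivative \<gamma> (at (1 - t))) / Im (\<gamma> (1 - t))) has_integral L) {0..1}"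
    using has_integral_affinity[OF I[unfolded box_real[symmetric]], of "-1" 1]
    by (simp add: image_affinity_atLeastAtMost_diff)
  then have "((\<lambda>t. norm (vector_derivative (reversepath \<gamma>) (at t)) / Im (reversepath \<gamma> t)) has_integral L) {0..1}"
  proof (rule has_integral_spike_finite[rotated 2])
    show "finite ((\<lambda>t. 1 - t) ` S)" using S by simp
    fix t assume t: "t \<in> {0..1} - (\<lambda>t. 1 - t) ` S"
    then have "1 - t \<in> {0..1} - S" by force
    then have "(\<gamma> has_vector_derivative vector_derivative \<gamma> (at (1 - t))) (at (1 - t))"
      using S(2)[of "1 - t"] vector_derivative_works by auto
    then have "(\<gamma> \<circ> (\<lambda>t. 1 - t) has_vector_derivative (- 1) *\<^sub>R vector_derivative \<gamma> (at (1 - t))) (at t)"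
      by (intro vector_diff_chain_at) (auto intro!: derivative_eq_intros)
    then have "vector_derivative (reversepath \<gamma>) (at t) = - vector_derivative \<gamma> (at (1 - t))"
      by (intro vector_derivative_at) (simp add: reversepath_def o_def)
    then show "norm (vector_derivative (reversepath \<gamma>) (at t)) / Im (reversepath \<gamma> t)
      = norm (vector_derivative \<gamma> (at (1 - t))) / Im (\<gamma> (1 - t))"
      by (simp add: reversepath_def)
  qed
  then show ?thesis using assms by (simp add: hyp_path_def)
qed

lemma hyp_path_vertical:
  assumes "0 < y" "y \<le> y'"
  shows "hyp_path (Complex 0 y) (Complex 0 y') (linepath (Complex 0 y) (Complex 0 y')) (ln y' - ln y)"
proof -
  have pos: "y + t * (y' - y) > 0" if "t \<in> {0..1}" for t
    using assms that by (simp add: add_pos_nonneg)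
  have l: "linepath (Complex 0 y) (Complex 0 y') t = Complex 0 (y + t * (y' - y))" for t
    by (simp add: linepath_def complex_eq_iff algebra_simps)
  have d: "vector_derivative (linepath (Complex 0 y) (Complex 0 y')) (at t) = Complex 0 (y' - y)" for t
    by (simp add: complex_eq_iff)
  have "((\<lambda>t. (y' - y) / (y + t * (y' - y))) has_integral (ln (y + 1 * (y' - y)) - ln (y + 0 * (y' - y)))) {0..1}"
    by (rule fundamental_theorem_of_calculus)
      (use pos in \<open>auto intro!: derivative_eq_intros simp flip: has_real_derivative_iff_has_vector_derivative\<close>)
  moreover have "norm (Complex 0 (y' - y)) = y' - y" using assms by (simp add: complex_norm)
  ultimately have "((\<lambda>t. norm (vector_derivative (linepath (Complex 0 y) (Complex 0 y')) (at t)) / Im (linepath (Complex 0 y) (Complex 0 y') t)) has_integral (ln y' - ln y)) {0..1}"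
    unfolding l d by simp
  moreover have "path_image (linepath (Complex 0 y) (Complex 0 y')) \<subseteq> upper_half_plane"
    unfolding path_image_def using pos by (auto simp: l upper_half_plane_def)
  ultimately show ?thesis by (simp add: hyp_path_def)
qed

lemma hyp_dist_vertical:
  assumes "0 < y" "0 < y'"
  shows "hyp_dist (Complex 0 y) (Complex 0 y') = \<bar>ln y' - ln y\<bar>"
proof -
  have "\<exists>\<gamma>. hyp_path (Complex 0 y) (Complex 0 y') \<gamma> \<bar>ln y' - ln y\<bar>"
  proof (cases "y \<le> y'")
    case True
    then show ?thesis using hyp_path_vertical[OF assms(1) True] assms by auto
  next
    case False
    then show ?thesis using hyp_path_reverse[OF hyp_path_vertical[OF assms(2), of y]] assms by force
  qed
  moreover have "\<bar>ln y' - ln y\<bar> \<le> L" if "hyp_path (Complex 0 y) (Complex 0 y') \<gamma> L" for \<gamma> L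
    using hyp_path_length_ge[OF that] hyp_path_length_ge[OF hyp_path_reverse[OF that]] by simp
  ultimately show ?thesis unfolding hyp_dist_alt by (intro cInf_eq_minimum) auto
qed

lemma cosh_hyp_dist_i:
  assumes w: "Im w > 0"
  shows "cosh (hyp_dist \<i> w) = ((norm w)\<^sup>2 + 1) / (2 * Im w)" and "hyp_dist \<i> w \<ge> 0"
proof -
  text \<open>\<open>\<alpha>\<close> is an endpoint of the geodesic through \<open>\<i>\<close> and \<open>w\<close>; the rotation about \<open>\<i>\<close> moving it
    to \<open>0\<close> makes this geodesic the imaginary axis.\<close>
  define h where "h = ((norm w)\<^sup>2 - 1) / (2 * Re w)"
  define \<alpha> where "\<alpha> = (if Re w = 0 then 0 else h + sqrt (h\<^sup>2 + 1))"
  \<comment> \<open>The left side is the numerator of \<open>Re (m w)\<close>. If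
    \<open>Re w = 0\<close>, the point is on the axis already and the rotation is trivial.\<close>
  have \<alpha>: "Re w * (1 - \<alpha>\<^sup>2) + \<alpha> * ((norm w)\<^sup>2 - 1) = 0"
  proof (cases "Re w = 0")
    case False
    have "\<alpha>\<^sup>2 = 2 * h * \<alpha> + 1" using False by (simp add: \<alpha>_def power2_sum) (simp add: power2_eq_square algebra_simps)
    moreover have "(norm w)\<^sup>2 - 1 = 2 * h * Re w" using False by (simp add: h_def)
    ultimately show ?thesis by simp
  qed (simp add: \<alpha>_def)
  define m where "m = moebius 1 (- \<alpha>) \<alpha> 1"
  have det: "1 * 1 - (- \<alpha>) * \<alpha> > 0" by (simp add: add_pos_nonneg)
  have N: "of_real \<alpha> * w + 1 \<noteq> 0" using moebius_denom_nonzero[OF det w] by simp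
  have "m \<i> = \<i>"
  proof -
    have "of_real \<alpha> * \<i> + 1 \<noteq> 0" using moebius_denom_nonzero[OF det, of \<i>] by simp
    then show ?thesis by (simp add: m_def moebius_def field_simps)
  qed
  define y where "y = Im (m w)"
  have y: "y > 0" using Im_moebius_pos[OF det w] by (simp add: y_def m_def)
  have nN: "(norm (of_real \<alpha> * w + 1))\<^sup>2 = (\<alpha> * Re w + 1)\<^sup>2 + (\<alpha> * Im w)\<^sup>2" by (simp add: cmod_power2)
  have yval: "y = (1 + \<alpha>\<^sup>2) * Im w / (norm (of_real \<alpha> * w + 1))\<^sup>2"
    using Im_moebius[OF det w] by (simp add: y_def m_def power2_eq_square)
  have "Re (m w) = 0"
  proof -
    have "m w = (w - of_real \<alpha>) * cnj (of_real \<alpha> * w + 1) / of_real ((norm (of_real \<alpha> * w + 1))\<^sup>2)"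
      unfolding m_def moebius_def by (subst complex_div_cnj) simp
    moreover have "Re ((w - of_real \<alpha>) * cnj (of_real \<alpha> * w + 1)) = Re w * (1 - \<alpha>\<^sup>2) + \<alpha> * ((norm w)\<^sup>2 - 1)"
      unfolding cmod_power2 by (simp add: algebra_simps power2_eq_square)
    ultimately show ?thesis using \<alpha> by (simp only: Re_divide_of_real)
  qed
  then have mw: "m w = Complex 0 y" by (simp add: y_def complex_eq_iff)
  have "hyp_dist \<i> w = hyp_dist (Complex 0 1) (Complex 0 y)"
    using hyp_dist_moebius[OF det, of \<i> w] w \<open>m \<i> = \<i>\<close> mw by (simp add: m_def imaginary_unit.ctr)
  also have "\<dots> = \<bar>ln y\<bar>" using hyp_dist_vertical[of 1 y] y by simp
  finally have d: "hyp_dist \<i> w = \<bar>ln y\<bar>" .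
  then show "hyp_dist \<i> w \<ge> 0" by simp
  have "cosh (hyp_dist \<i> w) = (y + 1 / y) / 2"
    using y by (simp add: d cosh_real_abs cosh_ln_real inverse_eq_divide)
  also have "(y + 1 / y) / 2 = (y\<^sup>2 + 1) / (2 * y)" using y by (simp add: field_simps power2_eq_square)
  also have "\<dots> = ((norm w)\<^sup>2 + 1) / (2 * Im w)"
  proof -
    define Q where "Q = (norm (of_real \<alpha> * w + 1))\<^sup>2"
    have Q: "Q > 0" using N by (simp add: Q_def)
    have y2: "y\<^sup>2 = (norm (w - of_real \<alpha>))\<^sup>2 / Q"
    proof -
      have "y\<^sup>2 = (norm (m w))\<^sup>2" by (simp add: mw cmod_power2)
      also have "\<dots> = (norm (w - of_real \<alpha>))\<^sup>2 / Q" by (simp add: m_def moebius_def norm_divide power_divide Q_def)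
      finally show ?thesis .
    qed
    have "(norm (w - of_real \<alpha>))\<^sup>2 + Q = (1 + \<alpha>\<^sup>2) * ((norm w)\<^sup>2 + 1)"
      unfolding Q_def nN unfolding cmod_power2 by (simp add: power2_eq_square algebra_simps)
    then have "y\<^sup>2 + 1 = (1 + \<alpha>\<^sup>2) * ((norm w)\<^sup>2 + 1) / Q" using Q by (simp add: y2 field_simps)
    moreover have "1 + \<alpha>\<^sup>2 > 0" by (simp add: add_pos_nonneg)
    ultimately show ?thesis using Q w by (simp add: yval Q_def[symmetric])
  qed
  finally show "cosh (hyp_dist \<i> w) = ((norm w)\<^sup>2 + 1) / (2 * Im w)" .
qed

text \<open>The distance from \<i> suffices for lambda; this two-point form measures segments when
  periodicity is decided.\<close>

lemma cosh_hyp_dist: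
  assumes z: "Im z > 0" and w: "Im w > 0"
  shows "cosh (hyp_dist z w) = 1 + (norm (z - w))\<^sup>2 / (2 * Im z * Im w)" and "hyp_dist z w \<ge> 0"
proof -
  define w' where "w' = moebius 1 (- Re z) 0 (Im z) w"
  have "moebius 1 (- Re z) 0 (Im z) z = \<i>" using z by (simp add: moebius_def complex_eq_iff Re_divide_of_real Im_divide_of_real)
  then have eq: "hyp_dist z w = hyp_dist \<i> w'" using hyp_dist_moebius[of 1 "Im z" "- Re z" 0 z w] z w by (simp add: w'_def)
  have w': "Im w' = Im w / Im z" "Re w' = (Re w - Re z) / Im z"
    by (simp_all add: w'_def moebius_def Re_divide_of_real Im_divide_of_real)
  have pos: "Im w' > 0" using z w by (simp add: w')
  from cosh_hyp_dist_i[OF pos] show "hyp_dist z w \<ge> 0" by (simp add: eq)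
  have "cosh (hyp_dist z w) = (((Re w - Re z) / Im z)\<^sup>2 + (Im w / Im z)\<^sup>2 + 1) / (2 * (Im w / Im z))"
    using cosh_hyp_dist_i(1)[OF pos] by (simp add: eq cmod_power2 w')
  also have "\<dots> = 1 + (norm (z - w))\<^sup>2 / (2 * Im z * Im w)"
  proof -
    have "(((Re w - Re z) / Im z)\<^sup>2 + (Im w / Im z)\<^sup>2 + 1) / (2 * (Im w / Im z))
        = ((Re w - Re z)\<^sup>2 + (Im w)\<^sup>2 + (Im z)\<^sup>2) / (2 * Im z * Im w)"
      using z w by (simp add: field_simps power2_eq_square)
    moreover have "(norm (z - w))\<^sup>2 = (Re w - Re z)\<^sup>2 + (Im w)\<^sup>2 + (Im z)\<^sup>2 - 2 * Im z * Im w"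
      unfolding cmod_power2 by (simp add: power2_eq_square algebra_simps)
    ultimately show ?thesis using z w by (simp add: diff_divide_distrib)
  qed
  finally show "cosh (hyp_dist z w) = 1 + (norm (z - w))\<^sup>2 / (2 * Im z * Im w)" .
qed

section \<open>Geodesics through endpoint vectors\<close>

text \<open>A boundary point is represented by a vector \<open>(x, y)\<close> with \<open>x / y\<close> in \<open>\<real> \<union> {\<infinity>}\<close>. The geodesic from
  \<open>p\<close> to \<open>q\<close> is \<open>t \<mapsto> (p\<^sub>1 + i t q\<^sub>1) / (p\<^sub>2 + i t q\<^sub>2)\<close>, where \<open>t\<close> has the sign of \<open>wedge p q\<close>; in this form matrices
  act linearly on \<open>p\<close> and \<open>q\<close>, and conjugation is \<open>t \<mapsto> -t\<close>.\<close>

definition geo_pt :: "real \<times> real \<Rightarrow> real \<times> real \<Rightarrow> real \<Rightarrow> complex" where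
  "geo_pt p q t = Complex (fst p) (t * fst q) / Complex (snd p) (t * snd q)"

definition wedge :: "real \<times> real \<Rightarrow> real \<times> real \<Rightarrow> real" where
  "wedge p q = fst q * snd p - fst p * snd q"

text \<open>Matrices of determinant -1 change the signs of the parameter and of
  \<open>wedge p q\<close> together. Their product is invariant, so it can express both the positive
  height and the direction from p to q.\<close>

definition geo :: "real \<times> real \<Rightarrow> real \<times> real \<Rightarrow> dcurve" where
  "geo p q = {(geo_pt p q s, geo_pt p q t) | s t. 0 < s * wedge p q \<and> s * wedge p q \<le> t * wedge p q}"

definition lin :: "int^2^2 \<Rightarrow> real \<times> real \<Rightarrow> real \<times> real" where
  "lin M p = (of_int (M$1$1) * fst p + of_int (M$1$2) * snd p, of_int (M$2$1) * fst p + of_int (M$2$2) * snd p)"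

definition mat2 :: "int \<Rightarrow> int \<Rightarrow> int \<Rightarrow> int \<Rightarrow> int^2^2" where
  "mat2 a b c d = vector [vector [a, b], vector [c, d]]"

lemma mat2_nth [simp]:
  "mat2 a b c d $ 1 $ 1 = a" "mat2 a b c d $ 1 $ 2 = b" "mat2 a b c d $ 2 $ 1 = c" "mat2 a b c d $ 2 $ 2 = d"
  by (simp_all add: mat2_def)

lemma mat2_eta: "mat2 (M$1$1) (M$1$2) (M$2$1) (M$2$2) = M"
  by (simp add: vec_eq_iff forall_2)

lemma det_mat2 [simp]: "det (mat2 a b c d) = a * d - b * c"
  by (simp add: det_2)

lemma lin_mat2 [simp]: "lin (mat2 a b c d) p = (a * fst p + b * snd p, c * fst p + d * snd p)"
  by (simp add: lin_def)

lemma lin_mult: "lin (M ** N) p = lin M (lin N p)"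
  by (simp add: lin_def matrix_matrix_mult_def sum_2 algebra_simps)

lemma GL2Z_mult: "M \<in> GL2Z \<Longrightarrow> N \<in> GL2Z \<Longrightarrow> M ** N \<in> GL2Z"
  by (auto simp: GL2Z_def det_mul)

lemma GL2Z_cases: "M \<in> GL2Z \<Longrightarrow> (det M = 1 \<Longrightarrow> thesis) \<Longrightarrow> (det M = -1 \<Longrightarrow> thesis) \<Longrightarrow> thesis"
  by (auto simp: GL2Z_def)

lemma GL2Z_inverse:
  assumes "M \<in> GL2Z"
  obtains N where "N \<in> GL2Z" "\<And>p. lin N (lin M p) = p"
proof -
  define e where "e = det M"
  \<comment> \<open>The adjugate times the determinant, which is the integral inverse because
    \<open>e * e = 1\<close>.\<close>
  define N where "N = mat2 (e * M$2$2) (- e * M$1$2) (- e * M$2$1) (e * M$1$1)"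
  have e: "e * e = 1" using assms by (auto simp: GL2Z_def e_def)
  have dM: "M$1$1 * M$2$2 - M$1$2 * M$2$1 = e" by (simp add: e_def det_2)
  have "det N = (e * e) * (M$1$1 * M$2$2 - M$1$2 * M$2$1)" by (simp add: N_def algebra_simps)
  then have "N \<in> GL2Z" using assms e dM by (simp add: GL2Z_def e_def)
  moreover have "lin N (lin M p) = p" for p
  proof -
    have "real_of_int e * (M$1$1 * M$2$2 - M$1$2 * M$2$1) = 1"
      using e dM by (metis of_int_1 of_int_diff of_int_mult)
    then have *: "real_of_int e * M$1$1 * M$2$2 = 1 + real_of_int e * M$1$2 * M$2$1" by (simp add: algebra_simps)
    have "fst (lin N (lin M p)) = (real_of_int e * M$1$1 * M$2$2 - real_of_int e * M$1$2 * M$2$1) * fst p"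
      "snd (lin N (lin M p)) = (real_of_int e * M$1$1 * M$2$2 - real_of_int e * M$1$2 * M$2$1) * snd p"
      by (simp_all add: N_def lin_def algebra_simps)
    then show ?thesis unfolding * by (simp add: prod_eq_iff)
  qed
  ultimately show ?thesis using that by blast
qed

lemma wedge_lin: "wedge (lin M p) (lin M q) = det M * wedge p q"
  by (simp add: wedge_def lin_def det_2 algebra_simps)

lemma geo_pt_denom:
  assumes "t \<noteq> 0" "wedge p q \<noteq> 0"
  shows "(snd p)\<^sup>2 + (t * snd q)\<^sup>2 > 0"
  using assms by (auto simp: wedge_def sum_power2_gt_zero_iff)

lemma Im_geo_pt: "Im (geo_pt p q t) = t * wedge p q / ((snd p)\<^sup>2 + (t * snd q)\<^sup>2)"
  by (simp add: geo_pt_def wedge_def Im_divide algebra_simps)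

lemma Re_geo_pt: "Re (geo_pt p q t) = (fst p * snd p + t\<^sup>2 * fst q * snd q) / ((snd p)\<^sup>2 + (t * snd q)\<^sup>2)"
  by (simp add: geo_pt_def Re_divide power2_eq_square algebra_simps)

lemma norm_geo_pt: "(norm (geo_pt p q t))\<^sup>2 = ((fst p)\<^sup>2 + (t * fst q)\<^sup>2) / ((snd p)\<^sup>2 + (t * snd q)\<^sup>2)"
  by (simp add: geo_pt_def norm_divide power_divide cmod_power2)

lemma Im_geo_pt_pos:
  assumes "0 < t * wedge p q"
  shows "Im (geo_pt p q t) > 0"
proof -
  have "t \<noteq> 0" "wedge p q \<noteq> 0" using assms by auto
  then show ?thesis using assms geo_pt_denom[of t p q] by (simp add: Im_geo_pt)
qed

lemma cnj_geo_pt: "cnj (geo_pt p q t) = geo_pt p q (- t)"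
  by (simp add: geo_pt_def complex_cnj_divide complex_eq_iff Re_divide Im_divide)

lemma moebius_geo_pt:
  assumes "t \<noteq> 0" "wedge p q \<noteq> 0"
  shows "(of_int (M$1$1) * geo_pt p q t + of_int (M$1$2)) / (of_int (M$2$1) * geo_pt p q t + of_int (M$2$2))
    = geo_pt (lin M p) (lin M q) t"
proof -
  define m where "m = Complex (snd p) (t * snd q)"
  define n where "n = Complex (fst p) (t * fst q)"
  have m: "m \<noteq> 0" using assms by (auto simp: m_def complex_eq_iff wedge_def)
  have z: "geo_pt p q t = n / m" by (simp add: geo_pt_def m_def n_def)
  have "geo_pt (lin M p) (lin M q) t = (of_int (M$1$1) * n + of_int (M$1$2) * m) / (of_int (M$2$1) * n + of_int (M$2$2) * m)"
    unfolding geo_pt_def lin_def m_def n_def by (intro arg_cong2[where f = "(/)"]) (simp_all add: complex_eq_iff algebra_simps)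
  also have "\<dots> = ((of_int (M$1$1) * n + of_int (M$1$2) * m) / m) / ((of_int (M$2$1) * n + of_int (M$2$2) * m) / m)"
    using m by simp
  also have "\<dots> = (of_int (M$1$1) * (n / m) + of_int (M$1$2)) / (of_int (M$2$1) * (n / m) + of_int (M$2$2))"
    using m by (simp add: add_divide_distrib)
  finally show ?thesis by (simp add: z)
qed

lemma pgl_act_geo_pt:
  fixes t :: real
  assumes "M \<in> GL2Z" "t \<noteq> 0" "wedge p q \<noteq> 0"
  shows "pgl_act M (geo_pt p q t) = geo_pt (lin M p) (lin M q) (det M * t)"
  using assms by (elim GL2Z_cases) (simp_all add: pgl_act_def cnj_geo_pt moebius_geo_pt)

lemma act_dcurve_geo:
  assumes M: "M \<in> GL2Z"
  shows "act_dcurve M (geo p q) = geo (lin M p) (lin M q)"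
proof -
  have dd: "real_of_int (det M) * real_of_int (det M) = 1" using M by (auto simp: GL2Z_def)
  have w: "(real_of_int (det M) * t) * wedge (lin M p) (lin M q) = t * wedge p q" for t
    using dd by (simp add: wedge_lin algebra_simps)
  show ?thesis
  proof (intro equalityI subsetI)
    fix x assume "x \<in> act_dcurve M (geo p q)"
    then obtain s t where st: "x = (pgl_act M (geo_pt p q s), pgl_act M (geo_pt p q t))"
      "0 < s * wedge p q" "s * wedge p q \<le> t * wedge p q"
      by (auto simp: act_dcurve_def geo_def)
    moreover have nz: "s \<noteq> 0" "t \<noteq> 0" "wedge p q \<noteq> 0" using st by auto
    ultimately have "x = (geo_pt (lin M p) (lin M q) (det M * s), geo_pt (lin M p) (lin M q) (det M * t))"
      using pgl_act_geo_pt[OF M nz(1,3)] pgl_act_geo_pt[OF M nz(2,3)] by simp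
    then show "x \<in> geo (lin M p) (lin M q)"
      unfolding geo_def using st(2,3) unfolding w[symmetric] by blast
  next
    fix x assume "x \<in> geo (lin M p) (lin M q)"
    then obtain s t where st: "x = (geo_pt (lin M p) (lin M q) s, geo_pt (lin M p) (lin M q) t)"
      "0 < s * wedge (lin M p) (lin M q)" "s * wedge (lin M p) (lin M q) \<le> t * wedge (lin M p) (lin M q)"
      by (auto simp: geo_def)
    define s' t' where "s' = det M * s" and "t' = det M * t"
    have st': "s = det M * s'" "t = det M * t'" using dd by (simp_all add: s'_def t'_def mult.assoc[symmetric])
    have pos: "0 < s' * wedge p q" "s' * wedge p q \<le> t' * wedge p q" using st(2,3) unfolding st' w .
    have nz: "s' \<noteq> 0" "t' \<noteq> 0" "wedge p q \<noteq> 0" using pos by auto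
    have "x = map_prod (pgl_act M) (pgl_act M) (geo_pt p q s', geo_pt p q t')"
      by (simp only: st(1) st' pgl_act_geo_pt[OF M nz(1,3)] pgl_act_geo_pt[OF M nz(2,3)] map_prod_simp)
    moreover have "(geo_pt p q s', geo_pt p q t') \<in> geo p q" using pos by (auto simp: geo_def)
    ultimately show "x \<in> act_dcurve M (geo p q)" unfolding act_dcurve_def by blast
  qed
qed

text \<open>Exchanging the vectors is the substitution t -> -1 / t: cancel the factor i t in
  numerator and denominator. It is increasing on each half-line while the wedge changes sign, so the
  direction is reversed.\<close>

lemma geo_converse: "geo q p = (geo p q)\<inverse>"
proof -
  have pt: "geo_pt q p t = geo_pt p q (- 1 / t)" if "t \<noteq> 0" for p q t
  proof -
    have eqs: "Complex (fst q) (t * fst p) = Complex 0 t * Complex (fst p) (- 1 / t * fst q)"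
      "Complex (snd q) (t * snd p) = Complex 0 t * Complex (snd p) (- 1 / t * snd q)"
      using that by (simp_all add: complex_eq_iff)
    have "Complex 0 t \<noteq> 0" using that by (simp add: complex_eq_iff)
    then show ?thesis unfolding geo_pt_def eqs by (rule mult_divide_mult_cancel_left)
  qed
  have w: "wedge q p = - wedge p q" for p q by (simp add: wedge_def)
  have "geo q p \<subseteq> (geo p q)\<inverse>" for p q
  proof
    fix x assume "x \<in> geo q p"
    then obtain s t where x: "x = (geo_pt q p s, geo_pt q p t)" "0 < s * wedge q p" "s * wedge q p \<le> t * wedge q p"
      by (auto simp: geo_def)
    have nz: "s \<noteq> 0" "t \<noteq> 0" using x by auto
    have "0 < - 1 / t * wedge p q" "- 1 / t * wedge p q \<le> - 1 / s * wedge p q"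
    proof -
      define a b where "a = s * wedge q p" and "b = t * wedge q p"
      have ab: "0 < a" "a \<le> b" using x by (simp_all add: a_def b_def)
      have "- 1 / t * wedge p q = (wedge q p)\<^sup>2 / b" "- 1 / s * wedge p q = (wedge q p)\<^sup>2 / a"
        using nz ab by (auto simp: a_def b_def w[of q p] field_simps power2_eq_square)
      moreover have "(wedge q p)\<^sup>2 > 0" using ab by (auto simp: a_def)
      ultimately show "0 < - 1 / t * wedge p q" "- 1 / t * wedge p q \<le> - 1 / s * wedge p q"
        using ab by (simp_all add: divide_left_mono)
    qed
    then show "x \<in> (geo p q)\<inverse>" unfolding x(1) pt[OF nz(1), of q p] pt[OF nz(2), of q p] geo_def by blast
  qed
  from this[of q p] this[of p q] show ?thesis by auto
qed

section \<open>Comparison with geodesics given by boundary points\<close>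

definition bdry_vec :: "real option \<Rightarrow> real \<times> real" where
  "bdry_vec \<alpha> = (case \<alpha> of None \<Rightarrow> (1, 0) | Some a \<Rightarrow> (a, 1))"

lemma bdry_vec_simps [simp]: "bdry_vec None = (1, 0)" "bdry_vec (Some a) = (a, 1)"
  by (simp_all add: bdry_vec_def)

lemma wedge_bdry_vec: "\<alpha> \<noteq> \<beta> \<Longrightarrow> wedge (bdry_vec \<alpha>) (bdry_vec \<beta>) \<noteq> 0"
  by (cases \<alpha>; cases \<beta>) (auto simp: wedge_def)

text \<open>The height over a diameter is the geometric mean of its two parts.\<close>

lemma semicircle_iff:
  "z \<in> semicircle a b \<longleftrightarrow> Im z > 0 \<and> (Re z - a) * (b - Re z) = (Im z)\<^sup>2"
proof -
  have "dist z (of_real ((a + b) / 2)) = \<bar>b - a\<bar> / 2 \<longleftrightarrow> (dist z (of_real ((a + b) / 2)))\<^sup>2 = (\<bar>b - a\<bar> / 2)\<^sup>2"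
    by (rule iffI) (simp, rule power2_eq_imp_eq, auto)
  also have "\<dots> \<longleftrightarrow> (Re z - a) * (b - Re z) = (Im z)\<^sup>2"
    unfolding dist_norm cmod_power2 by (auto simp: power2_eq_square field_simps)
  finally show ?thesis by (auto simp: semicircle_def upper_half_plane_def)
qed

lemma geo_semicircle:
  assumes "a \<noteq> b"
  shows "geo (a, 1) (b, 1) = geodesic (Some a) (Some b)"
proof -
  define \<gamma> where "\<gamma> = geo_pt (a, 1) (b, 1)"
  have w: "wedge (a, 1) (b, 1) = b - a" by (simp add: wedge_def)
  have pos: "1 + t\<^sup>2 > 0" for t :: real by (simp add: add_pos_nonneg)
  have Im: "Im (\<gamma> t) = t * (b - a) / (1 + t\<^sup>2)" for t by (simp add: \<gamma>_def Im_geo_pt w)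
  have Re: "Re (\<gamma> t) = (a + t\<^sup>2 * b) / (1 + t\<^sup>2)" for t by (simp add: \<gamma>_def Re_geo_pt)
  have Re': "Re (\<gamma> t) = b - (b - a) / (1 + t\<^sup>2)" for t
    unfolding Re using pos[of t] by (simp add: field_simps)
  have range: "z \<in> semicircle a b \<longleftrightarrow> (\<exists>t. 0 < t * (b - a) \<and> z = \<gamma> t)" for z
  proof
    assume z: "z \<in> semicircle a b"
    define x y where "x = Re z - a" and "y = Im z"
    have y: "y > 0" "x * (b - a - x) = y * y" using z unfolding semicircle_iff x_def y_def by (simp_all add: power2_eq_square)
    \<comment> \<open>On the curve z - a = (b - a) (t^2 + i t) / (1 + t^2), so t is the quotient of
      real and imaginary part of z - a.\<close>
    define t where "t = x / y"
    have x0: "x \<noteq> 0" using y by auto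
    have yy: "y\<^sup>2 + x\<^sup>2 = (b - a) * x" using y(2) by (simp add: power2_eq_square algebra_simps)
    have t1: "1 + t\<^sup>2 = (b - a) * x / y\<^sup>2" using y(1) yy by (simp add: t_def field_simps power2_eq_square)
    have "(b - a) * x > 0" using yy y(1) by (metis add_pos_nonneg zero_less_power zero_le_power2)
    then have "t * (b - a) > 0" using y(1) by (simp add: t_def mult.commute)
    moreover have "z = \<gamma> t"
    proof (rule complex_eqI)
      show "Im z = Im (\<gamma> t)" unfolding Im t1 using y(1) x0 assms by (simp add: t_def y_def[symmetric] field_simps power2_eq_square)
      have "(b - a) / (1 + t\<^sup>2) = y\<^sup>2 / x" unfolding t1 using y(1) x0 assms by simp
      also have "\<dots> = b - a - x" using y(2) x0 by (simp add: field_simps power2_eq_square)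
      finally show "Re z = Re (\<gamma> t)" unfolding Re' by (simp add: x_def)
    qed
    ultimately show "\<exists>t. 0 < t * (b - a) \<and> z = \<gamma> t" by blast
  next
    assume "\<exists>t. 0 < t * (b - a) \<and> z = \<gamma> t"
    then obtain t where t: "0 < t * (b - a)" "z = \<gamma> t" by blast
    have "(Re (\<gamma> t) - a) * (b - Re (\<gamma> t)) = (Im (\<gamma> t))\<^sup>2"
    proof -
      have "Re (\<gamma> t) - a = t\<^sup>2 * (b - a) / (1 + t\<^sup>2)" unfolding Re using pos[of t] by (simp add: field_simps)
      moreover have "b - Re (\<gamma> t) = (b - a) / (1 + t\<^sup>2)" unfolding Re' by simp
      ultimately show ?thesis unfolding Im by (simp add: power2_eq_square)
    qed
    then show "z \<in> semicircle a b" using t pos[of t] by (simp add: semicircle_iff Im)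
  qed
  have order: "s * (b - a) \<le> t * (b - a) \<longleftrightarrow> (if a < b then Re (\<gamma> s) \<le> Re (\<gamma> t) else Re (\<gamma> t) \<le> Re (\<gamma> s))"
    if st: "0 < s * (b - a)" "0 < t * (b - a)" for s t
  proof (cases "a < b")
    case True
    then have "0 < s" "0 < t" using st by (auto simp: zero_less_mult_iff)
    then have "s \<le> t \<longleftrightarrow> s\<^sup>2 \<le> t\<^sup>2" by (simp add: power2_le_iff_abs_le)
    moreover have "Re (\<gamma> s) \<le> Re (\<gamma> t) \<longleftrightarrow> (b - a) / (1 + t\<^sup>2) \<le> (b - a) / (1 + s\<^sup>2)"
      unfolding Re' by linarith
    moreover have "\<dots> \<longleftrightarrow> (b - a) * (1 + s\<^sup>2) \<le> (b - a) * (1 + t\<^sup>2)"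
      using pos[of s] pos[of t] by (simp add: divide_simps mult.commute)
    ultimately show ?thesis using True by (simp add: mult_le_cancel_left_pos mult_le_cancel_right_pos)
  next
    case False
    then have ba: "b < a" using assms by simp
    then have "s < 0" "t < 0" using st by (auto simp: zero_less_mult_iff)
    then have "t \<le> s \<longleftrightarrow> s\<^sup>2 \<le> t\<^sup>2" by (simp add: abs_le_square_iff[symmetric])
    moreover have "Re (\<gamma> t) \<le> Re (\<gamma> s) \<longleftrightarrow> (b - a) / (1 + s\<^sup>2) \<le> (b - a) / (1 + t\<^sup>2)"
      unfolding Re' by linarith
    moreover have "\<dots> \<longleftrightarrow> (b - a) * (1 + t\<^sup>2) \<le> (b - a) * (1 + s\<^sup>2)"
      using pos[of s] pos[of t] by (simp add: divide_simps mult.commute)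
    ultimately show ?thesis using ba by (simp add: mult_le_cancel_left_neg mult_le_cancel_right_neg)
  qed
  have "geo (a, 1) (b, 1) = {(z, z'). z \<in> semicircle a b \<and> z' \<in> semicircle a b \<and> (if a < b then Re z \<le> Re z' else Re z' \<le> Re z)}"
    unfolding geo_def w \<gamma>_def[symmetric] range
  proof (intro equalityI subsetI)
    fix x assume "x \<in> {(\<gamma> s, \<gamma> t) |s t. 0 < s * (b - a) \<and> s * (b - a) \<le> t * (b - a)}"
    then obtain s t where st: "x = (\<gamma> s, \<gamma> t)" "0 < s * (b - a)" "s * (b - a) \<le> t * (b - a)" by blast
    then have "0 < t * (b - a)" by linarith
    then show "x \<in> {(z, z'). (\<exists>t. 0 < t * (b - a) \<and> z = \<gamma> t) \<and> (\<exists>t. 0 < t * (b - a) \<and> z' = \<gamma> t)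
        \<and> (if a < b then Re z \<le> Re z' else Re z' \<le> Re z)}"
      using order[of s t] st by blast
  next
    fix x assume "x \<in> {(z, z'). (\<exists>t. 0 < t * (b - a) \<and> z = \<gamma> t) \<and> (\<exists>t. 0 < t * (b - a) \<and> z' = \<gamma> t)
        \<and> (if a < b then Re z \<le> Re z' else Re z' \<le> Re z)}"
    then obtain s t where st: "x = (\<gamma> s, \<gamma> t)" "0 < s * (b - a)" "0 < t * (b - a)"
      "if a < b then Re (\<gamma> s) \<le> Re (\<gamma> t) else Re (\<gamma> t) \<le> Re (\<gamma> s)" by blast
    then show "x \<in> {(\<gamma> s, \<gamma> t) |s t. 0 < s * (b - a) \<and> s * (b - a) \<le> t * (b - a)}"
      using order[of s t] by blast
  qed
  then show ?thesis by simp
qed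

lemma geo_vertical: "geo (a, 1) (1, 0) = geodesic (Some a) None"
proof -
  have "geo_pt (a, 1) (1, 0) t = Complex a t" for t by (simp add: geo_pt_def complex_eq_iff Re_divide Im_divide)
  moreover have "wedge (a, 1) (1, 0) = 1" by (simp add: wedge_def)
  ultimately show ?thesis
    unfolding geo_def by (auto simp: vertical_line_def upper_half_plane_def complex_eq_iff)
qed

lemma geo_bdry_vec:
  assumes "\<alpha> \<noteq> \<beta>"
  shows "geo (bdry_vec \<alpha>) (bdry_vec \<beta>) = geodesic \<alpha> \<beta>"
proof -
  have "geo (1, 0) (b, 1) = geodesic None (Some b)" for b
    unfolding geo_converse[of "(1, 0)"] geo_vertical geodesic.simps by blast
  then show ?thesis using assms geo_semicircle geo_vertical
    by (cases \<alpha>; cases \<beta>) (simp_all del: geodesic.simps)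
qed

text \<open>Scaling the vectors rescales the parameter by d / c; if this is negative, parameter and
  wedge change sign together.\<close>

lemma geo_scale:
  assumes "c \<noteq> 0" "d \<noteq> 0"
  shows "geo (c * fst p, c * snd p) (d * fst q, d * snd q) = geo p q"
proof -
  have sub: "geo (c * fst p, c * snd p) (d * fst q, d * snd q) \<subseteq> geo p q" if "c \<noteq> 0" "d \<noteq> 0" for c d p q
  proof
    fix x assume "x \<in> geo (c * fst p, c * snd p) (d * fst q, d * snd q)"
    then obtain s t where x: "x = (geo_pt (c * fst p, c * snd p) (d * fst q, d * snd q) s, geo_pt (c * fst p, c * snd p) (d * fst q, d * snd q) t)"
      and st: "0 < s * wedge (c * fst p, c * snd p) (d * fst q, d * snd q)"
       "s * wedge (c * fst p, c * snd p) (d * fst q, d * snd q) \<le> t * wedge (c * fst p, c * snd p) (d * fst q, d * snd q)"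
      unfolding geo_def by blast
    have pt: "geo_pt (c * fst p, c * snd p) (d * fst q, d * snd q) t = geo_pt p q (t * d / c)" for t
    proof -
      have eqs: "Complex (c * fst p) (t * (d * fst q)) = of_real c * Complex (fst p) (t * d / c * fst q)"
        "Complex (c * snd p) (t * (d * snd q)) = of_real c * Complex (snd p) (t * d / c * snd q)"
        using that by (simp_all add: complex_eq_iff)
      show ?thesis unfolding geo_pt_def fst_conv snd_conv eqs using that by (intro mult_divide_mult_cancel_left) simp
    qed
    have w: "t * wedge (c * fst p, c * snd p) (d * fst q, d * snd q) = c\<^sup>2 * ((t * d / c) * wedge p q)" for t
      using that by (simp add: wedge_def power2_eq_square algebra_simps)
    have c2: "c\<^sup>2 > 0" using that by simp
    have "0 < (s * d / c) * wedge p q" using st(1) c2 unfolding w by (metis zero_less_mult_pos)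
    moreover have "(s * d / c) * wedge p q \<le> (t * d / c) * wedge p q"
      using st(2) unfolding w by (rule mult_left_le_imp_le) (rule c2)
    ultimately show "x \<in> geo p q" unfolding x pt geo_def by blast
  qed
  have "geo p q \<subseteq> geo (c * fst p, c * snd p) (d * fst q, d * snd q)"
    using sub[of "1 / c" "1 / d" "(c * fst p, c * snd p)" "(d * fst q, d * snd q)"] assms by simp
  then show ?thesis using sub[OF assms] by blast
qed

section \<open>Billiards\<close>

definition vec_billiard :: "real \<times> real \<Rightarrow> real \<times> real \<Rightarrow> dcurve set" where
  "vec_billiard p q = {geo (lin M p) (lin M q) \<inter> (mod_triangle \<times> mod_triangle) | M. M \<in> GL2Z} - {{}}"

lemma billiard_eq_vec_billiard:
  "\<alpha> \<noteq> \<beta> \<Longrightarrow> billiard \<alpha> \<beta> = vec_billiard (bdry_vec \<alpha>) (bdry_vec \<beta>)"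
  unfolding billiard_def induced_billiard_def vec_billiard_def
  by (simp add: geo_bdry_vec[symmetric] act_dcurve_geo Setcompr_eq_image cong: image_cong_simp)

lemma vec_billiard_lin:
  assumes "g \<in> GL2Z"
  shows "vec_billiard (lin g p) (lin g q) = vec_billiard p q"
proof -
  have sub: "vec_billiard (lin g p) (lin g q) \<subseteq> vec_billiard p q" if "g \<in> GL2Z" for g p q
    unfolding vec_billiard_def lin_mult[symmetric] using that GL2Z_mult by blast
  obtain h where h: "h \<in> GL2Z" "\<And>p. lin h (lin g p) = p" using GL2Z_inverse[OF assms] by metis
  show ?thesis using sub[OF assms, of p q] sub[OF h(1), of "lin g p" "lin g q"] h(2) by simp
qed

lemma vec_billiard_scale:
  assumes "c \<noteq> 0" "d \<noteq> 0"
  shows "vec_billiard (c * fst p, c * snd p) (d * fst q, d * snd q) = vec_billiard p q"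
proof -
  have l: "lin M (c * fst p, c * snd p) = (c * fst (lin M p), c * snd (lin M p))" for M c p
    by (simp add: lin_def algebra_simps)
  show ?thesis unfolding vec_billiard_def l geo_scale[OF assms] ..
qed

lemma vec_billiard_swap: "vec_billiard q p = converse ` vec_billiard p q"
proof -
  have "geo (lin M q) (lin M p) \<inter> (mod_triangle \<times> mod_triangle) = converse (geo (lin M p) (lin M q) \<inter> (mod_triangle \<times> mod_triangle))" for M
    by (auto simp: geo_converse[of "lin M q"])
  moreover have "inj (converse :: dcurve \<Rightarrow> dcurve)" by (rule injI) (metis converse_converse)
  ultimately show ?thesis
    by (simp only: vec_billiard_def Setcompr_eq_image image_set_diff image_image) simp
qed

lemma billiard_swap: "\<alpha> \<noteq> \<beta> \<Longrightarrow> billiard \<beta> \<alpha> = converse ` billiard \<alpha> \<beta>"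
  using billiard_eq_vec_billiard[of \<alpha> \<beta>] billiard_eq_vec_billiard[of \<beta> \<alpha>]
    vec_billiard_swap[of "bdry_vec \<beta>" "bdry_vec \<alpha>"] by simp

text \<open>The definite description is well defined: by \<open>billiard_swap\<close> the reversed
  billiard consists of the converse segments, whichever endpoints induce it.\<close>

lemma reversal_eq:
  assumes "\<alpha> \<noteq> \<beta>"
  shows "reversal (billiard \<alpha> \<beta>) = billiard \<beta> \<alpha>"
  unfolding reversal_def
proof (intro the_equality)
  show "\<exists>\<alpha>' \<beta>'. \<alpha>' \<noteq> \<beta>' \<and> billiard \<alpha> \<beta> = billiard \<alpha>' \<beta>' \<and> billiard \<beta> \<alpha> = billiard \<beta>' \<alpha>'"
    using assms by blast
  show "B' = billiard \<beta> \<alpha>" if "\<exists>\<alpha>' \<beta>'. \<alpha>' \<noteq> \<beta>' \<and> billiard \<alpha> \<beta> = billiard \<alpha>' \<beta>' \<and> B' = billiard \<beta>' \<alpha>'" for B'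
    using that billiard_swap assms by metis
qed

lemma billiard_lin:
  assumes "g \<in> GL2Z" "\<alpha> \<noteq> \<beta>" "\<alpha>' \<noteq> \<beta>'" "c \<noteq> 0" "d \<noteq> 0"
    and "lin g (bdry_vec \<alpha>) = (c * fst (bdry_vec \<alpha>'), c * snd (bdry_vec \<alpha>'))"
    and "lin g (bdry_vec \<beta>) = (d * fst (bdry_vec \<beta>'), d * snd (bdry_vec \<beta>'))"
  shows "billiard \<alpha>' \<beta>' = billiard \<alpha> \<beta>"
  using assms vec_billiard_lin[OF assms(1), of "bdry_vec \<alpha>" "bdry_vec \<beta>"]
  by (simp add: billiard_eq_vec_billiard vec_billiard_scale)

lemma billiard_shift:
  "x \<noteq> y \<Longrightarrow> billiard (Some (x + of_int n)) (Some (y + of_int n)) = billiard (Some x) (Some y)"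
  by (rule billiard_lin[of "mat2 1 n 0 1" _ _ _ _ 1 1]) (simp_all add: GL2Z_def)

lemma billiard_neg:
  "x \<noteq> y \<Longrightarrow> billiard (Some (- x)) (Some (- y)) = billiard (Some x) (Some y)"
  by (rule billiard_lin[of "mat2 (-1) 0 0 1" _ _ _ _ 1 1]) (simp_all add: GL2Z_def)

lemma billiard_inverse:
  "x \<noteq> y \<Longrightarrow> x \<noteq> 0 \<Longrightarrow> y \<noteq> 0 \<Longrightarrow> billiard (Some (1 / x)) (Some (1 / y)) = billiard (Some x) (Some y)"
  by (rule billiard_lin[of "mat2 0 1 1 0" _ _ _ _ x y]) (simp_all add: GL2Z_def)

lemma billiard_inverse_infinity:
  "x \<noteq> 0 \<Longrightarrow> billiard (Some 0) (Some (1 / x)) = billiard None (Some x)"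
  by (rule billiard_lin[of "mat2 0 1 1 0" _ _ _ _ 1 x]) (simp_all add: GL2Z_def)

section \<open>The distance of a billiard from \<open>\<i>\<close>\<close>

text \<open>Twice the hyperbolic cosine of the distance from \<open>\<i>\<close>.\<close>

definition i_size :: "complex \<Rightarrow> real" where
  "i_size z = ((norm z)\<^sup>2 + 1) / Im z"

definition nrm2 :: "real \<times> real \<Rightarrow> real" where
  "nrm2 p = (fst p)\<^sup>2 + (snd p)\<^sup>2"

definition dot :: "real \<times> real \<Rightarrow> real \<times> real \<Rightarrow> real" where
  "dot p q = fst p * fst q + snd p * snd q"

lemma lagrange_identity: "nrm2 p * nrm2 q = (wedge p q)\<^sup>2 + (dot p q)\<^sup>2"
  by (simp add: nrm2_def dot_def wedge_def power2_eq_square algebra_simps)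

lemma nrm2_nonneg: "nrm2 p \<ge> 0"
  by (simp add: nrm2_def)

text \<open>By the inequality of the means and \<open>lagrange_identity\<close>, the minimum over t
  is 2 sqrt (1 + (dot p q / wedge p q)^2). So |dot p q| / |wedge p q| is the sinh of the distance of
  the whole geodesic from \<i>.\<close>

lemma i_size_geo_pt:
  assumes "0 < t * wedge p q"
  shows "i_size (geo_pt p q t) = (nrm2 p + t\<^sup>2 * nrm2 q) / (t * wedge p q)"
proof -
  define m where "m = (snd p)\<^sup>2 + (t * snd q)\<^sup>2"
  have "t \<noteq> 0" "wedge p q \<noteq> 0" using assms by auto
  then have m: "m > 0" using geo_pt_denom[of t p q] by (simp add: m_def)
  have "i_size (geo_pt p q t) = (((fst p)\<^sup>2 + (t * fst q)\<^sup>2) / m + 1) / (t * wedge p q / m)"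
    by (simp add: i_size_def norm_geo_pt Im_geo_pt m_def)
  also have "((fst p)\<^sup>2 + (t * fst q)\<^sup>2) / m + 1 = ((fst p)\<^sup>2 + (t * fst q)\<^sup>2 + m) / m"
    using m by (simp add: add_divide_distrib)
  also have "\<dots> / (t * wedge p q / m) = ((fst p)\<^sup>2 + (t * fst q)\<^sup>2 + m) / (t * wedge p q)"
    using m by simp
  also have "(fst p)\<^sup>2 + (t * fst q)\<^sup>2 + m = nrm2 p + t\<^sup>2 * nrm2 q"
    by (simp add: m_def nrm2_def power_mult_distrib algebra_simps)
  finally show ?thesis .
qed

lemma cosh_hyp_dist_i_size: "Im z > 0 \<Longrightarrow> cosh (hyp_dist \<i> z) = i_size z / 2"
  by (simp add: cosh_hyp_dist_i i_size_def)

text \<open>A point is treated as the point with parameter 1 on the vertical line through it, so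
  that the linear action on vectors applies to points too.\<close>

lemma geo_pt_point: "Im z > 0 \<Longrightarrow> geo_pt (Re z, 1) (Im z, 0) 1 = z \<and> wedge (Re z, 1) (Im z, 0) = Im z"
  by (simp add: geo_pt_def wedge_def complex_eq_iff Re_divide Im_divide)

lemma pgl_act_point:
  "M \<in> GL2Z \<Longrightarrow> Im z > 0 \<Longrightarrow> pgl_act M z = geo_pt (lin M (Re z, 1)) (lin M (Im z, 0)) (det M)"
  using pgl_act_geo_pt[where M = M and t = 1 and p = "(Re z, 1)" and q = "(Im z, 0)"] geo_pt_point[of z] by simp

lemma det_wedge_pos:
  fixes t :: real
  assumes "M \<in> GL2Z" "0 < t * wedge p q"
  shows "0 < (det M * t) * wedge (lin M p) (lin M q)"
  using assms by (elim GL2Z_cases) (simp_all add: wedge_lin)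

lemma Im_pgl_act_pos: "M \<in> GL2Z \<Longrightarrow> Im z > 0 \<Longrightarrow> Im (pgl_act M z) > 0"
  using det_wedge_pos[of M 1 "(Re z, 1)" "(Im z, 0)"] geo_pt_point[of z]
  by (simp add: pgl_act_point Im_geo_pt_pos)

lemma pgl_act_mult:
  assumes "M \<in> GL2Z" "N \<in> GL2Z" "Im z > 0"
  shows "pgl_act M (pgl_act N z) = pgl_act (M ** N) z"
proof -
  have "0 < real_of_int (det N) * wedge (lin N (Re z, 1)) (lin N (Im z, 0))"
    using assms geo_pt_point[of z] det_wedge_pos[of N 1 "(Re z, 1)" "(Im z, 0)"] by simp
  then have "det N \<noteq> 0" "wedge (lin N (Re z, 1)) (lin N (Im z, 0)) \<noteq> 0" by auto
  then have "pgl_act M (geo_pt (lin N (Re z, 1)) (lin N (Im z, 0)) (det N))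
      = geo_pt (lin M (lin N (Re z, 1))) (lin M (lin N (Im z, 0))) (det M * det N)"
    using pgl_act_geo_pt[OF assms(1), where t = "real_of_int (det N)"] by simp
  then show ?thesis using assms by (simp add: pgl_act_point GL2Z_mult lin_mult det_mul)
qed

lemma i_size_pgl_act:
  assumes "M \<in> GL2Z" "Im z > 0"
  shows "i_size (pgl_act M z) = (nrm2 (lin M (Re z, 1)) + nrm2 (lin M (Im z, 0))) / Im z"
proof -
  have "real_of_int (det M) * real_of_int (det M) = 1" using assms by (auto simp: GL2Z_def)
  then have "(real_of_int (det M))\<^sup>2 = 1" "real_of_int (det M) * wedge (lin M (Re z, 1)) (lin M (Im z, 0)) = Im z"
    using geo_pt_point[OF assms(2)] by (simp_all add: power2_eq_square wedge_lin mult.assoc[symmetric])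
  then show ?thesis
    using assms i_size_geo_pt[of "det M" "lin M (Re z, 1)" "lin M (Im z, 0)"] by (simp add: pgl_act_point)
qed

section \<open>Folding the half-plane into the triangle\<close>

lemma finite_bounded_ints: "finite {n :: int. \<bar>real_of_int n\<bar> \<le> R}"
proof (rule finite_subset)
  show "{n :: int. \<bar>real_of_int n\<bar> \<le> R} \<subseteq> {- \<lceil>R\<rceil>..\<lceil>R\<rceil>}" by (auto simp: abs_le_iff) linarith+
qed simp

lemma abs_int_le_square: "\<bar>real_of_int n\<bar> \<le> (real_of_int n)\<^sup>2"
proof (cases "n = 0")
  case False
  then have "1 \<le> \<bar>real_of_int n\<bar>" by linarith
  then show ?thesis using mult_left_mono[of 1 "\<bar>real_of_int n\<bar>" "\<bar>real_of_int n\<bar>"] by (simp add: power2_eq_square)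
qed simp

text \<open>The sum is |a z + b|^2 + |c z + d|^2, a positive definite form in the matrix
  entries.\<close>

lemma finite_small_orbit:
  assumes z: "Im z > 0"
  shows "finite {M \<in> GL2Z. nrm2 (lin M (Re z, 1)) + nrm2 (lin M (Im z, 0)) \<le> K}"
proof -
  define A where "A = K / (Im z)\<^sup>2"
  define R where "R = A + (K + 1 + A * \<bar>Re z\<bar>)"
  define I where "I = {n :: int. \<bar>real_of_int n\<bar> \<le> R}"
  have row: "a \<in> I \<and> b \<in> I"
    if "(a * Re z + b)\<^sup>2 + (a * Im z)\<^sup>2 \<le> K" for a b :: int
  proof -
    have a: "(a * Im z)\<^sup>2 \<le> K" and ab: "(a * Re z + b)\<^sup>2 \<le> K" and K: "K \<ge> 0"
      using that zero_le_power2[of "a * Re z + b"] zero_le_power2[of "a * Im z"] by linarith+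
    have "(real_of_int a)\<^sup>2 \<le> A" using a z by (simp add: A_def field_simps)
    then have a': "\<bar>real_of_int a\<bar> \<le> A" using abs_int_le_square[of a] by linarith
    define u where "u = a * Re z + b"
    have "0 \<le> (\<bar>u\<bar> - 1)\<^sup>2" by simp
    then have "2 * \<bar>u\<bar> \<le> u\<^sup>2 + 1" by (simp add: power2_diff)
    then have "\<bar>a * Re z + b\<bar> \<le> K + 1" using ab K unfolding u_def[symmetric] by linarith
    moreover have "\<bar>a * Re z\<bar> \<le> A * \<bar>Re z\<bar>" using a' by (simp add: abs_mult mult_right_mono)
    moreover have "0 \<le> A" using a' by linarith
    moreover have "0 \<le> A * \<bar>Re z\<bar>" using \<open>0 \<le> A\<close> by simp
    ultimately show ?thesis using a' K unfolding I_def R_def by simp linarith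
  qed
  have "{M \<in> GL2Z. nrm2 (lin M (Re z, 1)) + nrm2 (lin M (Im z, 0)) \<le> K}
    \<subseteq> (\<lambda>(a, b, c, d). mat2 a b c d) ` (I \<times> I \<times> I \<times> I)"
  proof
    fix M assume "M \<in> {M \<in> GL2Z. nrm2 (lin M (Re z, 1)) + nrm2 (lin M (Im z, 0)) \<le> K}"
    then have le: "(M$1$1 * Re z + M$1$2)\<^sup>2 + (M$1$1 * Im z)\<^sup>2 + ((M$2$1 * Re z + M$2$2)\<^sup>2 + (M$2$1 * Im z)\<^sup>2) \<le> K"
      by (simp add: nrm2_def lin_def)
    have nonneg: "0 \<le> (a * Re z + b)\<^sup>2 + (a * Im z)\<^sup>2" for a b :: int by simp
    have "M$1$1 \<in> I \<and> M$1$2 \<in> I" "M$2$1 \<in> I \<and> M$2$2 \<in> I"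
      using le nonneg[of "M$1$1" "M$1$2"] nonneg[of "M$2$1" "M$2$2"] by (intro row; linarith)+
    then have "(M$1$1, M$1$2, M$2$1, M$2$2) \<in> I \<times> I \<times> I \<times> I" by simp
    then show "M \<in> (\<lambda>(a, b, c, d). mat2 a b c d) ` (I \<times> I \<times> I \<times> I)"
      by (rule rev_image_eqI) (simp add: mat2_eta)
  qed
  moreover have "finite I" unfolding I_def by (rule finite_bounded_ints)
  then have "finite ((\<lambda>(a, b, c, d). mat2 a b c d) ` (I \<times> I \<times> I \<times> I))" by simp
  ultimately show ?thesis by (rule finite_subset)
qed

lemma mat_1_GL2Z: "mat 1 \<in> GL2Z" "lin (mat 1) p = p"
  by (simp add: GL2Z_def) (simp add: lin_def mat_def)

lemma pgl_act_mat_1: "pgl_act (mat 1) z = z"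
proof -
  have "(mat 1 :: int^2^2) $ 1 $ 1 = 1" "(mat 1 :: int^2^2) $ 1 $ 2 = 0"
    "(mat 1 :: int^2^2) $ 2 $ 1 = 0" "(mat 1 :: int^2^2) $ 2 $ 2 = 1" by (simp_all add: mat_def)
  then show ?thesis by (simp add: pgl_act_def)
qed

text \<open>Take an orbit point nearest to \<i>. The maps z -> 1 / cnj z and z -> - cnj z fix \<i>,
  so they bring it to norm \<ge> 1 and Re \<ge> 0 without changing its distance; as z -> z - 1
  cannot bring it nearer, Re \<le> 1 / 2. The bound on \<open>i_size\<close> then comes for
  free.\<close>

lemma fold_to_triangle:
  assumes z: "Im z > 0"
  obtains g where "g \<in> GL2Z" "pgl_act g z \<in> mod_triangle" "i_size (pgl_act g z) \<le> i_size z"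
proof -
  define V where "V M = nrm2 (lin M (Re z, 1)) + nrm2 (lin M (Im z, 0))" for M
  define F where "F = {M \<in> GL2Z. V M \<le> V (mat 1)}"
  have F: "finite F" "mat 1 \<in> F" using finite_small_orbit[OF z] mat_1_GL2Z by (auto simp: F_def V_def)
  have "Min (V ` F) \<in> V ` F" using F by (intro Min_in) auto
  then obtain M0 where M0: "M0 \<in> F" "V M0 = Min (V ` F)" by auto
  have minF: "V M0 \<le> V M" if "M \<in> F" for M using that F M0 by simp
  have minV: "V M0 \<le> V M" if "M \<in> GL2Z" for M
    using minF[of M] minF[OF F(2)] that unfolding F_def by force
  have size: "i_size (pgl_act M z) = V M / Im z" if "M \<in> GL2Z" for M
    using i_size_pgl_act[OF that z] by (simp add: V_def)
  have gM0: "M0 \<in> GL2Z" using M0 by (simp add: F_def)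
  define Orb where "Orb = {pgl_act M z | M. M \<in> GL2Z}"
  have Orb_act: "pgl_act N w \<in> Orb" if "w \<in> Orb" "N \<in> GL2Z" for w N
    using that pgl_act_mult[OF that(2) _ z] GL2Z_mult[OF that(2)] unfolding Orb_def by blast
  define z0 where "z0 = pgl_act M0 z"
  have z0: "z0 \<in> Orb" using gM0 by (auto simp: Orb_def z0_def)
  have pos: "Im w > 0" if "w \<in> Orb" for w using that Im_pgl_act_pos z by (auto simp: Orb_def)
  have min: "i_size z0 \<le> i_size w" if "w \<in> Orb" for w
    using that minV z gM0 unfolding Orb_def z0_def by (auto simp: size divide_right_mono)
  have inv: "1 / cnj w \<in> Orb" if "w \<in> Orb" for w
    using Orb_act[OF that, of "mat2 0 1 1 0"] by (simp add: GL2Z_def pgl_act_def)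
  have refl: "- cnj w \<in> Orb" if "w \<in> Orb" for w
    using Orb_act[OF that, of "mat2 (-1) 0 0 1"] by (simp add: GL2Z_def pgl_act_def)
  have trans: "w - 1 \<in> Orb" if "w \<in> Orb" for w
    using Orb_act[OF that, of "mat2 1 (-1) 0 1"] by (simp add: GL2Z_def pgl_act_def)
  have size_inv: "i_size (1 / cnj w) = i_size w" if "Im w > 0" for w
  proof -
    have w0: "w \<noteq> 0" using that by auto
    have "Im (1 / cnj w) = Im w / (norm w)\<^sup>2" by (simp add: Im_divide cmod_power2)
    moreover have "(norm (1 / cnj w))\<^sup>2 = 1 / (norm w)\<^sup>2" by (simp add: norm_divide power_divide)
    moreover have "(norm w)\<^sup>2 > 0" using w0 by simp
    ultimately show ?thesis using that unfolding i_size_def by (simp only:) (simp add: field_simps)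
  qed
  define z1 where "z1 = (if norm z0 < 1 then 1 / cnj z0 else z0)"
  have z1: "z1 \<in> Orb" "i_size z1 = i_size z0" "norm z1 \<ge> 1"
  proof -
    have "z0 \<noteq> 0" using pos[OF z0] by auto
    then show "norm z1 \<ge> 1" by (simp add: z1_def norm_divide field_simps)
  qed (use inv z0 size_inv pos in \<open>auto simp: z1_def\<close>)
  define z2 where "z2 = (if Re z1 < 0 then - cnj z1 else z1)"
  have z2: "z2 \<in> Orb" "i_size z2 = i_size z0" "norm z2 \<ge> 1" "Re z2 \<ge> 0"
    using refl z1 by (auto simp: z2_def i_size_def)
  have "i_size z2 \<le> i_size (z2 - 1)" using min[OF trans[OF z2(1)]] z2(2) by simp
  then have "(norm z2)\<^sup>2 + 1 \<le> (norm (z2 - 1))\<^sup>2 + 1"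
    using pos[OF z2(1)] by (simp add: i_size_def divide_le_cancel)
  then have "Re z2 \<le> 1 / 2" unfolding cmod_power2 by (simp add: power2_eq_square algebra_simps)
  then have T: "z2 \<in> mod_triangle" using z2 pos[OF z2(1)] by (simp add: mod_triangle_def upper_half_plane_def)
  obtain g where g: "g \<in> GL2Z" "z2 = pgl_act g z" using z2(1) by (auto simp: Orb_def)
  have "pgl_act (mat 1) z \<in> Orb" unfolding Orb_def using mat_1_GL2Z(1) by blast
  then have "z \<in> Orb" by (simp only: pgl_act_mat_1)
  then show ?thesis using that[OF g(1)] T g(2) min z2(2) by simp
qed

section \<open>The distance of a billiard in terms of its endpoint vectors\<close>

lemma Field_geo_cut:
  assumes "wedge p q \<noteq> 0"
  shows "Field (geo p q \<inter> (mod_triangle \<times> mod_triangle)) = {geo_pt p q t | t. 0 < t * wedge p q} \<inter> mod_triangle"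
proof -
  have "(geo_pt p q s, geo_pt p q s) \<in> geo p q" if "0 < s * wedge p q" for s
    using that unfolding geo_def by blast
  moreover have "0 < t * wedge p q" if "0 < s * wedge p q" "s * wedge p q \<le> t * wedge p q" for s t using that by linarith
  ultimately show ?thesis unfolding Field_def geo_def by blast
qed

lemma billiard_points_vec_billiard:
  assumes "wedge p q \<noteq> 0"
  shows "billiard_points (vec_billiard p q) =
    {geo_pt (lin M p) (lin M q) t | M t. M \<in> GL2Z \<and> 0 < t * wedge (lin M p) (lin M q)} \<inter> mod_triangle"
proof -
  have w: "wedge (lin M p) (lin M q) \<noteq> 0" if "M \<in> GL2Z" for M
    using that assms by (auto simp: wedge_lin GL2Z_def)
  have "billiard_points (vec_billiard p q) = (\<Union>M\<in>GL2Z. Field (geo (lin M p) (lin M q) \<inter> (mod_triangle \<times> mod_triangle)))"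
    unfolding billiard_points_def vec_billiard_def by (auto simp: Field_def)
  also have "\<dots> = (\<Union>M\<in>GL2Z. {geo_pt (lin M p) (lin M q) t | t. 0 < t * wedge (lin M p) (lin M q)} \<inter> mod_triangle)"
    by (intro SUP_cong refl Field_geo_cut w)
  finally show ?thesis by blast
qed

lemma mod_triangle_Im_pos: "z \<in> mod_triangle \<Longrightarrow> Im z > 0"
  by (simp add: mod_triangle_def upper_half_plane_def)

lemma fold_billiard_point:
  assumes w: "0 < t * wedge p q"
  obtains z where "z \<in> billiard_points (vec_billiard p q)" "i_size z \<le> i_size (geo_pt p q t)"
proof -
  obtain g where g: "g \<in> GL2Z" "pgl_act g (geo_pt p q t) \<in> mod_triangle"
    "i_size (pgl_act g (geo_pt p q t)) \<le> i_size (geo_pt p q t)"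
    using fold_to_triangle[OF Im_geo_pt_pos[OF w]] .
  have "pgl_act g (geo_pt p q t) = geo_pt (lin g p) (lin g q) (det g * t)"
    using w by (intro pgl_act_geo_pt[OF g(1)]) auto
  moreover have "0 < (det g * t) * wedge (lin g p) (lin g q)" by (rule det_wedge_pos[OF g(1) w])
  moreover have "wedge p q \<noteq> 0" using w by auto
  ultimately show ?thesis using that g by (auto simp: billiard_points_vec_billiard)
qed

lemma delta_nonneg: "wedge p q \<noteq> 0 \<Longrightarrow> delta \<i> (vec_billiard p q) \<ge> 0"
proof -
  assume w: "wedge p q \<noteq> 0"
  have "0 < wedge p q * wedge p q" using w by (metis not_square_less_zero not_less_iff_gr_or_eq mult_eq_0_iff)
  from fold_billiard_point[OF this] have "billiard_points (vec_billiard p q) \<noteq> {}" by blast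
  then show ?thesis unfolding delta_def
    using cosh_hyp_dist_i(2) mod_triangle_Im_pos billiard_points_vec_billiard[OF w] by (intro cINF_greatest) auto
qed

lemma sinh_delta_le:
  assumes w: "wedge p q \<noteq> 0"
  shows "sinh (delta \<i> (vec_billiard p q)) \<le> \<bar>dot p q\<bar> / \<bar>wedge p q\<bar>"
proof -
  have np: "nrm2 p > 0" and nq: "nrm2 q > 0"
    using lagrange_identity[of p q] w nrm2_nonneg[of p] nrm2_nonneg[of q]
    by (metis add_pos_nonneg less_eq_real_def mult_zero_left mult_zero_right less_irrefl zero_le_power2 zero_less_power2)+
  \<comment> \<open>The parameter of the point nearest to \<i>, where nrm2 p = t^2 nrm2 q; the sign
    puts it into the upper half-plane.\<close>
  define t where "t = sgn (wedge p q) * sqrt (nrm2 p / nrm2 q)"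
  have t2: "t\<^sup>2 * nrm2 q = nrm2 p" using w np nq by (simp add: t_def power_mult_distrib sgn_if)
  have tw: "t * wedge p q = sqrt (nrm2 p / nrm2 q) * \<bar>wedge p q\<bar>" by (simp add: t_def sgn_if abs_if)
  then have pos: "0 < t * wedge p q" using w np nq by simp
  obtain z where z: "z \<in> billiard_points (vec_billiard p q)" "i_size z \<le> i_size (geo_pt p q t)"
    using fold_billiard_point[OF pos] .
  have Imz: "Im z > 0" using z(1) mod_triangle_Im_pos by (auto simp: billiard_points_vec_billiard[OF w])
  have "bdd_below (hyp_dist \<i> ` billiard_points (vec_billiard p q))"
    using cosh_hyp_dist_i(2) mod_triangle_Im_pos billiard_points_vec_billiard[OF w] by (intro bdd_belowI[of _ 0]) auto
  then have "delta \<i> (vec_billiard p q) \<le> hyp_dist \<i> z"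
    unfolding delta_def using z(1) by (rule cINF_lower)
  then have "sinh (delta \<i> (vec_billiard p q)) \<le> sinh (hyp_dist \<i> z)" by simp
  also have "\<dots> \<le> \<bar>dot p q\<bar> / \<bar>wedge p q\<bar>"
  proof (rule power2_le_imp_le)
    have "i_size (geo_pt p q t) / 2 = nrm2 p / (sqrt (nrm2 p / nrm2 q) * \<bar>wedge p q\<bar>)"
      using pos by (simp add: i_size_geo_pt t2 tw)
    also have "\<dots>\<^sup>2 = nrm2 p * nrm2 q / (wedge p q)\<^sup>2"
      using np nq by (simp add: power_divide power_mult_distrib) (simp add: power2_eq_square)
    also have "\<dots> = 1 + (dot p q)\<^sup>2 / (wedge p q)\<^sup>2"
      using w by (simp add: lagrange_identity add_divide_distrib)
    finally have "(i_size (geo_pt p q t) / 2)\<^sup>2 = 1 + (dot p q)\<^sup>2 / (wedge p q)\<^sup>2" .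
    moreover have "(i_size z / 2)\<^sup>2 \<le> (i_size (geo_pt p q t) / 2)\<^sup>2"
      using z(2) Imz by (intro power_mono) (auto simp: i_size_def)
    moreover have "(cosh (hyp_dist \<i> z))\<^sup>2 = (i_size z / 2)\<^sup>2" using cosh_hyp_dist_i_size[OF Imz] by (simp only:)
    ultimately show "(sinh (hyp_dist \<i> z))\<^sup>2 \<le> (\<bar>dot p q\<bar> / \<bar>wedge p q\<bar>)\<^sup>2"
      using cosh_square_eq[of "hyp_dist \<i> z"] unfolding power_divide[of "\<bar>dot p q\<bar>"] power2_abs by linarith
  qed (use w in simp)
  finally show ?thesis .
qed

lemma sinh_delta_ge:
  assumes w: "wedge p q \<noteq> 0" and \<kappa>: "\<kappa> \<ge> 0"
    and bound: "\<And>M. M \<in> GL2Z \<Longrightarrow> \<kappa> * \<bar>wedge p q\<bar> \<le> \<bar>dot (lin M p) (lin M q)\<bar>"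
  shows "\<kappa> \<le> sinh (delta \<i> (vec_billiard p q))"
proof -
  have "arsinh \<kappa> \<le> delta \<i> (vec_billiard p q)"
    unfolding delta_def
  proof (rule cINF_greatest)
    have "0 < wedge p q * wedge p q" using w by (metis not_square_less_zero not_less_iff_gr_or_eq mult_eq_0_iff)
    from fold_billiard_point[OF this] show "billiard_points (vec_billiard p q) \<noteq> {}" by blast
    fix z assume z: "z \<in> billiard_points (vec_billiard p q)"
    then obtain M t where M: "M \<in> GL2Z" and zt: "z = geo_pt (lin M p) (lin M q) t"
      and pos: "0 < t * wedge (lin M p) (lin M q)" by (auto simp: billiard_points_vec_billiard[OF w])
    define P Q W where "P = nrm2 (lin M p)" and "Q = nrm2 (lin M q)" and "W = wedge (lin M p) (lin M q)"
    have Imz: "Im z > 0" using Im_geo_pt_pos[OF pos] zt by simp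
    have W: "W \<noteq> 0" "\<bar>W\<bar> = \<bar>wedge p q\<bar>" using pos M by (auto simp: W_def wedge_lin GL2Z_def)
    have t0: "t \<noteq> 0" using pos by auto
    have "(cosh (hyp_dist \<i> z))\<^sup>2 = (P + t\<^sup>2 * Q)\<^sup>2 / (4 * t\<^sup>2 * W\<^sup>2)"
      using cosh_hyp_dist_i_size[OF Imz] i_size_geo_pt[OF pos]
      by (simp add: zt P_def Q_def W_def power_divide power_mult_distrib)
    also have "\<dots> \<ge> (4 * t\<^sup>2 * (P * Q)) / (4 * t\<^sup>2 * W\<^sup>2)"
    proof (rule divide_right_mono)
      have "0 \<le> (P - t\<^sup>2 * Q)\<^sup>2" by simp
      then show "4 * t\<^sup>2 * (P * Q) \<le> (P + t\<^sup>2 * Q)\<^sup>2" by (simp add: power2_eq_square algebra_simps)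
    qed simp
    also have "(4 * t\<^sup>2 * (P * Q)) / (4 * t\<^sup>2 * W\<^sup>2) = P * Q / W\<^sup>2" using t0 by simp
    also have "P * Q / W\<^sup>2 = 1 + (dot (lin M p) (lin M q))\<^sup>2 / W\<^sup>2"
      using W by (simp add: P_def Q_def W_def lagrange_identity add_divide_distrib)
    finally have ge: "1 + (dot (lin M p) (lin M q))\<^sup>2 / W\<^sup>2 \<le> (cosh (hyp_dist \<i> z))\<^sup>2" .
    have "\<kappa> \<le> \<bar>dot (lin M p) (lin M q)\<bar> / \<bar>W\<bar>"
      using bound[OF M] W by (simp add: field_simps)
    then have "\<kappa>\<^sup>2 \<le> (\<bar>dot (lin M p) (lin M q)\<bar> / \<bar>W\<bar>)\<^sup>2" using \<kappa> by (rule power_mono)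
    then have "\<kappa>\<^sup>2 \<le> (sinh (hyp_dist \<i> z))\<^sup>2" using ge by (simp add: cosh_square_eq power_divide)
    then have "\<kappa> \<le> sinh (hyp_dist \<i> z)"
      by (rule power2_le_imp_le) (use cosh_hyp_dist_i(2)[OF Imz] in simp)
    then have "sinh (arsinh \<kappa>) \<le> sinh (hyp_dist \<i> z)" by simp
    then show "arsinh \<kappa> \<le> hyp_dist \<i> z" by (simp only: sinh_real_le_iff)
  qed
  then have "sinh (arsinh \<kappa>) \<le> sinh (delta \<i> (vec_billiard p q))" by (simp only: sinh_real_le_iff)
  then show ?thesis by simp
qed

text \<open>One pair of endpoints suffices, because all pairs of the orbit induce the same billiard
  and the bound may be applied to each. If the dot product vanishes, both sides are
  infinite.\<close>

lemma lambda_ge: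
  assumes "\<alpha> \<noteq> \<beta>"
  shows "inverse (ereal (\<bar>dot (bdry_vec \<alpha>) (bdry_vec \<beta>)\<bar> / \<bar>wedge (bdry_vec \<alpha>) (bdry_vec \<beta>)\<bar>)) \<le> lambda \<i> (billiard \<alpha> \<beta>)"
  unfolding lambda_def billiard_eq_vec_billiard[OF assms]
  using sinh_delta_le[OF wedge_bdry_vec[OF assms]] delta_nonneg[OF wedge_bdry_vec[OF assms]]
  by (intro ereal_inverse_antimono) simp_all

lemma lambda_le:
  fixes x y \<kappa> :: real
  assumes "x \<noteq> y" "\<kappa> > 0"
    and "\<And>(a::int) (b::int) (c::int) (d::int). \<bar>a * d - b * c\<bar> = (1::int) \<Longrightarrow>
      \<kappa> * \<bar>x - y\<bar> \<le> \<bar>(a * x + b) * (a * y + b) + (c * x + d) * (c * y + d)\<bar>"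
  shows "lambda \<i> (billiard (Some x) (Some y)) \<le> ereal (1 / \<kappa>)"
proof -
  have w: "wedge (x, 1) (y, 1) \<noteq> 0" using assms by (simp add: wedge_def)
  have "\<kappa> \<le> sinh (delta \<i> (vec_billiard (x, 1) (y, 1)))"
  proof (rule sinh_delta_ge[OF w])
    fix M :: "int^2^2" assume "M \<in> GL2Z"
    then have "\<bar>M$1$1 * M$2$2 - M$1$2 * M$2$1\<bar> = 1" by (auto simp: GL2Z_def det_2)
    from assms(3)[OF this] show "\<kappa> * \<bar>wedge (x, 1) (y, 1)\<bar> \<le> \<bar>dot (lin M (x, 1)) (lin M (y, 1))\<bar>"
      by (simp add: wedge_def dot_def lin_def abs_minus_commute)
  qed (use assms in simp)
  then have "lambda \<i> (billiard (Some x) (Some y)) \<le> inverse (ereal \<kappa>)"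
    unfolding lambda_def using assms by (intro ereal_inverse_antimono) (simp_all add: billiard_eq_vec_billiard)
  then show ?thesis using assms by (simp add: inverse_eq_divide)
qed

lemma billiard_points_converse: "billiard_points (converse ` B) = billiard_points B"
  by (simp add: billiard_points_def)

lemma lambda_converse: "lambda z (converse ` B) = lambda z B"
  by (simp add: lambda_def delta_def billiard_points_converse)

section \<open>Values of an indefinite form on integer bases\<close>

definition root_form :: "real \<Rightarrow> real \<Rightarrow> int \<Rightarrow> int \<Rightarrow> real" where
  "root_form v X p q = (p - v * q) * (p - X * q)"

lemma root_form_uminus: "root_form v X (- p) (- q) = root_form v X p q"
  by (simp add: root_form_def algebra_simps)

text \<open>The reflection x -> M - x reads the chain backwards: it exchanges the tails before and
  after the digit M.\<close>

lemma root_form_reflect: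
  fixes M :: int and v X :: real
  shows "root_form (M - X) (M - v) (M * q - p) q = root_form v X p q"
  by (simp add: root_form_def algebra_simps)

text \<open>The chain step acts on fractions by p / q -> q / (M q - p) and divides the form by (M -
  v) (M - X).\<close>

lemma root_form_step:
  fixes M :: int and v X :: real
  assumes "v < M" "X < M"
  shows "root_form (1 / (M - v)) (1 / (M - X)) q (M * q - p) * ((M - v) * (M - X)) = root_form v X p q"
proof -
  have 1: "(q - 1 / (M - v) * (M * q - p)) * (M - v) = p - v * q"
    using assms by (simp add: field_simps)
  have 2: "(q - 1 / (M - X) * (M * q - p)) * (M - X) = p - X * q"
    using assms by (simp add: field_simps)
  show ?thesis unfolding root_form_def 1[symmetric] 2[symmetric] by simp
qed

text \<open>An integer strictly between p / q and r / s splits the determinant into two terms of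
  equal sign, each of size at least 1.\<close>

lemma farey_no_integer_between:
  fixes p q r s N :: int
  assumes "\<bar>p * s - q * r\<bar> = 1" "q \<ge> 1" "s \<ge> 1"
  shows "(p \<le> N * q \<and> r \<le> N * s) \<or> (N * q \<le> p \<and> N * s \<le> r)"
proof (rule ccontr)
  assume "\<not> ?thesis"
  then consider "N * q - p \<ge> 1" "r - N * s \<ge> 1" | "p - N * q \<ge> 1" "N * s - r \<ge> 1" by linarith
  then show False
  proof cases
    case 1
    have "q * r - p * s = q * (r - N * s) + s * (N * q - p)" by (simp add: algebra_simps)
    moreover have "q * (r - N * s) \<ge> 1 * 1" "s * (N * q - p) \<ge> 1 * 1"
      using 1 assms by (intro mult_mono; simp)+
    ultimately show False using assms by linarith
  next
    case 2
    have "p * s - q * r = s * (p - N * q) + q * (N * s - r)" by (simp add: algebra_simps)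
    moreover have "s * (p - N * q) \<ge> 1 * 1" "q * (N * s - r) \<ge> 1 * 1"
      using 2 assms by (intro mult_mono; simp)+
    ultimately show False using assms by linarith
  qed
qed

text \<open>The inequalities are the bounds for the bases (1, 0), (n, 1) with n = 1, M - 1, M. The
  form is negative at the first two vectors (n, 1) and positive at the third. The bound at n = 0
  becomes the one at M after the reflection x -> M - x.\<close>

definition chain_step :: "real \<Rightarrow> int \<Rightarrow> real \<Rightarrow> real \<Rightarrow> bool" where
  "chain_step \<kappa> M v X \<longleftrightarrow> 4 \<le> M \<and> 0 \<le> v \<and> v < 1 \<and> M - 1 < X \<and> X < M \<and>
     1 + \<kappa> * (X - v) \<le> (1 - v) * (X - 1) \<and>
     1 + \<kappa> * (X - v) \<le> (M - 1 - v) * (X - M + 1) \<and>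
     \<kappa> * (X - v) \<le> (M - v) * (M - X) + 1"

text \<open>(t - v) (X - t) is concave in t, so on [1, M - 1] it is smallest at an end.\<close>

lemma chain_step_inner:
  fixes t :: real
  assumes C: "chain_step \<kappa> M v X" and t: "1 \<le> t" "t \<le> real_of_int M - 1"
  shows "1 + \<kappa> * (X - v) \<le> (t - v) * (X - t)"
proof -
  define K where "K = 1 + \<kappa> * (X - v)"
  define a where "a = (1 - v) * (X - 1) - K"
  define b where "b = (real_of_int M - 1 - v) * (X - M + 1) - K"
  have ab: "a \<ge> 0" "b \<ge> 0" using C by (auto simp: chain_step_def a_def b_def K_def)
  have M: "real_of_int M \<ge> 4" using C by (simp add: chain_step_def)
  have "(real_of_int M - 2) * ((t - v) * (X - t) - K)
      = (real_of_int M - 1 - t) * a + (t - 1) * b + (real_of_int M - 2) * ((t - 1) * (real_of_int M - 1 - t))"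
    unfolding a_def b_def by algebra
  also have "\<dots> \<ge> 0" using ab t M by (intro add_nonneg_nonneg mult_nonneg_nonneg) auto
  finally have "(t - v) * (X - t) - K \<ge> 0" using M by (simp add: zero_le_mult_iff)
  then show ?thesis by (simp add: K_def)
qed

text \<open>By homogeneity the value is q^2 \<ge> 1 times the one at p / q.\<close>

lemma root_form_inner:
  assumes C: "chain_step \<kappa> M v X" and q: "q \<ge> 1" and p: "q \<le> p" "p \<le> (M - 1) * q"
    and \<kappa>: "\<kappa> > 0"
  shows "root_form v X p q \<le> - (1 + \<kappa> * (X - v))"
proof -
  define t where "t = real_of_int p / q"
  have q': "real_of_int q \<ge> 1" using q by simp
  have p': "real_of_int q \<le> p" "real_of_int p \<le> (M - 1) * q"
    using p by (simp, metis of_int_1 of_int_diff of_int_le_iff of_int_mult)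
  have t: "1 \<le> t" "t \<le> real_of_int M - 1" using p' q' by (auto simp: t_def field_simps)
  have K: "1 + \<kappa> * (X - v) \<le> (t - v) * (X - t)" by (rule chain_step_inner[OF C t])
  have Kpos: "0 \<le> 1 + \<kappa> * (X - v)" using C \<kappa> by (simp add: chain_step_def)
  have "1 + \<kappa> * (X - v) \<le> (real_of_int q)\<^sup>2 * ((t - v) * (X - t))"
    using mult_mono[of 1 "(real_of_int q)\<^sup>2" "1 + \<kappa> * (X - v)" "(t - v) * (X - t)"] K Kpos q'
    by (simp add: one_le_power)
  moreover have "root_form v X p q = - ((real_of_int q)\<^sup>2 * ((t - v) * (X - t)))"
  proof -
    have "real_of_int p = t * q" using q' by (simp add: t_def)
    then show ?thesis by (simp add: root_form_def power2_eq_square algebra_simps)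
  qed
  ultimately show ?thesis by simp
qed

text \<open>Beyond M both factors grow. The ends of a Farey edge cannot both be M, so one of the two
  values is at least 1 and their sum at least (M - v) (M - X) + 1, as \<open>chain_step\<close>
  requires.\<close>

lemma root_form_outer:
  assumes C: "chain_step \<kappa> M v X" and q: "q \<ge> 1" and p: "M * q \<le> p"
  shows "root_form v X p q \<ge> (M - v) * (M - X)" and "M * q < p \<Longrightarrow> root_form v X p q \<ge> 1"
proof -
  have q': "real_of_int q \<ge> 1" using q by simp
  have p': "M * real_of_int q \<le> p" using p by (metis of_int_le_iff of_int_mult)
  have c: "0 \<le> v" "v < 1" "M - 1 < X" "X < M" "real_of_int M \<ge> 4" using C by (auto simp: chain_step_def)
  have a: "(M - v) * q \<le> p - v * q" "(M - X) * q \<le> p - X * q" using p' by (simp_all add: algebra_simps)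
  have b: "(M - v) \<le> (M - v) * q" "(M - X) \<le> (M - X) * q" using q' c by (simp_all add: mult_le_cancel_left1)
  show "root_form v X p q \<ge> (M - v) * (M - X)"
    unfolding root_form_def using a b c by (intro mult_mono) linarith+
  assume "M * q < p"
  then have "M * q + 1 \<le> p" by simp
  then have "M * real_of_int q + 1 \<le> p" by (metis of_int_1 of_int_add of_int_le_iff of_int_mult)
  moreover have "X * q \<le> M * real_of_int q" using c q' by (intro mult_right_mono) auto
  ultimately have "p - X * q \<ge> 1" by linarith
  moreover have "p - v * q \<ge> 1" using a b c by linarith
  ultimately show "root_form v X p q \<ge> 1"
    unfolding root_form_def using mult_mono[of 1 "p - v * q" 1 "p - X * q"] by simp
qed

text \<open>A basis is a Farey edge. The edges from \<open>\<infinity>\<close> are covered by the inequalities of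
  \<^const>\<open>chain_step\<close>; every other edge lies over an interval between consecutive integers, and only those over
  \<open>[M - 1, M]\<close> need to be followed along the chain, where their denominators decrease.\<close>

lemma chain_bound_right:
  fixes p q r s :: int
  assumes closed: "\<forall>v X. P v X \<longrightarrow> (\<exists>M. chain_step \<kappa> M v X \<and> P (1 / (M - v)) (1 / (M - X)))"
    and \<kappa>: "\<kappa> > 0"
    and "P v X" "\<bar>p * s - q * r\<bar> = 1" "0 \<le> q" "q \<le> p" "0 \<le> s" "s \<le> r"
  shows "\<kappa> * (X - v) \<le> \<bar>root_form v X p q + root_form v X r s\<bar>"
  using assms(3-)
proof (induction "nat (q + s)" arbitrary: p q r s v X rule: less_induct)
  case less
  from closed less.prems(1) obtain M where C: "chain_step \<kappa> M v X"
    and nxt: "P (1 / (M - v)) (1 / (M - X))" by blast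
  have c: "0 \<le> v" "v < 1" "M - 1 < X" "X < M" "real_of_int M \<ge> 4" "M \<ge> 4"
    "\<kappa> * (X - v) \<le> (M - v) * (M - X) + 1"
    using C by (auto simp: chain_step_def)
  have Kpos: "0 \<le> \<kappa> * (X - v)" using c \<kappa> by simp
  have vertex: "\<kappa> * (X - v) \<le> \<bar>1 + root_form v X n 1\<bar>" if "n \<ge> 1" for n :: int
  proof (cases "n \<le> M - 1")
    case True
    then show ?thesis using root_form_inner[OF C, of 1 n] that \<kappa> by simp
  next
    case False
    then show ?thesis using root_form_outer(1)[OF C, of 1 n] c by simp
  qed
  show ?case
  proof (cases "q = 0 \<or> s = 0")
    case True
    have one: "root_form v X 1 0 = 1" by (simp add: root_form_def)
    from True show ?thesis
    proof
      assume "q = 0"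
      then have "\<bar>p * s\<bar> = 1" using less.prems by simp
      then have "p = 1" "s = 1" using less.prems \<open>q = 0\<close> by (auto simp: abs_mult zmult_eq_1_iff)
      then show ?thesis using vertex[of r] less.prems \<open>q = 0\<close> one by simp
    next
      assume "s = 0"
      then have "\<bar>q * r\<bar> = 1" using less.prems by simp
      then have "q = 1" "r = 1" using less.prems \<open>s = 0\<close> by (auto simp: abs_mult zmult_eq_1_iff)
      then show ?thesis using vertex[of p] less.prems \<open>s = 0\<close> one by (simp add: add.commute)
    qed
  next
    case False
    then have qs: "q \<ge> 1" "s \<ge> 1" using less.prems by auto
    consider (inner) "p \<le> (M - 1) * q" "r \<le> (M - 1) * s" | (outer) "M * q \<le> p" "M * s \<le> r"
      | (mid) "(M - 1) * q \<le> p" "p \<le> M * q" "(M - 1) * s \<le> r" "r \<le> M * s"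
      using farey_no_integer_between[OF less.prems(2) qs, of "M - 1"]
        farey_no_integer_between[OF less.prems(2) qs, of M] by blast
    then show ?thesis
    proof cases
      case inner
      then show ?thesis
        using root_form_inner[OF C qs(1) less.prems(4)] root_form_inner[OF C qs(2) less.prems(6)] Kpos \<kappa> by linarith
    next
      case outer
      have "M * q < p \<or> M * s < r"
      proof (rule ccontr)
        assume "\<not> ?thesis"
        then have "p = M * q" "r = M * s" using outer by auto
        then show False using less.prems(2) by simp
      qed
      then show ?thesis
        using root_form_outer[OF C qs(1) outer(1)] root_form_outer[OF C qs(2) outer(2)] c by linarith
    next
      case mid
      \<comment> \<open>Over [M - 1, M] no denominator grows; if neither dropped, both fractions
        would be M - 1, against the determinant.\<close>
      have "nat (M * q - p + (M * s - r)) < nat (q + s)"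
      proof -
        have "(M - 1) * q < p \<or> (M - 1) * s < r"
        proof (rule ccontr)
          assume "\<not> ?thesis"
          then have "p = (M - 1) * q" "r = (M - 1) * s" using mid by auto
          then show False using less.prems(2) by simp
        qed
        then show ?thesis using mid qs by (auto simp: algebra_simps nat_less_eq_zless)
      qed
      moreover have "\<bar>q * (M * s - r) - (M * q - p) * s\<bar> = 1"
        using less.prems(2) by (simp add: algebra_simps abs_minus_commute)
      ultimately have IH: "\<kappa> * (1 / (M - X) - 1 / (M - v)) \<le>
        \<bar>root_form (1 / (M - v)) (1 / (M - X)) q (M * q - p)
          + root_form (1 / (M - v)) (1 / (M - X)) s (M * s - r)\<bar>"
        using mid less.prems(3-6) qs by (intro less.hyps nxt) (auto simp: algebra_simps)
      \<comment> \<open>The step divides the form and the difference of its roots by the same D, so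
        the inequality is transported unchanged.\<close>
      define D where "D = (M - v) * (M - X)"
      have D: "D > 0" using c by (simp add: D_def)
      have eq1: "\<kappa> * (1 / (M - X) - 1 / (M - v)) * D = \<kappa> * (X - v)"
      proof -
        have "M - X \<noteq> 0" "M - v \<noteq> 0" using c by auto
        then have "1 / (M - X) - 1 / (M - v) = (X - v) / D" by (simp add: D_def divide_simps)
        then show ?thesis using D by simp
      qed
      have eq2: "\<bar>root_form (1 / (M - v)) (1 / (M - X)) q (M * q - p)
          + root_form (1 / (M - v)) (1 / (M - X)) s (M * s - r)\<bar> * D
          = \<bar>root_form v X p q + root_form v X r s\<bar>"
      proof -
        have "v < M" "X < M" using c by auto
        then have "root_form v X p q + root_form v X r s =
            (root_form (1 / (M - v)) (1 / (M - X)) q (M * q - p)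
              + root_form (1 / (M - v)) (1 / (M - X)) s (M * s - r)) * D"
          unfolding D_def distrib_right by (simp only: root_form_step)
        then show ?thesis using D by (simp add: abs_mult)
      qed
      show ?thesis using mult_right_mono[OF IH, of D] D unfolding eq1 eq2 by simp
    qed
  qed
qed

text \<open>No edge crosses 1. The reflection x -> M - x carries the edges on its left to the right
  of M - 1, where the chain of the reflected pair applies; P at both pairs thus stands for both
  directions of the digit sequence.\<close>

lemma chain_bound:
  fixes p q r s M :: int and v X :: real
  assumes closed: "\<forall>v X. P v X \<longrightarrow> (\<exists>M. chain_step \<kappa> M v X \<and> P (1 / (M - v)) (1 / (M - X)))"
    and \<kappa>: "\<kappa> > 0" and M: "M \<ge> 3"
    and P: "P v X" "P (M - X) (M - v)" and det: "\<bar>p * s - q * r\<bar> = 1"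
  shows "\<kappa> * (X - v) \<le> \<bar>root_form v X p q + root_form v X r s\<bar>"
proof -
  note bound = chain_bound_right[where P = P, OF closed \<kappa>]
  have one: "root_form v X 1 0 = 1" "root_form (M - X) (M - v) 1 0 = 1" by (simp_all add: root_form_def)
  have vertex: "\<kappa> * (X - v) \<le> \<bar>1 + root_form v X n 1\<bar>" for n :: int
  proof (cases "n \<ge> 1")
    case True
    then show ?thesis using bound[OF P(1), of 1 1 0 n] one by simp
  next
    case False
    then have "\<kappa> * ((M - v) - (M - X)) \<le> \<bar>root_form (M - X) (M - v) 1 0 + root_form (M - X) (M - v) (M * 1 - n) 1\<bar>"
      using M by (intro bound[OF P(2)]) auto
    then show ?thesis unfolding root_form_reflect one by simp
  qed
  have pos: "\<kappa> * (X - v) \<le> \<bar>root_form v X p q + root_form v X r s\<bar>"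
    if det: "\<bar>p * s - q * r\<bar> = 1" and qs: "q > 0" "s > 0" for p q r s :: int
  proof -
    have right: ?thesis if "q \<le> p" "s \<le> r"
      using bound[OF P(1) det _ that(1) _ that(2)] qs by simp
    have left: ?thesis if "q \<le> M * q - p" "s \<le> M * s - r"
    proof -
      have "\<bar>(M * q - p) * s - q * (M * s - r)\<bar> = 1" using det by (simp add: algebra_simps)
      from bound[OF P(2) this _ that(1) _ that(2)] qs show ?thesis by (simp add: root_form_reflect)
    qed
    have "2 * q \<le> M * q" "2 * s \<le> M * s" using M qs by simp_all
    then have "q \<le> p \<and> s \<le> r \<or> q \<le> M * q - p \<and> s \<le> M * s - r"
      using farey_no_integer_between[OF det, of 1, unfolded mult_1] qs by linarith
    then show ?thesis using left right by blast
  qed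
  \<comment> \<open>The form is even, so basis vectors may be replaced by their negatives to make
    denominators nonnegative.\<close>
  have flip: "\<exists>p' q'. root_form v X p q = root_form v X p' q' \<and> (q' > 0 \<or> q' = 0 \<and> p' \<ge> 0)
      \<and> (\<forall>r s. \<bar>p' * s - q' * r\<bar> = \<bar>p * s - q * r\<bar>)" for p q :: int
  proof (cases "q > 0 \<or> q = 0 \<and> p \<ge> 0")
    case True
    then show ?thesis by blast
  next
    case False
    have "\<bar>- p * s - - q * r\<bar> = \<bar>p * s - q * r\<bar>" for r s by (simp add: abs_minus_commute)
    then show ?thesis using False root_form_uminus[of v X p q]
      by (intro exI[of _ "- p"] exI[of _ "- q"]) auto
  qed
  obtain p' q' where 1: "root_form v X p q = root_form v X p' q'" "q' > 0 \<or> q' = 0 \<and> p' \<ge> 0"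
    "\<bar>p' * s - q' * r\<bar> = \<bar>p * s - q * r\<bar>" for r s using flip by meson
  obtain r' s' where 2: "root_form v X r s = root_form v X r' s'" "s' > 0 \<or> s' = 0 \<and> r' \<ge> 0"
    "\<bar>r' * y - s' * x\<bar> = \<bar>r * y - s * x\<bar>" for x y using flip by meson
  have det': "\<bar>p' * s' - q' * r'\<bar> = 1"
    using 1(3)[of s' r'] 2(3)[of q p] det by (simp add: mult.commute abs_minus_commute)
  consider "q' = 0" "p' \<ge> 0" | "s' = 0" "r' \<ge> 0" | "q' > 0" "s' > 0" using 1 2 by blast
  then show ?thesis
  proof cases
    case 1
    then have "p' = 1" "s' = 1" using det' \<open>s' > 0 \<or> s' = 0 \<and> r' \<ge> 0\<close> by (auto simp: abs_mult zmult_eq_1_iff)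
    then show ?thesis using vertex[of r'] 1 2(1) \<open>root_form v X p q = root_form v X p' q'\<close> one by simp
  next
    case 2
    then have "r' = 1" "q' = 1" using det' \<open>q' > 0 \<or> q' = 0 \<and> p' \<ge> 0\<close> by (auto simp: abs_mult zmult_eq_1_iff)
    then show ?thesis using vertex[of p'] 1(1) 2 \<open>root_form v X r s = root_form v X r' s'\<close> one by (simp add: add.commute)
  next
    case 3
    then show ?thesis using pos[OF det' 3] 1(1) 2(1) by simp
  qed
qed

section \<open>Classification of the geodesics that stay away from the orbit of \<open>\<i>\<close>\<close>

text \<open>\<open>1 / kap\<close> is the third value \<open>(3 + sqrt 21) / 3\<close>, and \<open>1 - 2 * kap = (5 - sqrt 21) / 2\<close> is the minus
  continued fraction \<open>1 / (5 - 1 / (5 - \<dots>))\<close>.\<close>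

definition kap :: real where
  "kap = (sqrt 21 - 3) / 4"

lemma kap_quadratic: "4 * kap\<^sup>2 + 6 * kap = 3"
proof -
  have "(sqrt 21)\<^sup>2 = 21" by simp
  then show ?thesis by (simp add: kap_def power2_eq_square field_simps)
qed

lemma kap_bounds: "0.3956 < kap" "kap < 0.3957"
proof -
  have "4.5824 < sqrt 21" by (rule real_less_rsqrt) (simp add: power2_eq_square)
  moreover have "sqrt 21 < 4.5828" by (rule real_less_lsqrt) (simp_all add: power2_eq_square)
  ultimately show "0.3956 < kap" "kap < 0.3957" by (simp_all add: kap_def)
qed

lemma sqrt14_bounds: "3.74 < sqrt 14" "sqrt 14 < 3.75"
  by (rule real_less_rsqrt, simp add: power2_eq_square)
    (rule real_less_lsqrt, simp_all add: power2_eq_square)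

text \<open>Only the bound at \<i> is assumed; closure under generators of the group turns it into
  the bound at every point of the orbit. Reversal is included because lambda ignores
  orientation.\<close>

locale admissible_pairs =
  fixes S :: "(real \<times> real) set"
  assumes shift: "(x, y) \<in> S \<Longrightarrow> (x + of_int n, y + of_int n) \<in> S"
    and neg: "(x, y) \<in> S \<Longrightarrow> (- x, - y) \<in> S"
    and inv: "(x, y) \<in> S \<Longrightarrow> x \<noteq> 0 \<Longrightarrow> y \<noteq> 0 \<Longrightarrow> (1 / x, 1 / y) \<in> S"
    and swap: "(x, y) \<in> S \<Longrightarrow> (y, x) \<in> S"
    and bound: "(x, y) \<in> S \<Longrightarrow> kap * \<bar>x - y\<bar> \<le> \<bar>x * y + 1\<bar>"
begin

text \<open>The last condition says that the semicircle passes above \<open>1 + \<i>\<close>.\<close>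

definition state :: "real \<Rightarrow> real \<Rightarrow> bool" where
  "state v X \<longleftrightarrow> (v, X) \<in> S \<and> 0 \<le> v \<and> v < 1 \<and> 1 < (1 - v) * (X - 1)"

text \<open>\<open>M\<close> is the current digit; \<open>u\<close> and \<open>v\<close> are the minus continued fractions of the digits after and before
  it. The four inequalities are the distance bounds at \<open>1 + \<i>\<close>, \<open>M - 1 + \<i>\<close>, \<open>\<i>\<close> and \<open>M + \<i>\<close>.\<close>

definition digit :: "int \<Rightarrow> real \<Rightarrow> real \<Rightarrow> bool" where
  "digit M u v \<longleftrightarrow> state v (M - u) \<and> state u (M - v) \<and> state (1 / (M - v)) (1 / u) \<and> 4 \<le> M \<and>
     0 < u \<and> u < 1 - kap \<and> 0 < v \<and> v < 1 - kap \<and>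
     1 + kap * (M - u - v) \<le> (1 - v) * (M - u - 1) \<and>
     1 + kap * (M - u - v) \<le> (1 - u) * (M - v - 1) \<and>
     kap * (M - u - v) \<le> v * (M - u) + 1 \<and>
     kap * (M - u - v) \<le> u * (M - v) + 1"

section \<open>Digits along the chain\<close>

lemma bound_shift: "(x, y) \<in> S \<Longrightarrow> kap * \<bar>x - y\<bar> \<le> \<bar>(x - of_int n) * (y - of_int n) + 1\<bar>"
  using bound[OF shift[of x y "- n"]] by simp

text \<open>A bound at n + \<i> alone allows the arc to pass above or below the point. Once X - v >
  3, kap (X - v) exceeds 1; this forces the arc above M - 1 + \<i> and makes both tails
  positive.\<close>

lemma state_digit:
  assumes "state v X"
  obtains M u where "X = of_int M - u" "digit M u v"
proof -
  note k = kap_bounds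
  have S: "(v, X) \<in> S" and v: "0 \<le> v" "v < 1" and in1: "1 < (1 - v) * (X - 1)"
    using assms by (auto simp: state_def)
  have X2: "X > 2"
  proof (rule ccontr)
    assume "\<not> X > 2"
    then have "(1 - v) * (X - 1) \<le> (1 - v) * 1" using v by (intro mult_left_mono) auto
    also have "\<dots> \<le> 1" using v by simp
    finally show False using in1 leD by blast
  qed
  have I1: "1 + kap * (X - v) \<le> (1 - v) * (X - 1)"
    using bound_shift[OF S, of 1] in1 X2 v by (simp add: algebra_simps abs_if split: if_splits)
  then have v_le: "v * (X - 1 - kap) \<le> (1 - kap) * X - 2" by (simp add: algebra_simps)
  have "0 \<le> v * (X - 1 - kap)" using v X2 k by (intro mult_nonneg_nonneg) auto
  then have "2 \<le> (1 - kap) * X" using v_le by linarith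
  also have "\<dots> \<le> 0.6044 * X" using k X2 by (intro mult_right_mono) auto
  finally have X3: "X > 3.3" by simp
  have gap: "X - v > 3"
  proof (cases "X \<ge> 4")
    case False
    show ?thesis
    proof (rule ccontr)
      assume "\<not> ?thesis"
      then have "(X - 3) * (X - 1 - kap) \<le> v * (X - 1 - kap)" using X3 k by (intro mult_right_mono) auto
      then have "X * X - 5 * X + 5 + 3 * kap \<le> 0" using v_le by (simp add: algebra_simps)
      \<comment> \<open>3.3 and 1.7 have sum 5, and their product 5.61 is less than 5 + 3
        kap.\<close>
      moreover have "0 \<le> (X - 3.3) * (X - 1.7)" using X3 by (intro mult_nonneg_nonneg) auto
      ultimately show False using k by (simp add: algebra_simps)
    qed
  qed (use v in auto)
  then have ks: "kap * (X - v) > 1" using mult_strict_mono[of "0.3956" kap 3 "X - v"] k by simp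
  define M where "M = \<lceil>X\<rceil>"
  define u where "u = of_int M - X"
  have XM: "X = of_int M - u" by (simp add: u_def)
  have u: "0 \<le> u" "u < 1" unfolding u_def M_def by linarith+
  have M: "4 \<le> M" using X3 unfolding M_def by linarith
  then have M': "4 \<le> real_of_int M" by simp
  have vX: "\<bar>v - X\<bar> = X - v" using gap by simp
  have "(v - of_int M) * (X - of_int M) = (of_int M - v) * u" by (simp add: u_def algebra_simps)
  then have "kap * (X - v) \<le> \<bar>(of_int M - v) * u + 1\<bar>"
    using bound_shift[OF S, of M] vX by simp
  moreover have "(of_int M - v) * u \<ge> 0" using u v M' by (intro mult_nonneg_nonneg) auto
  ultimately have O2: "kap * (X - v) \<le> u * (of_int M - v) + 1" by (simp add: mult.commute)
  have u0: "0 < u" using O2 ks u by (cases "u = 0") auto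
  have "(v - of_int (M - 1)) * (X - of_int (M - 1)) + 1 = 1 - (1 - u) * (of_int M - v - 1)"
    by (simp add: u_def algebra_simps)
  then have "kap * (X - v) \<le> \<bar>(1 - u) * (of_int M - v - 1) - 1\<bar>"
    using bound_shift[OF S, of "M - 1"] vX by (simp only: abs_minus_commute[of _ 1])
  moreover have "(1 - u) * (of_int M - v - 1) \<ge> 0" using u v M' by (intro mult_nonneg_nonneg) auto
  ultimately have I2: "1 + kap * (X - v) \<le> (1 - u) * (of_int M - v - 1)" using ks by linarith
  have "kap * (X - v) \<le> \<bar>v * X + 1\<bar>" using bound[OF S] by (simp only: vX)
  moreover have "v * X \<ge> 0" using v X3 by simp
  ultimately have O1: "kap * (X - v) \<le> v * X + 1" by simp
  have v0: "0 < v" using O1 ks v by (cases "v = 0") auto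
  have u1: "u < 1 - kap"
  proof -
    have "kap * (X - v) = kap * (of_int M - v - 1) + kap * (1 - u)" unfolding XM by (simp add: algebra_simps)
    moreover have "kap * (1 - u) \<ge> 0" using u k by simp
    ultimately have "kap * (of_int M - v - 1) < (1 - u) * (of_int M - v - 1)" using I2 by linarith
    then show ?thesis using M' v by (simp add: mult_less_cancel_right)
  qed
  have v1: "v < 1 - kap"
  proof -
    have "kap * (X - v) = kap * (X - 1) + kap * (1 - v)" by (simp add: algebra_simps)
    moreover have "kap * (1 - v) \<ge> 0" using v k by simp
    ultimately have "kap * (X - 1) < (1 - v) * (X - 1)" using I1 by linarith
    then show ?thesis using X3 by (simp add: mult_less_cancel_right)
  qed
  have Su: "(of_int M - v, u) \<in> S" using shift[OF neg[OF S], of M] by (simp add: u_def algebra_simps)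
  then have "state u (of_int M - v)" using swap[OF Su] u I2 ks by (simp add: state_def)
  moreover have "state (1 / (of_int M - v)) (1 / u)"
  proof -
    define p where "p = of_int M - v"
    have p: "p > 3" using M' v by (simp add: p_def)
    have S': "(1 / p, 1 / u) \<in> S" using inv[OF Su] u0 p by (simp add: p_def)
    have le: "1 / p < 1 / u" using p u u0 by (simp add: divide_strict_left_mono)
    have s: "X - v = p - u" by (simp add: p_def XM)
    have "kap * \<bar>1 / p - 1 / u\<bar> \<le> \<bar>(1 / p - 1) * (1 / u - 1) + 1\<bar>" using bound_shift[OF S', of 1] by simp
    then have "kap * \<bar>1 / p - 1 / u\<bar> * (p * u) \<le> \<bar>(1 / p - 1) * (1 / u - 1) + 1\<bar> * (p * u)"
      using p u0 by (intro mult_right_mono) auto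
    moreover have "kap * \<bar>1 / p - 1 / u\<bar> * (p * u) = kap * (p - u)"
      using le p u0 by (simp add: field_simps)
    moreover have "\<bar>(1 / p - 1) * (1 / u - 1) + 1\<bar> * (p * u) = \<bar>((1 / p - 1) * (1 / u - 1) + 1) * (p * u)\<bar>"
      using p u0 by (simp add: abs_mult)
    moreover have "((1 / p - 1) * (1 / u - 1) + 1) * (p * u) = p * u - (p - 1) * (1 - u)"
      using p u0 by (simp add: field_simps)
    ultimately have *: "kap * (p - u) \<le> \<bar>p * u - (p - 1) * (1 - u)\<bar>" by simp
    \<comment> \<open>The bound at 1 + \<i> for the next pair, multiplied by p u, leaves two signs.
      \<open>u < 1 - kap\<close> and the bound at M - 1 + \<i> give T - W < Z, so the next arc
      passes above 1 + \<i>.\<close>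
    define W where "W = (p - 1) * (1 - u)"
    define Z where "Z = kap * (p - u)"
    define T where "T = p * u"
    have "10000 * u \<le> 6044" using u1 k by simp
    then have "p * (10000 * u) \<le> p * 6044" using p by (intro mult_left_mono) auto
    then have "10000 * T \<le> 6044 * p" by (simp add: T_def)
    moreover have "3956 * (p - u) \<le> (10000 * kap) * (p - u)" using k p u by (intro mult_right_mono) auto
    then have "3956 * (p - u) \<le> 10000 * Z" by (simp add: Z_def)
    moreover have "1 + Z \<le> W" using I2 unfolding s p_def[symmetric] Z_def W_def by (simp add: mult.commute)
    moreover note \<open>10000 * u \<le> 6044\<close>
    ultimately have "10000 * (T - W) < 10000 * Z" using p by argo
    then have "\<not> Z \<le> T - W" by simp
    then have "kap * (p - u) \<le> (p - 1) * (1 - u) - p * u" using * unfolding W_def Z_def T_def by (simp add: abs_if split: if_splits)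
    moreover have "kap * (p - u) > 0" using k p u by simp
    ultimately have "1 < (1 - 1 / p) * (1 / u - 1)" using p u0 by (simp add: field_simps)
    then show ?thesis using S' p by (simp add: state_def p_def[symmetric])
  qed
  ultimately have "digit M u v"
    using assms I1 I2 O1 O2 M u0 u1 v0 v1 unfolding digit_def
    by (simp add: XM diff_diff_eq2 algebra_simps)
  then show ?thesis using that XM by blast
qed

lemma digit_bounds: "digit M u v \<Longrightarrow> 0 < u \<and> u < 1 \<and> 0 < v \<and> v < 1 \<and> 4 \<le> real_of_int M"
  using kap_bounds by (auto simp: digit_def)

text \<open>Read backwards, the pair is again a state. Its digit is M as well, since all tails lie
  strictly between 0 and 1.\<close>

lemma digit_sym: "digit M u v \<Longrightarrow> digit M v u"
proof -
  assume d: "digit M u v"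
  then obtain M' u' where *: "of_int M - v = of_int M' - u'" "digit M' u' u"
    using state_digit[of u "M - v"] unfolding digit_def by blast
  have "M = M'" using * d digit_bounds[OF d] digit_bounds[OF *(2)] by linarith
  then show ?thesis using * by simp
qed

lemma digit_next:
  assumes "digit M u v"
  obtains M' u' where "u * (of_int M' - u') = 1" "digit M' u' (1 / (M - v))"
proof -
  from assms have "state (1 / (M - v)) (1 / u)" by (simp add: digit_def)
  from state_digit[OF this] obtain M' u' where *: "1 / u = of_int M' - u'" "digit M' u' (1 / (M - v))" by blast
  have "u * (of_int M' - u') = 1" using digit_bounds[OF assms] *(1) by (metis less_irrefl nonzero_mult_div_cancel_left times_divide_eq_right mult.right_neutral)
  then show ?thesis using that * by blast
qed

text \<open>The extremal tails are found by comparing the supremum (or infimum) of all tails with its own image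
  under the step.\<close>

definition tails :: "(int \<Rightarrow> bool) \<Rightarrow> real set" where
  "tails P = {u. \<exists>M v. digit M u v \<and> P M}"

lemma tails_bounded: "u \<in> tails P \<Longrightarrow> 0 \<le> u \<and> u \<le> 1"
  using digit_bounds by (fastforce simp: tails_def)

lemma tails_bdd: "bdd_above (tails P)" "bdd_below (tails P)"
  using tails_bounded by (meson bdd_above.I bdd_below.I)+

lemma no_four_tail_le:
  assumes no4: "\<And>M u v. digit M u v \<Longrightarrow> M \<noteq> 4" and d: "digit M u v"
  shows "u \<le> 1 - 2 * kap"
proof -
  define s where "s = Sup (tails (\<lambda>_. True))"
  have ne: "u \<in> tails (\<lambda>_. True)" using d by (auto simp: tails_def)
  have us: "u \<le> s" if "digit M u v" for M u v
    unfolding s_def by (rule cSup_upper[OF _ tails_bdd(1)]) (use that in \<open>auto simp: tails_def\<close>)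
  have s1: "0 < s" "s \<le> 1"
    using us[OF d] digit_bounds[OF d] cSup_least[of "tails (\<lambda>_. True)" 1] tails_bounded ne by (force simp: s_def)+
  have "x \<le> 1 / (5 - s)" if x: "x \<in> tails (\<lambda>_. True)" for x
  proof -
    obtain M v where dx: "digit M x v" using x by (auto simp: tails_def)
    from digit_next[OF this] obtain M' u' where n: "x * (of_int M' - u') = 1" "digit M' u' (1 / (M - v))" .
    have "5 \<le> M'" using no4[OF n(2)] n(2) by (auto simp: digit_def)
    then have "5 - s \<le> of_int M' - u'" using us[OF n(2)] by linarith
    then have "x * (5 - s) \<le> 1" using n(1) digit_bounds[OF dx] by (metis less_imp_le mult_left_mono)
    then show ?thesis using s1 by (simp add: field_simps)
  qed
  then have "s \<le> 1 / (5 - s)" unfolding s_def using ne by (intro cSup_least) auto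
  then have "s * (5 - s) \<le> 1" using s1 by (simp add: field_simps)
  \<comment> \<open>By \<open>kap_quadratic\<close>, 1 - 2 kap and 4 + 2 kap are the roots of
    \<open>s * s - 5 * s + 1\<close>; s \<le> 1 leaves the smaller one.\<close>
  moreover have "(s - (1 - 2 * kap)) * (s - (4 + 2 * kap)) = s * s - 5 * s + 4 - (4 * kap\<^sup>2 + 6 * kap)"
    by (simp add: algebra_simps power2_eq_square)
  ultimately have "(s - (1 - 2 * kap)) * (s - (4 + 2 * kap)) \<ge> 0" using kap_quadratic by (simp only: right_diff_distrib)
  then have "s \<le> 1 - 2 * kap" using s1 kap_bounds by (auto simp: zero_le_mult_iff)
  then show ?thesis using us[OF d] by simp
qed

text \<open>With tails at most 1 - 2 kap the bound at \<i> fails from the digit 7 on. At 6 the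
  extreme tails give equality, by \<open>kap_quadratic\<close>, so a smaller v fails;
  \<open>digit_sym\<close> extends this to u.\<close>

lemma no_four_digit_le:
  assumes no4: "\<And>M u v. digit M u v \<Longrightarrow> M \<noteq> 4" and d: "digit M u v"
  shows "M = 5 \<or> M = 6 \<and> v = 1 - 2 * kap"
proof -
  note k = kap_bounds
  have b: "u \<le> 1 - 2 * kap" "v \<le> 1 - 2 * kap" using no_four_tail_le[OF no4] d digit_sym[OF d] by auto
  have M5: "5 \<le> M" using no4[OF d] d by (auto simp: digit_def)
  define Y where "Y = of_int M - u"
  have O: "kap * (Y - v) \<le> v * Y + 1" using d by (simp add: digit_def Y_def)
  have O': "0 \<le> v * (Y + kap) - kap * Y + 1" using O by (simp add: algebra_simps)
  have Y4: "Y > 4" using M5 digit_bounds[OF d] by (simp add: Y_def)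
  have "M < 7"
  proof (rule ccontr)
    assume "\<not> M < 7"
    then have "Y > 679 / 100" using b k by (simp add: Y_def)
    moreover have "(10000 * v) * (Y + kap) \<le> 2088 * (Y + 1)" using b k Y4 by (intro mult_mono) auto
    then have "10000 * (v * (Y + kap)) \<le> 2088 * Y + 2088" by simp
    moreover have "3956 * Y \<le> (10000 * kap) * Y" using k Y4 by (intro mult_right_mono) auto
    then have "3956 * Y \<le> 10000 * (kap * Y)" by simp
    moreover have "0 \<le> 10000 * (v * (Y + kap)) - 10000 * (kap * Y) + 10000" using O' by simp
    ultimately show False by simp
  qed
  moreover have "v = 1 - 2 * kap" if "M = 6"
  proof (rule ccontr)
    assume "v \<noteq> 1 - 2 * kap"
    then have "v < 1 - 2 * kap" using b by simp
    then have "v * (Y + kap) < (1 - 2 * kap) * (Y + kap)" using Y4 k by (intro mult_strict_right_mono) auto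
    moreover have "5 + 2 * kap \<le> Y" using b that by (simp add: Y_def)
    then have "(1 - 3 * kap) * Y \<le> (1 - 3 * kap) * (5 + 2 * kap)" using k by (intro mult_left_mono_neg) auto
    ultimately have "0 < (1 - 3 * kap) * (5 + 2 * kap) + (1 - 2 * kap) * kap + 1"
      using O' by (simp add: algebra_simps)
    also have "\<dots> = 6 - 2 * (4 * kap\<^sup>2 + 6 * kap)" by (simp add: algebra_simps power2_eq_square)
    finally show False by (simp add: kap_quadratic)
  qed
  ultimately show ?thesis using M5 by auto
qed

lemma all_five_tail_ge:
  assumes all5: "\<And>M u v. digit M u v \<Longrightarrow> M = 5" and d: "digit M u v"
  shows "1 - 2 * kap \<le> u"
proof -
  define s where "s = Inf (tails (\<lambda>_. True))"
  have ne: "u \<in> tails (\<lambda>_. True)" using d by (auto simp: tails_def)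
  have us: "s \<le> u" if "digit M u v" for M u v
    unfolding s_def by (rule cInf_lower[OF _ tails_bdd(2)]) (use that in \<open>auto simp: tails_def\<close>)
  have s1: "0 \<le> s" "s < 1"
    using us[OF d] digit_bounds[OF d] cInf_greatest[of "tails (\<lambda>_. True)" 0] tails_bounded ne by (force simp: s_def)+
  have "1 / (5 - s) \<le> x" if x: "x \<in> tails (\<lambda>_. True)" for x
  proof -
    obtain M v where dx: "digit M x v" using x by (auto simp: tails_def)
    from digit_next[OF this] obtain M' u' where n: "x * (of_int M' - u') = 1" "digit M' u' (1 / (M - v))" .
    have "of_int M' - u' \<le> 5 - s" using us[OF n(2)] all5[OF n(2)] by simp
    then have "1 \<le> x * (5 - s)" using n(1) digit_bounds[OF dx] by (metis less_imp_le mult_left_mono)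
    then show ?thesis using s1 by (simp add: field_simps)
  qed
  then have "1 / (5 - s) \<le> s" unfolding s_def using ne by (intro cInf_greatest) auto
  then have "1 \<le> s * (5 - s)" using s1 by (simp add: field_simps)
  moreover have "(s - (1 - 2 * kap)) * (s - (4 + 2 * kap)) = s * s - 5 * s + 4 - (4 * kap\<^sup>2 + 6 * kap)"
    by (simp add: algebra_simps power2_eq_square)
  ultimately have "(s - (1 - 2 * kap)) * (s - (4 + 2 * kap)) \<le> 0" using kap_quadratic by (simp only: right_diff_distrib)
  then have "1 - 2 * kap \<le> s" using s1 kap_bounds by (auto simp: mult_le_0_iff)
  then show ?thesis using us[OF d] by simp
qed

section \<open>Chains containing the digit 4\<close>

lemma four_tail_le:
  assumes "digit 4 u v"
  shows "u \<le> 0.1604"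
proof -
  note k = kap_bounds
  have d: "0 < u" "u < 1" "0 < v" "v < 1" using digit_bounds[OF assms] by auto
  have "1 + kap * (4 - u - v) \<le> (1 - u) * (3 - v)" using assms by (simp add: digit_def algebra_simps)
  moreover have "(1 - u - kap) * v \<ge> 0" using assms d by (intro mult_nonneg_nonneg) (auto simp: digit_def)
  ultimately have "u * (3 - kap) \<le> 2 - 4 * kap" by (simp add: algebra_simps)
  moreover have "u * 2.6043 \<le> u * (3 - kap)" using d k by (intro mult_left_mono) auto
  ultimately show ?thesis using k by simp
qed

text \<open>Tails at a 4 are at most 0.1604, so the next digit is at least 7. The tail before that
  digit is at most 0.2605, and the bound at M + \<i> needs a tail above 0.233 after it, which forces
  another 4. This caps that tail at 0.2605, and the same bound gives M \<le> 8.\<close>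

lemma four_next:
  assumes d: "digit 4 u v"
  obtains M u1 u2 v2 where "u * (of_int M - u1) = 1" "u1 * (4 - u2) = 1" "digit 4 u2 v2" "M = 7 \<or> M = 8"
proof -
  note k = kap_bounds
  have u: "0 < u" "u \<le> 0.1604" and v: "0 < v" "v \<le> 0.1604"
    using four_tail_le[OF d] four_tail_le[OF digit_sym[OF d]] digit_bounds[OF d] by auto
  from digit_next[OF d] obtain M u1 where 1: "u * (of_int M - u1) = 1" and d1: "digit M u1 (1 / (4 - v))"
    by auto
  define v1 where "v1 = 1 / (4 - v)"
  have v1: "v1 \<le> 0.2605" "0 < v1" using v by (auto simp: v1_def field_simps)
  have b1: "0 < u1" "u1 < 0.6044" using d1 k by (auto simp: digit_def)
  have M7: "7 \<le> M"
  proof (rule ccontr)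
    assume "\<not> 7 \<le> M"
    then have "u * (of_int M - u1) < 0.1604 * 6" 
      using u b1 digit_bounds[OF d1] mult_le_less_imp_less[of u "0.1604" "of_int M - u1" 6] by simp
    then show False using 1 by simp
  qed
  define Y where "Y = of_int M - v1"
  have Y: "Y > 6.73" using M7 v1 by (simp add: Y_def)
  have "kap * (Y - u1) \<le> u1 * Y + 1" using d1 by (simp add: digit_def Y_def v1_def algebra_simps)
  then have O: "kap * Y - 1 \<le> u1 * (Y + kap)" by (simp add: algebra_simps)
  have kY: "0.3956 * Y \<le> kap * Y" using Y k by (intro mult_right_mono) auto
  have u1: "0.233 < u1"
  proof (rule ccontr)
    assume "\<not> 0.233 < u1"
    then have "u1 * (Y + kap) \<le> 0.233 * (Y + 0.3957)" using b1 Y k by (intro mult_mono) auto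
    then show False using O kY Y by simp
  qed
  from digit_next[OF d1] obtain M2 u2 v2 where 2: "u1 * (of_int M2 - u2) = 1" and d2: "digit M2 u2 v2" by blast
  have b2: "0 < u2" "u2 < 0.6044" "4 \<le> M2" using d2 k by (auto simp: digit_def)
  have M2: "M2 = 4"
  proof (rule ccontr)
    assume "M2 \<noteq> 4"
    then have "5 \<le> real_of_int M2" using b2 by simp
    then have "of_int M2 - u2 > 4.39" using b2 by simp
    then have "u1 * (of_int M2 - u2) > 0.233 * 4.39" using u1 by (intro mult_strict_mono) auto
    then show False using 2 by simp
  qed
  have u2: "u2 \<le> 0.1604" using four_tail_le d2 M2 by blast
  have u1_le: "u1 \<le> 0.2605"
  proof (rule ccontr)
    assume "\<not> u1 \<le> 0.2605"
    then have "u1 * (4 - u2) > 0.2605 * 3.839" using u2 by (intro mult_strict_mono) auto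
    then show False using 2 M2 by simp
  qed
  have "u1 * (Y + kap) \<le> 0.2605 * (Y + 0.3957)" using b1 Y k u1_le by (intro mult_mono) auto
  then have "Y < 8.2" using O kY by simp
  then have "M \<le> 8" using v1 by (simp add: Y_def)
  then have "M = 7 \<or> M = 8" using M7 by linarith
  then show ?thesis using that[OF 1 _ d2[unfolded M2]] 2 M2 by simp
qed

lemma four_tail_ge:
  assumes d: "digit 4 u v"
  shows "0.125 < u"
proof -
  from four_next[OF d] obtain M u1 u2 v2 where *: "u * (of_int M - u1) = 1" "u1 * (4 - u2) = 1"
    "digit 4 u2 v2" "M = 7 \<or> M = 8" .
  have "0 < u1 * (4 - u2)" using *(2) by simp
  then have "u1 > 0" using digit_bounds[OF *(3)] by (auto simp: zero_less_mult_iff)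
  then have "real_of_int M - u1 < 8" using *(4) by auto
  then have "u * (of_int M - u1) < u * 8" using digit_bounds[OF d] by (intro mult_strict_left_mono) auto
  then show ?thesis using * by simp
qed

text \<open>A digit 7 would give u > 0.148; with v > 1 / 8 from \<open>four_tail_ge\<close> the
  bound at 3 + \<i> then fails.\<close>

lemma four_next_eight:
  assumes d: "digit 4 u v"
  obtains u2 v2 where "u * (8 * (4 - u2) - 1) = 4 - u2" "digit 4 u2 v2"
proof -
  note k = kap_bounds
  from four_next[OF d] obtain M u1 u2 v2 where *: "u * (of_int M - u1) = 1" "u1 * (4 - u2) = 1"
    "digit 4 u2 v2" "M = 7 \<or> M = 8" .
  have u: "0 < u" "u \<le> 0.1604" and v: "0.125 < v" "v < 1"
    using four_tail_le[OF d] four_tail_ge[OF digit_sym[OF d]] digit_bounds[OF d] by auto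
  have u1: "u1 = 1 / (4 - u2)" using *(2) digit_bounds[OF *(3)] by (simp add: field_simps)
  have "u1 > 0.25" using four_tail_ge[OF *(3)] four_tail_le[OF *(3)] by (simp add: u1 field_simps)
  have "M \<noteq> 7"
  proof
    assume "M = 7"
    then have "u * (7 - u1) = 1" using * by simp
    moreover have "u * (7 - u1) < u * 6.75" using u \<open>u1 > 0.25\<close> by (intro mult_strict_left_mono) auto
    ultimately have ul: "u > 0.148" by simp
    have "1 + kap * (4 - u - v) \<le> (1 - u) * (3 - v)" using d by (simp add: digit_def algebra_simps)
    moreover have "(1 - u) * (3 - v) \<le> 0.852 * (3 - v)" using ul v by (intro mult_right_mono) auto
    moreover have "0.3956 * (4 - u - v) \<le> kap * (4 - u - v)" using u v k by (intro mult_right_mono) auto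
    ultimately show False using u v by simp
  qed
  then have "u * (8 - 1 / (4 - u2)) = 1" using * u1 by simp
  then have "u * (8 * (4 - u2) - 1) = 4 - u2" using digit_bounds[OF *(3)] by (simp add: field_simps)
  then show ?thesis using that * by blast
qed

text \<open>Two steps express a tail at a 4 through the next such tail by the increasing map F(s) =
  (4 - s) / (8 (4 - s) - 1). Supremum and infimum satisfy s \<le> F(s) and F(t) \<le> t; both are at
  most 1, so only the smaller fixed point remains.\<close>

lemma four_tail_eq:
  assumes d: "digit 4 u v"
  shows "u = (4 - sqrt 14) / 2"
proof (rule antisym)
  note r = sqrt14_bounds
  have fac: "2 * s * s - 8 * s + 1 = 2 * ((s - (4 - sqrt 14) / 2) * (s - (4 + sqrt 14) / 2))" for s :: real
    by (simp add: field_simps)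
  have ne: "u \<in> tails (\<lambda>M. M = 4)" using d by (auto simp: tails_def)
  define s where "s = Sup (tails (\<lambda>M. M = 4))"
  have us: "u \<le> s" if "digit 4 u v" for u v
    unfolding s_def by (rule cSup_upper[OF _ tails_bdd(1)]) (use that in \<open>auto simp: tails_def\<close>)
  have s1: "s \<le> 1" unfolding s_def using tails_bounded ne by (intro cSup_least) auto
  have "x \<le> (4 - s) / (8 * (4 - s) - 1)" if x: "x \<in> tails (\<lambda>M. M = 4)" for x
  proof -
    obtain v where dx: "digit 4 x v" using x by (auto simp: tails_def)
    from four_next_eight[OF this] obtain u2 v2 where n: "x * (8 * (4 - u2) - 1) = 4 - u2" "digit 4 u2 v2" .
    \<comment> \<open>In the form (8 x - 1) (4 - \<open>u2\<close>) = x the relation can be compared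
      with s in place of \<open>u2\<close>, because tails at a 4 exceed 1 / 8.\<close>
    have "8 * x - 1 > 0" using four_tail_ge[OF dx] by simp
    then have "(8 * x - 1) * (4 - s) \<le> (8 * x - 1) * (4 - u2)" using us[OF n(2)] by (intro mult_left_mono) auto
    then have "x * (8 * (4 - s) - 1) \<le> 4 - s" using n(1) by (simp add: algebra_simps)
    then show ?thesis using s1 by (simp add: field_simps)
  qed
  then have "s \<le> (4 - s) / (8 * (4 - s) - 1)" unfolding s_def using ne by (intro cSup_least) auto
  then have "s * (8 * (4 - s) - 1) \<le> 4 - s" using s1 by (simp add: pos_le_divide_eq)
  then have "(s - (4 - sqrt 14) / 2) * (s - (4 + sqrt 14) / 2) \<ge> 0" using fac[of s] by (simp only: right_diff_distrib)
  then have "s \<le> (4 - sqrt 14) / 2" using s1 r by (auto simp: zero_le_mult_iff)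
  then show "u \<le> (4 - sqrt 14) / 2" using us[OF d] by simp
  define t where "t = Inf (tails (\<lambda>M. M = 4))"
  have ut: "t \<le> u" if "digit 4 u v" for u v
    unfolding t_def by (rule cInf_lower[OF _ tails_bdd(2)]) (use that in \<open>auto simp: tails_def\<close>)
  have t1: "t \<le> 1" using ut[OF d] digit_bounds[OF d] by simp
  have "(4 - t) / (8 * (4 - t) - 1) \<le> x" if x: "x \<in> tails (\<lambda>M. M = 4)" for x
  proof -
    obtain v where dx: "digit 4 x v" using x by (auto simp: tails_def)
    from four_next_eight[OF this] obtain u2 v2 where n: "x * (8 * (4 - u2) - 1) = 4 - u2" "digit 4 u2 v2" .
    have "8 * x - 1 > 0" using four_tail_ge[OF dx] by simp
    then have "(8 * x - 1) * (4 - u2) \<le> (8 * x - 1) * (4 - t)" using ut[OF n(2)] by (intro mult_left_mono) auto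
    then have "4 - t \<le> x * (8 * (4 - t) - 1)" using n(1) by (simp add: algebra_simps)
    then show ?thesis using t1 by (simp add: field_simps)
  qed
  then have "(4 - t) / (8 * (4 - t) - 1) \<le> t" unfolding t_def using ne by (intro cInf_greatest) auto
  then have "4 - t \<le> t * (8 * (4 - t) - 1)" using t1 by (simp add: pos_divide_le_eq)
  then have "(t - (4 - sqrt 14) / 2) * (t - (4 + sqrt 14) / 2) \<le> 0" using fac[of t] by (simp only: right_diff_distrib)
  then have "(4 - sqrt 14) / 2 \<le> t" using t1 r by (auto simp: mult_le_0_iff)
  then show "(4 - sqrt 14) / 2 \<le> u" using ut[OF d] by simp
qed

text \<open>One occurrence of a 4, or failing that of a 6, determines both tails there, and with
  them a pair in S. Without either, all digits are 5 and the two estimates for the tails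
  meet.\<close>

lemma state_classification:
  assumes "state v X"
  shows "(1 - 2 * kap, 4 + 2 * kap) \<in> S \<or> ((4 - sqrt 14) / 2, (4 + sqrt 14) / 2) \<in> S
    \<or> (1 - 2 * kap, 5 + 2 * kap) \<in> S"
proof -
  from state_digit[OF assms] obtain M u where d: "digit M u v" by blast
  have in_S: "(v, of_int M - u) \<in> S" if "digit M u v" for M u v
    using that by (simp add: digit_def state_def)
  consider (four) u v where "digit 4 u v" | (no4) "\<And>M u v. digit M u v \<Longrightarrow> M \<noteq> 4" by blast
  then show ?thesis
  proof cases
    case four
    then show ?thesis
      using in_S[OF four] four_tail_eq[OF four] four_tail_eq[OF digit_sym[OF four]] by (simp add: diff_divide_distrib add_divide_distrib)
  next
    case no4
    show ?thesis
    proof (cases "\<exists>u v. digit 6 u v")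
      case True
      then obtain u v where d6: "digit 6 u v" by blast
      then have "u = 1 - 2 * kap" "v = 1 - 2 * kap"
        using no_four_digit_le[OF no4] digit_sym by force+
      then show ?thesis using in_S[OF d6] by simp
    next
      case False
      then have all5: "M = 5" if "digit M u v" for M u v using no_four_digit_le[OF _ that] no4 that False by metis
      have "u = 1 - 2 * kap" "v = 1 - 2 * kap"
        using no_four_tail_le[OF no4] all_five_tail_ge[OF all5] d digit_sym[OF d] by (meson antisym)+
      then show ?thesis using in_S[OF d] all5[OF d] by simp
    qed
  qed
qed

end

section \<open>Billiards with small values\<close>

lemma lambda_le_imp_bound:
  assumes "lambda \<i> (billiard \<alpha> \<beta>) \<le> ereal (1 / \<kappa>)" "\<kappa> > 0" "\<alpha> \<noteq> \<beta>"
  shows "\<kappa> * \<bar>wedge (bdry_vec \<alpha>) (bdry_vec \<beta>)\<bar> \<le> \<bar>dot (bdry_vec \<alpha>) (bdry_vec \<beta>)\<bar>"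
proof -
  define r where "r = \<bar>dot (bdry_vec \<alpha>) (bdry_vec \<beta>)\<bar> / \<bar>wedge (bdry_vec \<alpha>) (bdry_vec \<beta>)\<bar>"
  have w: "\<bar>wedge (bdry_vec \<alpha>) (bdry_vec \<beta>)\<bar> > 0" using wedge_bdry_vec[OF assms(3)] by simp
  have r0: "r \<ge> 0" by (simp add: r_def)
  have le: "inverse (ereal r) \<le> ereal (1 / \<kappa>)"
    using order_trans[OF lambda_ge[OF assms(3)] assms(1)] by (simp add: r_def)
  then have "r \<noteq> 0" by (auto simp: zero_ereal_def[symmetric])
  then have "1 / r \<le> 1 / \<kappa>" using le by (simp add: inverse_eq_divide)
  then have "\<kappa> \<le> r" using r0 \<open>r \<noteq> 0\<close> assms(2) by (simp add: field_simps)
  then show ?thesis using w by (simp add: r_def field_simps)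
qed

definition endpoint_pairs :: "dcurve set \<Rightarrow> (real \<times> real) set" where
  "endpoint_pairs B = {(x, y). x \<noteq> y \<and> (billiard (Some x) (Some y) = B \<or> billiard (Some x) (Some y) = converse ` B)}"

lemma converse_image_image: "converse ` converse ` (B :: dcurve set) = B"
  by (simp add: image_image)

lemma endpoint_pairs_admissible:
  assumes "lambda \<i> B \<le> ereal (1 / kap)"
  shows "admissible_pairs (endpoint_pairs B)"
proof
  fix x y assume xy: "(x, y) \<in> endpoint_pairs B"
  then have "x \<noteq> y" "lambda \<i> (billiard (Some x) (Some y)) = lambda \<i> B"
    by (auto simp: endpoint_pairs_def lambda_converse)
  then show "kap * \<bar>x - y\<bar> \<le> \<bar>x * y + 1\<bar>"
    using lambda_le_imp_bound[of "Some x" "Some y" kap] assms kap_bounds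
    by (simp add: wedge_def dot_def abs_minus_commute)
  show "(- x, - y) \<in> endpoint_pairs B" using xy by (auto simp: endpoint_pairs_def billiard_neg)
  show "(y, x) \<in> endpoint_pairs B"
    using xy billiard_swap[of "Some x" "Some y"] by (auto simp: endpoint_pairs_def converse_image_image)
  show "(x + of_int n, y + of_int n) \<in> endpoint_pairs B" for n
    using xy by (auto simp: endpoint_pairs_def billiard_shift)
  show "(1 / x, 1 / y) \<in> endpoint_pairs B" if "x \<noteq> 0" "y \<noteq> 0"
    using xy that by (auto simp: endpoint_pairs_def billiard_inverse)
qed

text \<open>Go left through the points n + \<i> under the arc until the left endpoint lies in [n -
  1, n); translation by n - 1 then gives a state. The bounds keep the arc from dropping below n - 1
  + \<i> before that.\<close>

lemma (in admissible_pairs) inside_imp_state: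
  assumes "(x, y) \<in> S" "x < of_int n" "1 < (of_int n - x) * (y - of_int n)"
  shows "\<exists>v X. state v X"
  using assms(2-)
proof (induction "nat (n - \<lfloor>x\<rfloor>)" arbitrary: n rule: less_induct)
  case less
  note k = kap_bounds
  define v X where "v = x - of_int (n - 1)" and "X = y - of_int (n - 1)"
  have S: "(v, X) \<in> S" using shift[OF assms(1), of "1 - n"] by (simp add: v_def X_def algebra_simps)
  have in1: "1 < (1 - v) * (X - 1)" using less.prems by (simp add: v_def X_def algebra_simps)
  have v1: "v < 1" using less.prems by (simp add: v_def)
  show ?case
  proof (cases "v \<ge> 0")
    case True
    then show ?thesis using S in1 v1 state_def by blast
  next
    case False
    have "0 < (1 - v) * (X - 1)" using in1 by simp
    then have X1: "X > 1" using v1 by (auto simp: zero_less_mult_iff)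
    have s: "\<bar>v - X\<bar> = X - v" using X1 v1 by simp
    \<comment> \<open>For an arc above 1 + \<i> but not above \<i>, the two bounds add up to 2 kap
      (X - v) \<le> v + X - 1. This forces X > 4, hence kap (X - v) > 1 and v X > 0, although v < 0
      < X.\<close>
    have "1 < - v * X"
    proof (rule ccontr)
      assume no: "\<not> 1 < - v * X"
      have a: "kap * (X - v) \<le> v * X + 1" using bound[OF S] no unfolding s by simp
      have "kap * (X - v) \<le> \<bar>(v - 1) * (X - 1) + 1\<bar>" using bound_shift[OF S, of 1] unfolding s by simp
      moreover have "(v - 1) * (X - 1) + 1 < 0" using in1 by (simp add: algebra_simps)
      ultimately have "kap * (X - v) \<le> (1 - v) * (X - 1) - 1" by (simp add: algebra_simps)
      then have b: "2 * (kap * (X - v)) \<le> v + X - 1" using a by (simp add: algebra_simps)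
      have "3956 * (X - v) \<le> (10000 * kap) * (X - v)" using k X1 v1 by (intro mult_right_mono) auto
      then have c: "3956 * (X - v) \<le> 10000 * (kap * (X - v))" by simp
      have "10000 * (2 * (kap * (X - v))) \<le> 10000 * (v + X - 1)" using b by simp
      then have "X > 4" using c False by simp
      then have "kap * (X - v) > 1" using c False by simp
      then have "v * X > 0" using a by simp
      then show False using False X1 by (simp add: zero_less_mult_iff)
    qed
    then have "1 < (of_int (n - 1) - x) * (y - of_int (n - 1))" by (simp add: v_def X_def)
    moreover have "x < of_int (n - 1)" using False by (simp add: v_def)
    moreover from this have "\<lfloor>x\<rfloor> < n" by linarith
    ultimately show ?thesis by (intro less.hyps[of "n - 1"]) auto
  qed
qed

text \<open>A semicircle through the triangle that passes below both \<open>\<i>\<close> and \<open>1 + \<i>\<close> comes too close to one of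
  them.\<close>

lemma (in admissible_pairs) meets_triangle_imp_state:
  assumes S: "(x, y) \<in> S" and xy: "x < y" and z: "z \<in> semicircle x y" "z \<in> mod_triangle"
  shows "\<exists>v X. state v X"
proof -
  note k = kap_bounds
  define a b where "a = Re z" and "b = Im z"
  have a: "0 \<le> a" "a \<le> 1 / 2" and ab: "1 \<le> a\<^sup>2 + b\<^sup>2" and b: "(a - x) * (y - a) = b\<^sup>2" "b > 0"
    using z unfolding semicircle_iff mod_triangle_def
    by (auto simp: a_def b_def upper_half_plane_def cmod_power2[symmetric] one_le_power)
  have a2: "a\<^sup>2 \<le> 1 / 4" using power_mono[OF a(2,1), of 2] by (simp add: power2_eq_square)
  have "0 < (a - x) * (y - a)" using b by simp
  then have x_a: "x < a" "a < y" using xy by (auto simp: zero_less_mult_iff)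
  show ?thesis
  proof (rule ccontr)
    assume no: "\<not> ?thesis"
    have no0: "\<not> 1 < - x * y" if "x < 0" using inside_imp_state[OF S, of 0] that no by auto
    have no1: "\<not> 1 < (1 - x) * (y - 1)" if "x < 1" using inside_imp_state[OF S, of 1] that no by auto
    have "- 1 \<le> x * y"
    proof (cases "x < 0")
      case False
      then have "0 \<le> x * y" using xy by simp
      then show ?thesis by simp
    qed (use no0 in auto)
    then have 0: "kap * (y - x) \<le> x * y + 1" using bound[OF S] xy by simp
    have "(1 - x) * (y - 1) \<le> 1" using no1 x_a a by linarith
    then have "0 \<le> (x - 1) * (y - 1) + 1" by (simp add: algebra_simps)
    then have 1: "kap * (y - x) \<le> (x - 1) * (y - 1) + 1" using bound_shift[OF S, of 1] xy by simp
    have xyv: "x * y = a * (x + y) - (a\<^sup>2 + b\<^sup>2)" using b by (simp add: algebra_simps power2_eq_square)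
    have "0 < kap * (y - x)" using k xy by simp
    have p: "kap * (y - x) \<le> a * (x + y)" using 0 ab xyv by linarith
    then have "0 < a * (x + y)" using \<open>0 < kap * (y - x)\<close> by linarith
    then have "x + y \<ge> 0" using a by (simp add: zero_less_mult_iff)
    define s T where "s = x + y" and "T = a * (x + y)"
    have "2 * T \<le> s" using mult_right_mono[OF a(2) \<open>x + y \<ge> 0\<close>] by (simp add: s_def T_def)
    moreover have "kap * (y - x) \<le> T - s + 1" using 1 ab xyv by (simp add: s_def T_def algebra_simps)
    \<comment> \<open>The bounds at \<i> and 1 + \<i> add up to this and make the diameter at most 3
      / 2; but as (Im z)^2 \<ge> 3 / 4 in the triangle, it is at least sqrt 3.\<close>
    ultimately have "2 * (kap * (y - x)) \<le> 1" using p unfolding T_def[symmetric] by linarith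
    moreover have "3956 * (y - x) \<le> (10000 * kap) * (y - x)" using k xy by (intro mult_right_mono) auto
    ultimately have "y - x \<le> 3 / 2" by simp
    then have "(y - x)\<^sup>2 \<le> (3 / 2)\<^sup>2" using xy by (intro power_mono) auto
    moreover have "(y - x)\<^sup>2 = (x + y - 2 * a)\<^sup>2 + 4 * b\<^sup>2" using b by (simp add: power2_eq_square algebra_simps)
    moreover have "0 \<le> (x + y - 2 * a)\<^sup>2" by simp
    moreover have "3 \<le> 4 * b\<^sup>2" using ab a2 by simp
    ultimately have "3 \<le> (3 / 2 :: real)\<^sup>2" by linarith
    then show False by (simp add: power2_eq_square)
  qed
qed

section \<open>Geodesics ending at infinity\<close>

lemma billiard_vertical_shift: "billiard None (Some (x + of_int n)) = billiard None (Some x)"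
  by (rule billiard_lin[of "mat2 1 n 0 1" _ _ _ _ 1 1]) (simp_all add: GL2Z_def)

lemma billiard_vertical_neg: "billiard None (Some (- x)) = billiard None (Some x)"
  by (rule billiard_lin[of "mat2 (-1) 0 0 1" _ _ _ _ "-1" 1]) (simp_all add: GL2Z_def)

text \<open>Move the finite endpoint to y in [0, 1 / 2]. The bound at \<i> gives kap \<le> y; after
  inversion the bound at 1 + \<i> gives kap \<le> 1 - 2 y, against kap > 1 / 3.\<close>

lemma vertical_not_admissible:
  assumes "lambda \<i> (billiard None (Some x)) \<le> ereal (1 / kap)"
  shows False
proof -
  note k = kap_bounds
  define y where "y = \<bar>x + of_int (- round x)\<bar>"
  have "billiard None (Some y) = billiard None (Some x)"
    unfolding y_def abs_if using billiard_vertical_shift[of x "- round x"] billiard_vertical_neg by presburger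
  then have le: "lambda \<i> (billiard None (Some y)) \<le> ereal (1 / kap)" using assms by simp
  have y: "0 \<le> y" "y \<le> 1 / 2"
    using of_int_round_abs_le[of x] by (simp_all add: y_def abs_minus_commute)
  have ky: "kap \<le> y" using lambda_le_imp_bound[OF le] k y by (simp add: wedge_def dot_def)
  then have y0: "y > 0" using k by simp
  have "billiard (Some (0 + of_int (-1))) (Some (1 / y + of_int (-1))) = billiard (Some 0) (Some (1 / y))"
    using y0 by (intro billiard_shift) simp
  then have "lambda \<i> (billiard (Some (0 + of_int (-1))) (Some (1 / y + of_int (-1)))) \<le> ereal (1 / kap)"
    using le y0 by (simp add: billiard_inverse_infinity)
  from lambda_le_imp_bound[OF this] have "kap * (1 / y) \<le> \<bar>2 - 1 / y\<bar>"
    using k y0 by (simp add: wedge_def dot_def)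
  then have "kap \<le> \<bar>2 - 1 / y\<bar> * y" using y0 by (simp add: field_simps)
  also have "\<dots> = \<bar>2 * y - 1\<bar>" using y0 by (simp add: abs_mult_pos' algebra_simps flip: abs_mult_pos)
  finally show False using k ky y by simp
qed

lemma admissible_state:
  assumes le: "lambda \<i> (billiard \<alpha> \<beta>) \<le> ereal (1 / kap)" and ne: "\<alpha> \<noteq> \<beta>"
  shows "\<exists>v X. admissible_pairs.state (endpoint_pairs (billiard \<alpha> \<beta>)) v X"
proof -
  interpret admissible_pairs "endpoint_pairs (billiard \<alpha> \<beta>)" by (rule endpoint_pairs_admissible[OF le])
  define p q where "p = bdry_vec \<alpha>" and "q = bdry_vec \<beta>"
  have B: "billiard \<alpha> \<beta> = vec_billiard p q" using billiard_eq_vec_billiard[OF ne] by (simp add: p_def q_def)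
  have w: "wedge p q \<noteq> 0" using wedge_bdry_vec[OF ne] by (simp add: p_def q_def)
  then have "0 < wedge p q * wedge p q" by (metis not_square_less_zero not_less_iff_gr_or_eq mult_eq_0_iff)
  then obtain z where "z \<in> billiard_points (vec_billiard p q)" using fold_billiard_point by blast
  then obtain M t where M: "M \<in> GL2Z" and zt: "z = geo_pt (lin M p) (lin M q) t"
    and pos: "0 < t * wedge (lin M p) (lin M q)" and zT: "z \<in> mod_triangle"
    by (auto simp: billiard_points_vec_billiard[OF w])
  define P Q where "P = lin M p" and "Q = lin M q"
  have BPQ: "vec_billiard P Q = billiard \<alpha> \<beta>" using vec_billiard_lin[OF M] by (simp add: P_def Q_def B)
  have wPQ: "wedge P Q \<noteq> 0" using pos by (auto simp: P_def Q_def)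
  have nv: "snd P \<noteq> 0" if "vec_billiard P Q = B" "wedge P Q \<noteq> 0" "lambda \<i> B \<le> ereal (1 / kap)" for P Q B
  proof
    assume P0: "snd P = 0"
    then have nz: "fst P \<noteq> 0" "snd Q \<noteq> 0" using that by (auto simp: wedge_def)
    have "vec_billiard (fst P * 1, fst P * 0) (snd Q * (fst Q / snd Q), snd Q * 1) = billiard None (Some (fst Q / snd Q))"
      using vec_billiard_scale[OF nz, of "(1, 0)" "(fst Q / snd Q, 1)"] billiard_eq_vec_billiard[of None "Some (fst Q / snd Q)"] by simp
    moreover have "(fst P * 1, fst P * 0) = P" "(snd Q * (fst Q / snd Q), snd Q * 1) = Q" using P0 nz by (simp_all add: prod_eq_iff)
    ultimately have "billiard None (Some (fst Q / snd Q)) = B" using that by simp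
    then show False using vertical_not_admissible that by blast
  qed
  have P0: "snd P \<noteq> 0" by (rule nv[OF BPQ wPQ le])
  have "vec_billiard Q P = converse ` billiard \<alpha> \<beta>" using vec_billiard_swap[of Q P] BPQ by simp
  moreover have "wedge Q P \<noteq> 0" using wPQ by (simp add: wedge_def)
  ultimately have Q0: "snd Q \<noteq> 0" using nv le by (simp add: lambda_converse)
  define x y where "x = fst P / snd P" and "y = fst Q / snd Q"
  have PQ: "(snd P * x, snd P * 1) = P" "(snd Q * y, snd Q * 1) = Q" using P0 Q0 by (simp_all add: x_def y_def)
  have xy: "x \<noteq> y" using wPQ P0 Q0 by (auto simp: x_def y_def wedge_def field_simps)
  have "billiard (Some x) (Some y) = billiard \<alpha> \<beta>"
    using vec_billiard_scale[OF P0 Q0, of "(x, 1)" "(y, 1)"] billiard_eq_vec_billiard[of "Some x" "Some y"] xy PQ BPQ by simp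
  then have S: "(x, y) \<in> endpoint_pairs (billiard \<alpha> \<beta>)" using xy by (simp add: endpoint_pairs_def)
  have "(z, z) \<in> geo P Q" using pos unfolding geo_def zt P_def Q_def by blast
  also have "geo P Q = geodesic (Some x) (Some y)"
    using geo_scale[OF P0 Q0, of "(x, 1)" "(y, 1)"] geo_semicircle[OF xy] PQ by simp
  finally have zs: "z \<in> semicircle x y" by simp
  show ?thesis
  proof (cases "x < y")
    case True
    then show ?thesis using meets_triangle_imp_state[OF S _ zs zT] by blast
  next
    case False
    moreover have "z \<in> semicircle y x" using zs by (auto simp: semicircle_iff algebra_simps)
    ultimately show ?thesis using meets_triangle_imp_state[OF swap[OF S] _ _ zT] xy by auto
  qed
qed

section \<open>The three billiards by reduced endpoints, and their symmetry\<close>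

lemma kap_endpoints: "1 - 2 * kap = (5 - sqrt 21) / 2" "4 + 2 * kap = (5 + sqrt 21) / 2" "5 + 2 * kap = (7 + sqrt 21) / 2"
  by (simp_all add: kap_def field_simps)

lemma inverse_kap: "1 / kap = (3 + sqrt 21) / 3"
proof -
  have "(3 + sqrt 21) / 3 * kap = 1" by (simp add: kap_def field_simps)
  then show ?thesis using kap_bounds by (simp add: field_simps)
qed

lemma billiard_C1_kap: "billiard_C1 = billiard (Some (1 - 2 * kap)) (Some (4 + 2 * kap))"
  unfolding billiard_C1_def kap_endpoints
  by (subst billiard_shift[where n = 2, symmetric]) (simp_all add: field_simps)

lemma billiard_C2_reduced: "billiard_C2 = billiard (Some ((4 - sqrt 14) / 2)) (Some ((4 + sqrt 14) / 2))"
  unfolding billiard_C2_def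
  by (subst billiard_shift[where n = 1, symmetric]) (simp_all add: field_simps)

lemma billiard_C3_kap: "billiard_C3 = billiard (Some (1 - 2 * kap)) (Some (5 + 2 * kap))"
proof -
  have "0 < 2 * sqrt 21 + 2" by (intro add_pos_pos) simp_all
  then have "(3 - sqrt 21) / 2 < (5 + sqrt 21) / 2" by (simp add: field_simps)
  then show ?thesis
    unfolding billiard_C3_def kap_endpoints
    by (subst billiard_shift[where n = 1, symmetric]) (simp_all add: add_divide_distrib diff_divide_distrib)
qed

text \<open>The reflection x -> n - x belongs to the group and exchanges the endpoints.\<close>

lemma billiard_symmetric:
  assumes "x \<noteq> y" "x + y = of_int n"
  shows "billiard (Some y) (Some x) = billiard (Some x) (Some y)"
proof -
  have "y = - x + of_int n" "x = - y + of_int n" using assms(2) by simp_all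
  then have "billiard (Some y) (Some x) = billiard (Some (- x + of_int n)) (Some (- y + of_int n))" by metis
  also have "\<dots> = billiard (Some x) (Some y)" using assms billiard_shift[of "- x" "- y" n] billiard_neg[of x y] by simp
  finally show ?thesis .
qed

lemma converse_C1: "converse ` billiard_C1 = billiard_C1"
  using billiard_symmetric[of "1 - 2 * kap" "4 + 2 * kap" 5] kap_bounds
  by (simp add: billiard_C1_kap flip: billiard_swap)

lemma converse_C2: "converse ` billiard_C2 = billiard_C2"
  using billiard_symmetric[of "(4 - sqrt 14) / 2" "(4 + sqrt 14) / 2" 4]
  by (simp add: billiard_C2_reduced add_divide_distrib diff_divide_distrib flip: billiard_swap)

lemma converse_C3: "converse ` billiard_C3 = billiard_C3"
  using billiard_symmetric[of "1 - 2 * kap" "5 + 2 * kap" 6] kap_bounds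
  by (simp add: billiard_C3_kap flip: billiard_swap)

lemma small_lambda_billiards:
  assumes B: "B \<in> modular_billiards" and le: "lambda \<i> B \<le> ereal (1 / kap)"
  shows "B = billiard_C1 \<or> B = billiard_C2 \<or> B = billiard_C3"
proof -
  obtain \<alpha> \<beta> where ne: "\<alpha> \<noteq> \<beta>" and B: "B = billiard \<alpha> \<beta>" using B by (auto simp: modular_billiards_def)
  interpret admissible_pairs "endpoint_pairs B" by (rule endpoint_pairs_admissible[OF le])
  obtain v X where "state v X" using admissible_state[of \<alpha> \<beta>] le ne B by blast
  note cl = state_classification[OF this]
  have mem: "billiard (Some x) (Some y) \<in> {B, converse ` B}" if "(x, y) \<in> endpoint_pairs B" for x y
    using that by (simp add: endpoint_pairs_def)
  from cl have "billiard_C1 \<in> {B, converse ` B} \<or> billiard_C2 \<in> {B, converse ` B} \<or> billiard_C3 \<in> {B, converse ` B}"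
    unfolding billiard_C1_kap billiard_C2_reduced billiard_C3_kap
    by (rule disj_forward[OF _ mem disj_forward[OF _ mem mem]])
  \<comment> \<open>The classification finds B only up to reversal, which fixes each of the three
    billiards.\<close>
  moreover have "B = C" if "C \<in> {B, converse ` B}" "converse ` C = C" for C
  proof -
    from that(1) consider "C = B" | "C = converse ` B" by blast
    then show ?thesis
    proof cases
      case 2
      have "B = converse ` C" unfolding 2 converse_image_image ..
      then show ?thesis using that(2) by (rule trans)
    qed (rule sym)
  qed
  ultimately show ?thesis using converse_C1 converse_C2 converse_C3 by blast
qed

section \<open>The three values\<close>

lemma lambda_le_chain:
  fixes v X \<kappa> :: real and M :: int
  assumes "\<forall>v X. P v X \<longrightarrow> (\<exists>M. chain_step \<kappa> M v X \<and> P (1 / (M - v)) (1 / (M - X)))"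
    and "\<kappa> > 0" "M \<ge> 3" "P v X" "P (M - X) (M - v)" "v < X"
  shows "lambda \<i> (billiard (Some v) (Some X)) \<le> ereal (1 / \<kappa>)"
proof (rule lambda_le)
  fix a b c d :: int assume "\<bar>a * d - b * c\<bar> = 1"
  \<comment> \<open>A row (a, b) takes the value of \<open>root_form\<close> at the vector (- b,
    a).\<close>
  then have "\<bar>(- b) * c - a * (- d)\<bar> = 1" by (simp add: mult.commute abs_minus_commute)
  from chain_bound[OF assms(1-5) this] assms(6)
  show "\<kappa> * \<bar>v - X\<bar> \<le> \<bar>(a * v + b) * (a * X + b) + (c * v + d) * (c * X + d)\<bar>"
    by (simp add: root_form_def algebra_simps)
qed (use assms in auto)

lemma lambda_ge_finite:
  assumes "x < y" "x * y + 1 > 0"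
  shows "ereal ((y - x) / (x * y + 1)) \<le> lambda \<i> (billiard (Some x) (Some y))"
  using lambda_ge[of "Some x" "Some y"] assms by (simp add: wedge_def dot_def)

lemma lambda_C1: "lambda \<i> billiard_C1 = ereal (sqrt 21 / 2)"
proof (rule antisym)
  define v X where "v = (5 - sqrt 21) / 2" and "X = (5 + sqrt 21) / 2"
  have r: "4.58 < sqrt 21" "sqrt 21 < 4.59"
    by (rule real_less_rsqrt, simp add: power2_eq_square) (rule real_less_lsqrt, simp_all add: power2_eq_square)
  have B: "billiard_C1 = billiard (Some v) (Some X)" by (simp add: billiard_C1_kap kap_endpoints v_def X_def)
  have prods: "v * X = 1" "(1 - v) * (X - 1) = 3" "(4 - v) * (X - 5 + 1) = 3" "(5 - v) * (5 - X) = 1" "X - v = sqrt 21"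
    by (simp_all add: v_def X_def field_simps)
  have inv: "1 / (5 - v) = v" "1 / (5 - X) = X" using prods(1) r by (simp_all add: v_def X_def field_simps)
  have "0 \<le> v" "v < 1" "4 < X" "X < 5" using r by (simp_all add: v_def X_def)
  \<comment> \<open>For this \<kappa> all three inequalities are equalities. The step with digit 5
    fixes (v, X), so the chain has a single state.\<close>
  then have c: "chain_step (2 / sqrt 21) 5 v X"
    unfolding chain_step_def using prods by simp
  have "lambda \<i> (billiard (Some v) (Some X)) \<le> ereal (1 / (2 / sqrt 21))"
  proof (rule lambda_le_chain[where P = "\<lambda>a b. a = v \<and> b = X" and M = 5])
    show "\<forall>(a::real) (b::real). a = v \<and> b = X \<longrightarrow>
        (\<exists>M::int. chain_step (2 / sqrt 21) M a b \<and> 1 / (M - a) = v \<and> 1 / (M - b) = X)"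
      using c inv by (intro allI impI exI[of _ 5]) simp
  qed (use r in \<open>auto simp: v_def X_def field_simps\<close>)
  then show "lambda \<i> billiard_C1 \<le> ereal (sqrt 21 / 2)" by (simp add: B)
  show "ereal (sqrt 21 / 2) \<le> lambda \<i> billiard_C1"
    using lambda_ge_finite[of v X] r unfolding prods B by (simp add: v_def X_def)
qed

lemma lambda_C2: "lambda \<i> billiard_C2 = ereal (2 / 3 * sqrt 14)"
proof (rule antisym)
  define v X where "v = (4 - sqrt 14) / 2" and "X = (4 + sqrt 14) / 2"
  define v' X' where "v' = 4 - sqrt 14" and "X' = 4 + sqrt 14"
  note r = sqrt14_bounds
  note defs = v_def X_def v'_def X'_def
  have B: "billiard_C2 = billiard (Some v) (Some X)" by (simp add: billiard_C2_reduced v_def X_def)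
  have prods: "v * X = 1 / 2" "(1 - v) * (X - 1) = 5 / 2" "(3 - v) * (X - 4 + 1) = 5 / 2" "(4 - v) * (4 - X) = 1 / 2" "X - v = sqrt 14"
    "(1 - v') * (X' - 1) = 5" "(7 - v') * (X' - 8 + 1) = 5" "(8 - v') * (8 - X') = 2" "X' - v' = 2 * sqrt 14"
    by (simp_all add: defs field_simps)
  have inv: "1 / (4 - v) = v'" "1 / (4 - X) = X'" "1 / (8 - v') = v" "1 / (8 - X') = X"
    using r by (simp_all add: defs field_simps)
  \<comment> \<open>At the digit 4 all three inequalities are equalities, at the digit 8 only the
    third.\<close>
  have c1: "chain_step (3 / (2 * sqrt 14)) 4 v X"
  proof -
    have "0 \<le> v" "v < 1" "3 < X" "X < 4" using r by (simp_all add: v_def X_def)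
    then show ?thesis unfolding chain_step_def using prods by simp
  qed
  have c2: "chain_step (3 / (2 * sqrt 14)) 8 v' X'"
  proof -
    have "0 \<le> v'" "v' < 1" "7 < X'" "X' < 8" using r by (simp_all add: v'_def X'_def)
    then show ?thesis unfolding chain_step_def using prods by simp
  qed
  have "lambda \<i> (billiard (Some v) (Some X)) \<le> ereal (1 / (3 / (2 * sqrt 14)))"
  proof (rule lambda_le_chain[where P = "\<lambda>a b. (a = v \<and> b = X) \<or> (a = v' \<and> b = X')" and M = 4])
    show "\<forall>(a::real) (b::real). a = v \<and> b = X \<or> a = v' \<and> b = X' \<longrightarrow> (\<exists>M::int. chain_step (3 / (2 * sqrt 14)) M a b \<and>
        (1 / (M - a) = v \<and> 1 / (M - b) = X \<or> 1 / (M - a) = v' \<and> 1 / (M - b) = X'))"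
    proof (intro allI impI, elim disjE conjE)
      fix a b assume "a = v" "b = X"
      then show "\<exists>M::int. chain_step (3 / (2 * sqrt 14)) M a b \<and>
        (1 / (M - a) = v \<and> 1 / (M - b) = X \<or> 1 / (M - a) = v' \<and> 1 / (M - b) = X')"
        using c1 inv by (intro exI[of _ 4]) simp
    next
      fix a b assume "a = v'" "b = X'"
      then show "\<exists>M::int. chain_step (3 / (2 * sqrt 14)) M a b \<and>
        (1 / (M - a) = v \<and> 1 / (M - b) = X \<or> 1 / (M - a) = v' \<and> 1 / (M - b) = X')"
        using c2 inv by (intro exI[of _ 8]) simp
    qed
  qed (use r in \<open>auto simp: v_def X_def field_simps\<close>)
  then show "lambda \<i> billiard_C2 \<le> ereal (2 / 3 * sqrt 14)" by (simp add: B)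
  show "ereal (2 / 3 * sqrt 14) \<le> lambda \<i> billiard_C2"
    using lambda_ge_finite[of v X] r unfolding prods B by (simp add: v_def X_def mult.commute)
qed

lemma kap_inverse: "1 / (1 - 2 * kap) = 4 + 2 * kap" "1 / (4 + 2 * kap) = 1 - 2 * kap"
proof -
  have "(1 - 2 * kap) * (4 + 2 * kap) = 4 - (4 * kap\<^sup>2 + 6 * kap)" by (simp add: power2_eq_square algebra_simps)
  then have "(1 - 2 * kap) * (4 + 2 * kap) = 1" by (simp add: kap_quadratic)
  then show "1 / (1 - 2 * kap) = 4 + 2 * kap" "1 / (4 + 2 * kap) = 1 - 2 * kap"
    using kap_bounds by (simp_all add: field_simps)
qed

lemma kap_square: "kap * kap = (3 - 6 * kap) / 4"
  using kap_quadratic by (simp add: power2_eq_square field_simps)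

text \<open>Only fives follow, as X = 5 - (1 - 2 kap), while the tail before the digit is arbitrary
  up to its maximum. This serves all states past the last 6.\<close>

lemma chain_step_tail:
  assumes v: "0 \<le> v" "v \<le> 1 - 2 * kap" and \<kappa>: "0 < \<kappa>" "\<kappa> \<le> kap"
  shows "chain_step \<kappa> 5 v (4 + 2 * kap)"
proof -
  note k = kap_bounds
  define s where "s = 4 + 2 * kap - v"
  have k': "3956 < 10000 * kap" "10000 * kap < 3957" using k by simp_all
  have s: "s > 0" using v k by (simp add: s_def)
  have ks: "\<kappa> * s \<le> kap * s" using \<kappa> s by simp
  have kv: "0 \<le> kap * v" "v * kap \<le> (1 - 2 * kap) * kap" using v k by (auto intro: mult_right_mono)
  have sq: "kap * kap = (3 - 6 * kap) / 4" by (rule kap_square)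
  have kse: "kap * s = 4 * kap + 2 * (kap * kap) - kap * v" by (simp add: s_def algebra_simps)
  have kv': "kap * v \<le> kap - 2 * (kap * kap)" using kv(2) by (simp add: algebra_simps)
  have A: "1 + \<kappa> * s \<le> (1 - v) * (4 + 2 * kap - 1)"
  proof -
    have "(1 - v) * (4 + 2 * kap - 1) = 3 + 2 * kap - 3 * v - 2 * (kap * v)" by (simp add: algebra_simps)
    then show ?thesis using ks kse sq kv kv' v k' by linarith
  qed
  have B: "1 + \<kappa> * s \<le> (5 - 1 - v) * (4 + 2 * kap - 5 + 1)"
  proof -
    have "(5 - 1 - v) * (4 + 2 * kap - 5 + 1) = 8 * kap - 2 * (kap * v)" by (simp add: algebra_simps)
    then show ?thesis using ks kse sq kv kv' v k' by linarith
  qed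
  have C: "\<kappa> * s \<le> (5 - v) * (5 - (4 + 2 * kap)) + 1"
  proof -
    have "(5 - v) * (5 - (4 + 2 * kap)) = 5 - 10 * kap - v + 2 * (kap * v)" by (simp add: algebra_simps)
    moreover have "3956 * v \<le> (10000 * kap) * v" using k v by (intro mult_right_mono) auto
    then have "3956 * v \<le> 10000 * (kap * v)" by simp
    ultimately show ?thesis using ks kse sq kv kv' v k' by linarith
  qed
  show ?thesis unfolding chain_step_def using v k A B C by (simp add: s_def)
qed

lemma lambda_C3: "lambda \<i> billiard_C3 = ereal ((3 + sqrt 21) / 3)"
proof (rule antisym)
  note k = kap_bounds
  have eq: "kap * (4 + 4 * kap) = 3 - 2 * kap" "(1 - 2 * kap) * (5 + 2 * kap) + 1 = 3 - 2 * kap"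
    using kap_square by (simp_all add: algebra_simps)
  have c6: "chain_step kap 6 (1 - 2 * kap) (5 + 2 * kap)"
  proof -
    have "2 * kap * (4 + 2 * kap) = 3 + 2 * kap" using kap_square by (simp add: algebra_simps)
    then show ?thesis unfolding chain_step_def using eq k by (simp add: mult.commute algebra_simps)
  qed
  \<comment> \<open>Past the 6 the tail v changes at every step, so a range stands for it; X stays
    at its fixed point.\<close>
  define P where "P v X \<longleftrightarrow> v = 1 - 2 * kap \<and> X = 5 + 2 * kap \<or> 0 \<le> v \<and> v \<le> 1 - 2 * kap \<and> X = 4 + 2 * kap" for v X
  have "lambda \<i> (billiard (Some (1 - 2 * kap)) (Some (5 + 2 * kap))) \<le> ereal (1 / kap)"
  proof (rule lambda_le_chain[where P = P and M = 6])
    show "\<forall>(v::real) (X::real). P v X \<longrightarrow> (\<exists>M::int. chain_step kap M v X \<and> P (1 / (M - v)) (1 / (M - X)))"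
    proof (intro allI impI)
      fix v X assume "P v X"
      then consider "v = 1 - 2 * kap" "X = 5 + 2 * kap" | "0 \<le> v" "v \<le> 1 - 2 * kap" "X = 4 + 2 * kap"
        unfolding P_def by blast
      then show "\<exists>M::int. chain_step kap M v X \<and> P (1 / (M - v)) (1 / (M - X))"
      proof cases
        case 1
        moreover have "1 / (5 + 2 * kap) \<le> 1 - 2 * kap"
        proof -
          have "1 / (5 + 2 * kap) \<le> 1 / (4 + 2 * kap)" using k by (intro divide_left_mono) auto
          then show ?thesis by (simp only: kap_inverse)
        qed
        ultimately show ?thesis using c6 k by (intro exI[of _ 6]) (simp add: P_def kap_inverse)
      next
        case v: 2
        then have "1 / (5 - v) \<le> 1 / (4 + 2 * kap)" using k by (intro divide_left_mono) auto
        then have "1 / (5 - v) \<le> 1 - 2 * kap" by (simp only: kap_inverse)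
        then show ?thesis using chain_step_tail[OF v(1,2), of kap] k v by (intro exI[of _ 5]) (simp add: P_def kap_inverse)
      qed
    qed
  qed (use k in \<open>simp_all add: P_def\<close>)
  then show "lambda \<i> billiard_C3 \<le> ereal ((3 + sqrt 21) / 3)" by (simp only: billiard_C3_kap inverse_kap)
  have "ereal (1 / kap) \<le> lambda \<i> billiard_C3"
  proof -
    have "(5 + 2 * kap - (1 - 2 * kap)) / ((1 - 2 * kap) * (5 + 2 * kap) + 1) = (4 + 4 * kap) / (kap * (4 + 4 * kap))"
      unfolding eq by simp
    also have "\<dots> = 1 / kap" using k by simp
    finally show ?thesis
      using lambda_ge_finite[of "1 - 2 * kap" "5 + 2 * kap"] k eq by (simp add: billiard_C3_kap)
  qed
  then show "ereal ((3 + sqrt 21) / 3) \<le> lambda \<i> billiard_C3" by (simp only: inverse_kap)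
qed


section \<open>Values close to the third one\<close>

text \<open>The minus continued fraction with j fives, one 6, then fives forever;
  \<open>5 + 2 * kap\<close> is 6 minus the all-five tail.\<close>

primrec tail_frac :: "nat \<Rightarrow> real" where
  "tail_frac 0 = 1 / (5 + 2 * kap)"
| "tail_frac (Suc j) = 1 / (5 - tail_frac j)"

lemma tail_frac_bounds: "1 / (5 + 2 * kap) \<le> tail_frac j" "tail_frac j < 1 - 2 * kap"
proof (induction j)
  case 0
  have "1 / (5 + 2 * kap) < 1 / (4 + 2 * kap)" using kap_bounds by (intro divide_strict_left_mono) auto
  then show "1 / (5 + 2 * kap) \<le> tail_frac 0" "tail_frac 0 < 1 - 2 * kap" by (simp_all only: kap_inverse tail_frac.simps)
next
  case (Suc j)
  have w: "0 \<le> tail_frac j" using Suc kap_bounds by (intro order_trans[OF _ Suc(1)]) auto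
  have "1 / (5 + 2 * kap) \<le> 1 / (5 - tail_frac j)"
    using Suc w kap_bounds by (intro divide_left_mono) auto
  then show "1 / (5 + 2 * kap) \<le> tail_frac (Suc j)" by simp
  have "1 / (5 - tail_frac j) < 1 / (4 + 2 * kap)"
    using Suc kap_bounds by (intro divide_strict_left_mono) auto
  then show "tail_frac (Suc j) < 1 - 2 * kap" by (simp only: kap_inverse tail_frac.simps)
qed

lemma tail_frac_numeric:
  "1726 \<le> 10000 * tail_frac j" "10000 * tail_frac j < 2088" "2070 \<le> 10000 * tail_frac (Suc j)"
proof -
  have lo: "1726 \<le> 10000 * tail_frac j" for j
  proof -
    have "1726 / 10000 \<le> 1 / (5 + 2 * kap)" using kap_bounds by (simp add: field_simps)
    then show ?thesis using tail_frac_bounds(1)[of j] by simp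
  qed
  show "1726 \<le> 10000 * tail_frac j" by (rule lo)
  show hi: "10000 * tail_frac j < 2088" using tail_frac_bounds(2)[of j] kap_bounds by simp
  show "2070 \<le> 10000 * tail_frac (Suc j)" using lo[of j] hi by (simp add: field_simps)
qed

lemma tail_frac_diff: "(1 - 2 * kap) - tail_frac (Suc j) = ((1 - 2 * kap) - tail_frac j) / ((4 + 2 * kap) * (5 - tail_frac j))"
proof -
  have "5 - tail_frac j \<noteq> 0" "4 + 2 * kap \<noteq> 0" using tail_frac_numeric[of j] kap_bounds by auto
  then have "1 / (4 + 2 * kap) - 1 / (5 - tail_frac j) = ((1 - 2 * kap) - tail_frac j) / ((4 + 2 * kap) * (5 - tail_frac j))"
    by (simp add: diff_frac_eq)
  then show ?thesis by (simp only: kap_inverse tail_frac.simps)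
qed

text \<open>The step contracts towards its fixed point, so each additional 5 brings the tail
  geometrically closer.\<close>

lemma tail_frac_Suc_diff_le: "(1 - 2 * kap) - tail_frac (Suc j) \<le> ((1 - 2 * kap) - tail_frac j) / 16"
proof -
  have "4 * 4 \<le> (4 + 2 * kap) * (5 - tail_frac j)" using tail_frac_numeric[of j] kap_bounds by (intro mult_mono) auto
  then show ?thesis unfolding tail_frac_diff using tail_frac_bounds(2)[of j] by (intro divide_left_mono) auto
qed

lemma tail_frac_less_Suc: "tail_frac j < tail_frac (Suc j)"
  using tail_frac_Suc_diff_le[of j] tail_frac_bounds(2)[of j] by simp

lemma strict_mono_tail_frac: "strict_mono tail_frac"
  using tail_frac_less_Suc by (simp only: strict_mono_Suc_iff) blast

lemma tail_frac_close:
  assumes "e > 0"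
  shows "\<exists>n. (1 - 2 * kap) - tail_frac n \<le> e"
proof -
  have le: "(1 - 2 * kap) - tail_frac n \<le> (1 / 16) ^ n" for n
  proof (induction n)
    case 0
    show ?case using tail_frac_numeric[of 0] kap_bounds by simp
  next
    case (Suc n)
    then show ?case using tail_frac_Suc_diff_le[of n] by simp
  qed
  obtain n where "(1 / 16 :: real) ^ n < e" using real_arch_pow_inv[OF assms, of "1 / 16"] by auto
  then show ?thesis using le[of n] by (meson less_imp_le order_trans)
qed

text \<open>The endpoints have the digits \<open>\<dots>, 5, 5, 6, 5, \<dots>, 5, 6, 5, 5, \<dots>\<close> with a long middle block of fives:
  seen from either \<open>6\<close> the geodesic is close to the one of \<^const>\<open>billiard_C3\<close>.\<close>

lemma lambda_close_to_third:
  assumes \<kappa>: "0 < \<kappa>" "\<kappa> < kap"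
  shows "\<exists>x y. x \<noteq> y \<and> ereal (1 / kap) < lambda \<i> (billiard (Some x) (Some y))
    \<and> lambda \<i> (billiard (Some x) (Some y)) \<le> ereal (1 / \<kappa>)"
proof -
  define u where "u = 1 - 2 * kap"
  define w where "w = tail_frac"
  \<comment> \<open>The slack \<open>d\<close> pays for tails that differ from the all-five value
    \<open>u\<close>; the block length makes \<open>e\<close> and \<open>e'\<close> at most d /
    2.\<close>
  define d where "d = kap - \<kappa>"
  have d: "d > 0" using \<kappa> by (simp add: d_def)
  have k: "3956 < 10000 * kap" "10000 * kap < 3957" using kap_bounds by simp_all
  have u: "2086 < 10000 * u" "10000 * u < 2088" using k by (simp_all add: u_def)
  note kk = kap_square
  obtain m where m: "u - w m \<le> d / 2" using tail_frac_close[of "d / 2"] d by (auto simp: u_def w_def)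
  define n where "n = Suc m"
  define e where "e = u - w n"
  define e' where "e' = u - w m"
  have e': "0 < e'" "2 * e' \<le> d" using m tail_frac_bounds(2)[of m] by (simp_all add: e'_def u_def w_def)
  have e: "0 < e" "2 * e \<le> d"
    using tail_frac_bounds(2)[of n] tail_frac_less_Suc[of m] e' by (simp_all add: e_def e'_def u_def w_def n_def)
  have wb: "1726 \<le> 10000 * w j" "10000 * w j < 2088" "2070 \<le> 10000 * w (Suc j)" for j
    using tail_frac_numeric by (simp_all add: w_def)
  have w_inv: "1 / w (Suc j) = 5 - w j" "1 / w 0 = 6 - u" "1 / (6 - u) = w 0" "1 / (5 - w j) = w (Suc j)" for j
    using wb(1)[of j] by (simp_all add: w_def u_def)
  have u_inv: "1 / u = 4 + 2 * kap" "6 - (5 + 2 * kap) = u" "6 - u = 5 + 2 * kap" by (simp_all add: u_def kap_inverse)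
  \<comment> \<open>The block has n = m + 1 fives: at position j, j fives lie between the digit and
    the 6 before it, and m - j between it and the 6 after it.\<close>
  define P where "P v X \<longleftrightarrow> v = u \<and> X = 6 - w n \<or> (\<exists>j\<le>m. v = w j \<and> X = 5 - w (m - j))
    \<or> v = w n \<and> X = 6 - u \<or> 0 \<le> v \<and> v \<le> u \<and> X = 4 + 2 * kap" for v X
  have prod_mono: "a * b \<le> x * y" if "0 \<le> a" "a \<le> x" "0 \<le> b" "b \<le> y" for a b x y :: real
    using that by (intro mult_mono) auto
  have ks: "10000 * (\<kappa> * s) \<le> 3957 * s" if "s \<ge> 0" for s
    using mult_right_mono[of "10000 * \<kappa>" 3957 s] \<kappa> k that by simp
  \<comment> \<open>Tails t lie between 0.1726 and 0.2088. This bounds the factors 1 - t and 5 - t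
    at a 6, and in \<open>mid\<close> the factors 1 - t and 4 - t at a 5, where s \<le> 5 - 2 *
    0.1726.\<close>
  have big: "1 + \<kappa> * s \<le> a * b" if "7911 \<le> 10000 * a" "47911 \<le> 10000 * b" "0 \<le> s" "s \<le> 6" for a b s
  proof -
    have "7911 * 47911 \<le> (10000 * a) * (10000 * b)" using that by (intro mult_mono) auto
    then have "37902 \<le> 10000 * (a * b)" by simp
    moreover have "10000 * (1 + \<kappa> * s) \<le> 33742" using ks[OF that(3)] that(4) by simp
    ultimately have "10000 * (1 + \<kappa> * s) \<le> 10000 * (a * b)" by linarith
    then show ?thesis by simp
  qed
  have mid: "1 + \<kappa> * s \<le> a * b" if "7911 \<le> 10000 * a" "37911 \<le> 10000 * b" "0 \<le> s" "10000 * s \<le> 46548" for a b s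
  proof -
    have "7911 * 37911 \<le> (10000 * a) * (10000 * b)" using that by (intro mult_mono) auto
    then have "29991 \<le> 10000 * (a * b)" by simp
    moreover have "10000 * (1 + \<kappa> * s) \<le> 28420" using ks[OF that(3)] that(4) by simp
    ultimately have "10000 * (1 + \<kappa> * s) \<le> 10000 * (a * b)" by linarith
    then show ?thesis by simp
  qed
  \<comment> \<open>The equality case of the digit 6, with both tails \<open>u\<close> and \<kappa>
    = kap. \<open>A\<close> and \<open>B\<close> perturb it, losing terms in \<open>e\<close> and
    gaining terms in \<open>d\<close>.\<close>
  have eqA: "(6 - u) * u + 1 = kap * (6 - 2 * u)"
    using kk by (simp add: u_def algebra_simps)
  have kd: "\<kappa> = kap - d" by (simp add: d_def)
  have A: "\<kappa> * (6 - w n - u) \<le> (6 - u) * w n + 1"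
  proof -
    have "(6 - u) * w n + 1 - \<kappa> * (6 - w n - u) = d * (6 - 2 * u) - e * (6 - u + \<kappa>)"
      using eqA by (simp add: kd e_def algebra_simps)
    moreover have "e * (6 - u + \<kappa>) \<le> e * 7" using e u k \<kappa> by (intro mult_left_mono) auto
    moreover have "d * 5 \<le> d * (6 - 2 * u)" using d u by (intro mult_left_mono) auto
    ultimately show ?thesis using e by linarith
  qed
  have B: "\<kappa> * (6 - u - w n) \<le> (6 - w n) * u + 1"
  proof -
    have "(6 - w n) * u - (6 - u) * w n = 6 * e" by (simp add: e_def algebra_simps)
    then show ?thesis using A e by (simp add: algebra_simps)
  qed
  \<comment> \<open>The last 5 before the second 6: its bound at 5 + \<i> is the bound at \<i> of
    the next state, so it is also tight in the limit. The tail \<open>w 0\<close> is kept exact and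
    only \<open>w m\<close> is compared with \<open>u\<close>.\<close>
  have C: "\<kappa> * (5 - w 0 - w m) \<le> (5 - w m) * w 0 + 1"
  proof -
    have w0: "w 0 * (6 - u) = 1" using w_inv(2) wb(1)[of 0] by (simp add: field_simps)
    have "(6 - u) * ((5 - u) * w 0 + 1 - kap * (5 - w 0 - u)) = (5 - u) * (w 0 * (6 - u)) + (6 - u) - kap * ((6 - u) * (5 - u) - w 0 * (6 - u))"
      by (simp add: algebra_simps)
    also have "(6 - u) * (5 - u) = 23 + 12 * kap" using kk by (simp add: u_def algebra_simps)
    also have "(5 - u) * (w 0 * (6 - u)) + (6 - u) - kap * (23 + 12 * kap - w 0 * (6 - u)) = 0"
      unfolding w0 using kk by (simp add: u_def algebra_simps)
    finally have "(5 - u) * w 0 + 1 = kap * (5 - w 0 - u)" using u by simp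
    then have "(5 - w m) * w 0 + 1 - \<kappa> * (5 - w 0 - w m) = d * (5 - w 0 - u) + e' * (w 0 - \<kappa>)"
      by (simp add: kd e'_def algebra_simps)
    moreover have "e' * (- 1) \<le> e' * (w 0 - \<kappa>)" using e' wb(1)[of 0] k \<kappa> by (intro mult_left_mono) auto
    moreover have "d * 4 \<le> d * (5 - w 0 - u)" using d u wb(2)[of 0] by (intro mult_left_mono) auto
    ultimately show ?thesis using e' by linarith
  qed
  have six: "chain_step \<kappa> 6 a (6 - b)"
    if a: "1726 \<le> 10000 * a" "10000 * a < 2088" and b: "1726 \<le> 10000 * b" "10000 * b < 2088"
      and outer: "\<kappa> * (6 - b - a) \<le> (6 - a) * b + 1" for a b
  proof -
    have "1 + \<kappa> * (6 - b - a) \<le> (1 - a) * (6 - b - 1)" using a b by (intro big) auto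
    moreover have "1 + \<kappa> * (6 - b - a) \<le> (6 - b - 6 + 1) * (6 - 1 - a)" using a b by (intro big) auto
    ultimately show ?thesis
      unfolding chain_step_def of_int_numeral using a b outer by (simp only: mult.commute[of "6 - b - 6 + 1"]) simp
  qed
  have five: "chain_step \<kappa> 5 a (5 - b)"
    if a: "1726 \<le> 10000 * a" "10000 * a < 2088" and b: "1726 \<le> 10000 * b" "10000 * b < 2088"
      and outer: "\<kappa> * (5 - b - a) \<le> (5 - a) * b + 1" for a b
  proof -
    have "1 + \<kappa> * (5 - b - a) \<le> (1 - a) * (5 - b - 1)" using a b by (intro mid) auto
    moreover have "1 + \<kappa> * (5 - b - a) \<le> (5 - b - 5 + 1) * (5 - 1 - a)" using a b by (intro mid) auto
    ultimately show ?thesis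
      unfolding chain_step_def of_int_numeral using a b outer by (simp only: mult.commute[of "5 - b - 5 + 1"]) simp
  qed
  have step1: "chain_step \<kappa> 6 u (6 - w n)" using u wb[of n] A by (intro six) auto
  have step3: "chain_step \<kappa> 6 (w n) (6 - u)" using u wb[of n] B by (intro six) auto
  have step2: "chain_step \<kappa> 5 (w j) (5 - w (m - j))" if "j \<le> m" for j
  proof -
    have "\<kappa> * (5 - w (m - j) - w j) \<le> (5 - w j) * w (m - j) + 1"
    proof (cases "m - j")
      case 0
      then have "j = m" using that by simp
      then show ?thesis using C by simp
    next
      case (Suc i)
      \<comment> \<open>Earlier in the block the tail after the digit begins with a 5 and is at
        least 0.2070, so crude estimates suffice.\<close>
      have "47912 * 2070 \<le> (10000 * (5 - w j)) * (10000 * w (Suc i))"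
        using wb(2)[of j] wb(3)[of i] by (intro mult_mono) auto
      moreover have "(10000 * (5 - w j)) * (10000 * w (Suc i)) = 10000 * (10000 * ((5 - w j) * w (Suc i)))"
        by (simp only: ac_simps)
      ultimately have "9917 \<le> 10000 * ((5 - w j) * w (Suc i))" by linarith
      moreover have "10000 * (\<kappa> * (5 - w (Suc i) - w j)) \<le> 3957 * (5 - w (Suc i) - w j)"
        using wb(2)[of j] wb(2)[of "Suc i"] by (intro ks) auto
      moreover have "5 - w (Suc i) - w j \<le> 5" using wb(1)[of j] wb(1)[of "Suc i"] by simp
      ultimately have "10000 * (\<kappa> * (5 - w (Suc i) - w j)) \<le> 10000 * ((5 - w j) * w (Suc i) + 1)" by simp
      then show ?thesis unfolding Suc by simp
    qed
    then show ?thesis using wb(1,2)[of j] wb(1,2)[of "m - j"] by (intro five) auto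
  qed
  have closed: "\<forall>(v::real) (X::real). P v X \<longrightarrow> (\<exists>M::int. chain_step \<kappa> M v X \<and> P (1 / (M - v)) (1 / (M - X)))"
  proof (intro allI impI)
    fix v X :: real assume "P v X"
    then consider "v = u" "X = 6 - w n" | j where "j \<le> m" "v = w j" "X = 5 - w (m - j)"
      | "v = w n" "X = 6 - u" | "0 \<le> v" "v \<le> u" "X = 4 + 2 * kap" unfolding P_def by blast
    then show "\<exists>M::int. chain_step \<kappa> M v X \<and> P (1 / (M - v)) (1 / (M - X))"
    proof cases
      case 1
      have "P (w 0) (5 - w m)" unfolding P_def by force
      then show ?thesis using step1 1 w_inv by (intro exI[of _ 6]) (simp add: n_def)
    next
      case 2
      have "P (w (Suc j)) (1 / w (m - j))"
      proof (cases "m - j")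
        case 0
        then show ?thesis using 2 w_inv by (simp add: P_def n_def)
      next
        case (Suc i)
        then have "Suc j \<le> m" "m - Suc j = i" using 2 by auto
        then show ?thesis unfolding Suc w_inv P_def by blast
      qed
      then show ?thesis using step2[OF 2(1)] 2 w_inv by (intro exI[of _ 5]) simp
    next
      case 3
      have "1 / (6 - w n) \<le> 1 / (4 + 2 * kap)" using wb(2)[of n] k by (intro divide_left_mono) auto
      then have "1 / (6 - w n) \<le> u" unfolding kap_inverse u_def .
      moreover have "0 \<le> 1 / (6 - w n)" using wb(2)[of n] by simp
      ultimately have "P (1 / (6 - w n)) (1 / u)" by (simp add: P_def u_inv)
      then show ?thesis using step3 3 by (intro exI[of _ 6]) simp
    next
      case 4
      have "1 / (5 - v) \<le> 1 / (4 + 2 * kap)" using 4 k by (intro divide_left_mono) (auto simp: u_def)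
      then have "1 / (5 - v) \<le> u" unfolding kap_inverse u_def .
      moreover have "0 \<le> 1 / (5 - v)" using 4 u by simp
      ultimately have "P (1 / (5 - v)) (1 / u)" by (simp add: P_def u_inv)
      then have "P (1 / (5 - v)) (1 / (5 - X))" using 4 by (simp add: u_def)
      then show ?thesis using chain_step_tail[of v \<kappa>] 4 \<kappa> by (intro exI[of _ 5]) (simp add: u_def)
    qed
  qed
  have "lambda \<i> (billiard (Some u) (Some (6 - w n))) \<le> ereal (1 / \<kappa>)"
  proof (rule lambda_le_chain[where P = P and M = 6])
    show "P u (6 - w n)" "P (real_of_int 6 - (6 - w n)) (real_of_int 6 - u)" by (simp_all add: P_def)
    show "u < 6 - w n" using u wb(2)[of n] by simp
  qed (use closed \<kappa> in simp_all)
  moreover have "ereal (1 / kap) < lambda \<i> (billiard (Some u) (Some (6 - w n)))"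
  proof (rule less_le_trans)
    have pos: "0 < u * (6 - w n) + 1" using u wb(2)[of n] by (intro add_pos_pos mult_pos_pos) auto
    show "ereal ((6 - w n - u) / (u * (6 - w n) + 1)) \<le> lambda \<i> (billiard (Some u) (Some (6 - w n)))"
      using u wb(2)[of n] pos by (intro lambda_ge_finite) auto
    \<comment> \<open>Lowering one tail from \<open>u\<close> to \<open>w n\<close> spoils the
      equality by e (kap - u) > 0, so the value strictly exceeds the third one.\<close>
    have "kap * (6 - w n - u) - (u * (6 - w n) + 1) = e * (kap - u)"
      using eqA by (simp add: e_def algebra_simps)
    also have "\<dots> > 0" using e u k by simp
    finally have "1 / kap < (6 - w n - u) / (u * (6 - w n) + 1)" using pos k by (simp add: field_simps)
    then show "ereal (1 / kap) < ereal ((6 - w n - u) / (u * (6 - w n) + 1))" by simp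
  qed
  moreover have "u \<noteq> 6 - w n" using u wb(2)[of n] by auto
  ultimately show ?thesis by blast
qed

lemma third_value_islimpt: "ereal (1 / kap) islimpt lambda_spectrum \<i>"
proof -
  define \<kappa> where "\<kappa> n = kap - kap / real (n + 2)" for n
  have \<kappa>: "0 < \<kappa> n" "\<kappa> n < kap" for n
  proof -
    have "0 < kap / real (n + 2)" "kap / real (n + 2) < kap / 1"
      using kap_bounds by (simp, intro divide_strict_left_mono) auto
    then show "0 < \<kappa> n" "\<kappa> n < kap" by (simp_all add: \<kappa>_def)
  qed
  obtain x y where xy: "x n \<noteq> y n" "ereal (1 / kap) < lambda \<i> (billiard (Some (x n)) (Some (y n)))"
    "lambda \<i> (billiard (Some (x n)) (Some (y n))) \<le> ereal (1 / \<kappa> n)" for n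
    using lambda_close_to_third[OF \<kappa>] by metis
  define f where "f n = lambda \<i> (billiard (Some (x n)) (Some (y n)))" for n
  have "(\<lambda>n. kap / real (n + 2)) \<longlonglongrightarrow> 0"
    by (rule LIMSEQ_ignore_initial_segment[OF lim_const_over_n])
  then have "(\<lambda>n. 1 / \<kappa> n) \<longlonglongrightarrow> 1 / (kap - 0)"
    unfolding \<kappa>_def using kap_bounds by (intro tendsto_intros) auto
  then have "(\<lambda>n. ereal (1 / \<kappa> n)) \<longlonglongrightarrow> ereal (1 / kap)" by simp
  then have "f \<longlonglongrightarrow> ereal (1 / kap)"
    by (rule tendsto_sandwich[OF _ _ tendsto_const, rotated 2])
      (use xy in \<open>auto simp: f_def less_imp_le\<close>)
  moreover have "f n \<in> lambda_spectrum \<i> - {ereal (1 / kap)}" for n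
    using xy(1)[of n] xy(2)[of n] unfolding lambda_spectrum_def modular_billiards_def f_def by fastforce
  ultimately show ?thesis unfolding islimpt_sequential by blast
qed

section \<open>Segments of a billiard with irrational endpoints\<close>

text \<open>With \<open>m sqrt d\<close> an integer, the smaller multiple \<open>m (sqrt d - f)\<close> is one too, which gives a descent.\<close>

lemma irrational_multiple:
  fixes m n :: int and d f :: nat
  assumes f: "real f < sqrt d" "sqrt d < real f + 1" and eq: "m * sqrt d = n"
  shows "m = 0"
  using eq
proof (induction "nat \<bar>m\<bar>" arbitrary: m n rule: less_induct)
  case less
  show ?case
  proof (rule ccontr)
    assume m: "m \<noteq> 0"
    define m' where "m' = n - f * m"
    have m': "real_of_int m' = m * (sqrt d - f)" using less.prems by (simp add: m'_def algebra_simps)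
    have "m' * sqrt d = real_of_int (m * d - f * n)"
    proof -
      have "m' * sqrt d = m * (sqrt d * sqrt d) - f * (m * sqrt d)" unfolding m' by (simp add: algebra_simps)
      then show ?thesis using less.prems by simp
    qed
    moreover have "\<bar>m'\<bar> < \<bar>m\<bar>"
    proof -
      have "\<bar>real_of_int m'\<bar> = \<bar>real_of_int m\<bar> * (sqrt d - f)" unfolding m' using f by (simp add: abs_mult)
      also have "\<dots> < \<bar>real_of_int m\<bar> * 1" using m f by (intro mult_strict_left_mono) auto
      finally show ?thesis by simp
    qed
    ultimately have "m' = 0" using m by (intro less.hyps[of m' "m * d - f * n"]) auto
    then show False using m' m f by simp
  qed
qed

text \<open>Phrased for linear forms because the denominators c x + d of Moebius images must not
  vanish.\<close>

definition irrational :: "real \<Rightarrow> bool" where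
  "irrational x \<longleftrightarrow> (\<forall>(c::int) (d::int). of_int c * x + of_int d = 0 \<longrightarrow> c = 0)"

lemma irrationalI:
  fixes d f :: nat and a b k :: int and x :: real
  assumes "real f < sqrt d" "sqrt d < real f + 1" "b \<noteq> 0" "k \<noteq> 0" "k * x = a + b * sqrt d"
  shows "irrational x"
proof -
  have zero: "m = 0" if "of_int m * x + of_int n = 0" for m n :: int
  proof -
    have "k * (m * x + n) = 0" using that by simp
    then have "m * (k * x) = - k * n" by (simp add: algebra_simps)
    then have "m * (a + b * sqrt d) = - k * n" unfolding assms(5) by simp
    then have "real_of_int (m * b) * sqrt d = real_of_int (- k * n - m * a)" by (simp add: algebra_simps)
    from irrational_multiple[OF assms(1,2) this] assms(3) show ?thesis by simp
  qed
  show ?thesis unfolding irrational_def by (intro allI impI) (rule zero)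
qed

lemma irrational_endpoints:
  "irrational (1 - 2 * kap)" "irrational (4 + 2 * kap)" "irrational (5 + 2 * kap)"
  "irrational ((4 - sqrt 14) / 2)" "irrational ((4 + sqrt 14) / 2)"
proof -
  have "real 4 < sqrt (real 21)" "sqrt (real 21) < real 4 + 1"
    by (rule real_less_rsqrt, simp) (rule real_less_lsqrt, simp_all)
  note I = irrationalI[OF this, where k = 2]
  show "irrational (1 - 2 * kap)" by (rule I[where a = 5 and b = "- 1"]) (simp_all add: kap_endpoints)
  show "irrational (4 + 2 * kap)" by (rule I[where a = 5 and b = 1]) (simp_all add: kap_endpoints)
  show "irrational (5 + 2 * kap)" by (rule I[where a = 7 and b = 1]) (simp_all add: kap_endpoints)
  have "real 3 < sqrt (real 14)" "sqrt (real 14) < real 3 + 1"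
    by (rule real_less_rsqrt, simp) (rule real_less_lsqrt, simp_all)
  note J = irrationalI[OF this, where k = 2]
  show "irrational ((4 - sqrt 14) / 2)" by (rule J[where a = 4 and b = "- 1"]) simp_all
  show "irrational ((4 + sqrt 14) / 2)" by (rule J[where a = 4 and b = 1]) simp_all
qed

lemma irrational_denom: "irrational x \<Longrightarrow> (c, d) \<noteq> (0, 0) \<Longrightarrow> of_int c * x + of_int d \<noteq> 0"
  unfolding irrational_def by fastforce

text \<open>No geodesic of the orbit ends at infinity, so every segment is cut from a semicircle
  with explicit endpoints.\<close>

lemma irrational_billiard_segment:
  fixes x y :: real
  assumes xy: "x \<noteq> y" and irr: "irrational x" "irrational y" and s: "s \<in> billiard (Some x) (Some y)"
  obtains a b c d :: int where "\<bar>a * d - b * c\<bar> = 1" "c * x + d \<noteq> 0" "c * y + d \<noteq> 0"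
    "(a * x + b) / (c * x + d) \<noteq> (a * y + b) / (c * y + d)"
    "s = geodesic (Some ((a * x + b) / (c * x + d))) (Some ((a * y + b) / (c * y + d))) \<inter> (mod_triangle \<times> mod_triangle)"
    "s \<noteq> {}"
proof -
  from s obtain M where M: "M \<in> GL2Z" and sM: "s = geo (lin M (x, 1)) (lin M (y, 1)) \<inter> (mod_triangle \<times> mod_triangle)"
    and ne: "s \<noteq> {}"
    using xy by (auto simp: billiard_eq_vec_billiard vec_billiard_def)
  define a b c d where "a = M$1$1" and "b = M$1$2" and "c = M$2$1" and "d = M$2$2"
  have det: "\<bar>a * d - b * c\<bar> = 1" using M by (auto simp: GL2Z_def det_2 a_def b_def c_def d_def)
  have cd: "(c, d) \<noteq> (0, 0)" using det by auto
  note nz = irrational_denom[OF irr(1) cd] irrational_denom[OF irr(2) cd]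
  define x' y' where "x' = (a * x + b) / (c * x + d)" and "y' = (a * y + b) / (c * y + d)"
  have lin: "lin M (x, 1) = ((c * x + d) * fst (x', 1::real), (c * x + d) * snd (x', 1::real))"
    "lin M (y, 1) = ((c * y + d) * fst (y', 1::real), (c * y + d) * snd (y', 1::real))"
    using nz by (simp_all add: lin_def x'_def y'_def a_def b_def c_def d_def)
  have "x' \<noteq> y'"
  proof
    assume "x' = y'"
    then have "(a * x + b) * (c * y + d) = (a * y + b) * (c * x + d)" using nz by (simp add: x'_def y'_def field_simps)
    then have "(a * d - b * c) * (x - y) = 0" by (simp add: algebra_simps)
    moreover have "real_of_int (a * d - b * c) \<noteq> 0" using det by linarith
    ultimately show False using xy by simp
  qed
  moreover have "s = geodesic (Some x') (Some y') \<inter> (mod_triangle \<times> mod_triangle)"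
    unfolding sM lin geo_scale[OF nz] geo_semicircle[OF \<open>x' \<noteq> y'\<close>] ..
  ultimately show ?thesis using that[OF det nz] ne unfolding x'_def y'_def by blast
qed

lemma geodesic_cut_memD:
  assumes "(z, w) \<in> geodesic (Some x) (Some y) \<inter> (mod_triangle \<times> mod_triangle)"
  shows "z \<in> semicircle x y" "w \<in> semicircle x y" "z \<in> mod_triangle" "w \<in> mod_triangle"
  using assms by auto

text \<open>A semicircle meets a vertical line at most once.\<close>

lemma proper_irrational:
  assumes "x \<noteq> y" "irrational x" "irrational y"
  shows "proper (billiard (Some x) (Some y))"
  unfolding proper_def improper_def
proof
  assume "\<exists>s\<in>billiard (Some x) (Some y). vertical_segment s"
  then obtain s where s: "s \<in> billiard (Some x) (Some y)" "vertical_segment s" by blast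
  then obtain z w a where zw: "(z, w) \<in> s" "z \<noteq> w" "Field s \<subseteq> vertical_line a"
    unfolding vertical_segment_def by blast
  have "z \<in> Field s" "w \<in> Field s" using zw(1) by (auto simp: Field_def)
  then have re: "Re z = Re w" using zw(3) by (auto simp: vertical_line_def)
  from irrational_billiard_segment[OF assms s(1)] obtain x' y' where
    "s = geodesic (Some x') (Some y') \<inter> (mod_triangle \<times> mod_triangle)" by metis
  then have "z \<in> semicircle x' y'" "w \<in> semicircle x' y'" using zw(1) geodesic_cut_memD by blast+
  then have "Im z > 0" "Im w > 0" "(Im z)\<^sup>2 = (Im w)\<^sup>2" using re by (simp_all add: semicircle_iff)
  then have "Im z = Im w" by (simp add: power2_eq_iff_nonneg)
  then show False using re zw(2) by (simp add: complex_eq_iff)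
qed

lemma mod_triangle_Im: "z \<in> mod_triangle \<Longrightarrow> (Im z)\<^sup>2 \<ge> 3 / 4 \<and> Im z \<ge> 1 / 2"
proof -
  assume z: "z \<in> mod_triangle"
  then have "0 \<le> Re z" "Re z \<le> 1 / 2" "Im z > 0" "1 \<le> (norm z)\<^sup>2"
    by (auto simp: mod_triangle_def upper_half_plane_def one_le_power)
  moreover have "(Re z)\<^sup>2 \<le> (1 / 2)\<^sup>2" using calculation by (intro power_mono) auto
  ultimately have sq: "(Im z)\<^sup>2 \<ge> 3 / 4" unfolding cmod_power2 by (simp add: power2_eq_square)
  have "1 / 2 \<le> Im z"
    by (rule power2_le_imp_le) (use sq \<open>Im z > 0\<close> in \<open>simp_all add: power2_eq_square\<close>)
  then show ?thesis using sq by simp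
qed

text \<open>From (x + y - 2 Re z)^2 + (2 Im z)^2 = (x - y)^2: the diameter bounds the height and the
  centre, and it cannot be small over the triangle.\<close>

lemma semicircle_triangle_bounds:
  assumes z: "z \<in> semicircle x y" "z \<in> mod_triangle"
  shows "1 \<le> \<bar>x - y\<bar>" "2 * Im z \<le> \<bar>x - y\<bar>" "\<bar>x + y\<bar> \<le> \<bar>x - y\<bar> + 1"
proof -
  have Re: "0 \<le> Re z" "Re z \<le> 1 / 2" using z(2) by (auto simp: mod_triangle_def)
  have Im: "Im z > 0" "(Im z)\<^sup>2 \<ge> 3 / 4" using mod_triangle_Im[OF z(2)] mod_triangle_Im_pos[OF z(2)] by auto
  have eq: "(x + y - 2 * Re z)\<^sup>2 + (2 * Im z)\<^sup>2 = (x - y)\<^sup>2"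
    using z(1) unfolding semicircle_iff by (simp add: power2_eq_square algebra_simps)
  have 1: "(2 * Im z)\<^sup>2 \<le> (x - y)\<^sup>2" "(x + y - 2 * Re z)\<^sup>2 \<le> (x - y)\<^sup>2"
    using eq zero_le_power2[of "x + y - 2 * Re z"] zero_le_power2[of "2 * Im z"] by linarith+
  have "\<bar>2 * Im z\<bar> \<le> \<bar>x - y\<bar>" using 1(1) by (simp only: abs_le_square_iff)
  then show "2 * Im z \<le> \<bar>x - y\<bar>" by simp
  moreover have "2 * Im z \<ge> 1" using mod_triangle_Im[OF z(2)] by simp
  ultimately show "1 \<le> \<bar>x - y\<bar>" by linarith
  have "\<bar>x + y - 2 * Re z\<bar> \<le> \<bar>x - y\<bar>" using 1(2) by (simp add: abs_le_square_iff)
  then show "\<bar>x + y\<bar> \<le> \<bar>x - y\<bar> + 1" using Re by linarith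
qed

lemma segment_length_finite:
  "segment_length (geodesic (Some x) (Some y) \<inter> (mod_triangle \<times> mod_triangle)) < \<infinity>"
proof -
  define K where "K = 1 + (1 + (x - y)\<^sup>2) * 2"
  have K: "K \<ge> 1" by (simp add: K_def)
  have "hyp_dist z w \<le> arcosh K" if zw: "(z, w) \<in> geodesic (Some x) (Some y) \<inter> (mod_triangle \<times> mod_triangle)" for z w
  proof -
    note m = geodesic_cut_memD[OF zw]
    have I: "Im z \<ge> 1 / 2" "Im w \<ge> 1 / 2" "2 * Im z \<le> \<bar>x - y\<bar>" "2 * Im w \<le> \<bar>x - y\<bar>"
      using mod_triangle_Im m semicircle_triangle_bounds by blast+
    have R: "\<bar>Re z - Re w\<bar> \<le> 1" using m(3,4) by (auto simp: mod_triangle_def)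
    have pos: "Im z > 0" "Im w > 0" using I by auto
    have "(norm (z - w))\<^sup>2 \<le> 1 + (x - y)\<^sup>2"
    proof -
      have "\<bar>Im z - Im w\<bar> \<le> \<bar>x - y\<bar>" using I pos by linarith
      then have "(Im z - Im w)\<^sup>2 \<le> (x - y)\<^sup>2" by (simp add: abs_le_square_iff)
      moreover have "(Re z - Re w)\<^sup>2 \<le> 1" using R by (simp add: abs_square_le_1)
      ultimately show ?thesis unfolding cmod_power2 by simp
    qed
    moreover have "1 / 2 \<le> 2 * Im z * Im w"
      using mult_mono[of "1 / 2" "Im z" "1 / 2" "Im w"] I by simp
    ultimately have "(norm (z - w))\<^sup>2 / (2 * Im z * Im w) \<le> (1 + (x - y)\<^sup>2) / (1 / 2)"
      by (intro frac_le) auto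
    then have "cosh (hyp_dist z w) \<le> cosh (arcosh K)" using K by (simp add: cosh_hyp_dist[OF pos] K_def)
    then show ?thesis
      using cosh_hyp_dist(2)[OF pos] arcosh_nonneg_real[OF K] by (simp only: cosh_real_nonneg_le_iff)
  qed
  then have "segment_length (geodesic (Some x) (Some y) \<inter> (mod_triangle \<times> mod_triangle)) \<le> ennreal (arcosh K)"
    unfolding segment_length_def by (intro SUP_least) (auto simp: ennreal_leI simp del: geodesic.simps)
  then show ?thesis by (simp add: le_less_trans)
qed

text \<open>For conjugate quadratic endpoints all geodesics of the orbit have integral coefficients and the same
  discriminant, so only finitely many of them meet the triangle.\<close>

lemma periodic_quadratic:
  fixes A B C :: int and x y :: real
  assumes xy: "x \<noteq> y" and irr: "irrational x" "irrational y"
    and A: "A \<noteq> 0" "A * (x + y) = B" "A * (x * y) = C"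
  shows "periodic (billiard (Some x) (Some y))"
proof -
  define D where "D = \<bar>A\<bar> * \<bar>x - y\<bar>"
  have D: "D > 0" using xy A by (simp add: D_def)
  define g :: "int \<times> int \<times> int \<Rightarrow> dcurve" where
    "g = (\<lambda>(a, b, e). geodesic (Some ((b / a + e * (D / a)) / 2)) (Some ((b / a - e * (D / a)) / 2)) \<inter> (mod_triangle \<times> mod_triangle))"
  \<comment> \<open>\<open>D\<close> is the square root of the common discriminant: |A'| |x' - y'| =
    D. Arcs meeting the triangle have |x' - y'| \<ge> 1, so |A'| \<le> D and |B'| \<le> 2 D.\<close>
  define I where "I = {n :: int. \<bar>real_of_int n\<bar> \<le> D * (D + 2)}"
  have "finite I" unfolding I_def by (rule finite_bounded_ints)
  have "billiard (Some x) (Some y) \<subseteq> g ` (I \<times> I \<times> {-1, 1})"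
  proof
    fix s assume "s \<in> billiard (Some x) (Some y)"
    from irrational_billiard_segment[OF xy irr this] obtain a b c d :: int where det: "\<bar>a * d - b * c\<bar> = 1"
      and nz: "c * x + d \<noteq> 0" "c * y + d \<noteq> 0"
      and s: "s = geodesic (Some ((a * x + b) / (c * x + d))) (Some ((a * y + b) / (c * y + d))) \<inter> (mod_triangle \<times> mod_triangle)"
      and ne: "s \<noteq> {}" by metis
    define x' y' where "x' = (a * x + b) / (c * x + d)" and "y' = (a * y + b) / (c * y + d)"
    \<comment> \<open>Leading and middle coefficient, up to sign, of the transformed quadratic
      polynomial with roots x' and y'.\<close>
    define A' where "A' = C * c * c + B * c * d + A * d * d"
    define B' where "B' = 2 * a * c * C + (a * d + b * c) * B + 2 * b * d * A"
    define E where "E = a * d - b * c"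
    have A': "real_of_int A' = A * ((c * x + d) * (c * y + d))"
      unfolding A'_def of_int_add of_int_mult A(2,3)[symmetric] by (simp add: algebra_simps)
    have A'0: "A' \<noteq> 0" using A(1) nz A' by (metis mult_eq_0_iff of_int_0 of_int_0_eq_iff)
    have x': "(c * x + d) * x' = a * x + b" "(c * y + d) * y' = a * y + b" using nz by (simp_all add: x'_def y'_def)
    have B': "A' * (x' + y') = B'"
    proof -
      have "A' * (x' + y') = A * (((c * x + d) * x') * (c * y + d) + ((c * y + d) * y') * (c * x + d))"
        unfolding A' by (simp add: algebra_simps)
      also have "\<dots> = 2 * a * c * (A * (x * y)) + (a * d + b * c) * (A * (x + y)) + 2 * b * d * A"
        unfolding x' by (simp add: algebra_simps)
      finally show ?thesis unfolding A by (simp add: B'_def)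
    qed
    have "A' * (x' - y') = A * (((c * x + d) * x') * (c * y + d) - ((c * y + d) * y') * (c * x + d))"
      unfolding A' by (simp add: algebra_simps)
    also have "\<dots> = E * (A * (x - y))" unfolding x' E_def by (simp add: algebra_simps)
    finally have diff: "A' * (x' - y') = E * (A * (x - y))" .
    define e :: int where "e = (if E * (A * (x - y)) > 0 then 1 else - 1)"
    have "\<bar>real_of_int E\<bar> = 1" using det unfolding E_def by linarith
    then have "\<bar>E * (A * (x - y))\<bar> = D" by (simp add: abs_mult D_def)
    then have diffe: "A' * (x' - y') = e * D" unfolding diff e_def by (auto simp: abs_if split: if_splits)
    obtain z where z: "z \<in> semicircle x' y'" "z \<in> mod_triangle"
      using ne geodesic_cut_memD unfolding s x'_def[symmetric] y'_def[symmetric] by blast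
    note bd = semicircle_triangle_bounds[OF z]
    have "\<bar>real_of_int A'\<bar> * \<bar>x' - y'\<bar> = D" using diffe D by (simp add: e_def flip: abs_mult)
    then have AD: "\<bar>real_of_int A'\<bar> \<le> D" using bd(1) mult_left_mono[of 1 "\<bar>x' - y'\<bar>" "\<bar>real_of_int A'\<bar>"] by simp
    have DD: "D \<le> D * (D + 2)" using D by (simp add: algebra_simps)
    have "1 \<le> \<bar>real_of_int A'\<bar>" using A'0 by linarith
    have "\<bar>real_of_int B'\<bar> = \<bar>real_of_int A'\<bar> * \<bar>x' + y'\<bar>" by (simp add: B'[symmetric] abs_mult)
    also have "\<dots> \<le> \<bar>real_of_int A'\<bar> * (\<bar>x' - y'\<bar> + 1)" using bd(3) by (intro mult_left_mono) auto
    also have "\<dots> = D + \<bar>real_of_int A'\<bar>" using \<open>\<bar>real_of_int A'\<bar> * \<bar>x' - y'\<bar> = D\<close> by (simp add: algebra_simps)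
    also have "\<dots> \<le> D * (D + 2)" using AD zero_le_square[of D] unfolding distrib_left by linarith
    finally have "B' \<in> I" "A' \<in> I" using AD DD by (simp_all add: I_def)
    moreover have "s = g (A', B', e)"
    proof -
      have "x' + y' = B' / A'" "x' - y' = e * (D / A')" using A'0 B' diffe by (simp_all add: field_simps)
      moreover have "x' = ((x' + y') + (x' - y')) / 2" "y' = ((x' + y') - (x' - y')) / 2" by simp_all
      ultimately have *: "x' = (B' / A' + e * (D / A')) / 2" "y' = (B' / A' - e * (D / A')) / 2" by metis+
      show ?thesis unfolding s g_def x'_def[symmetric] y'_def[symmetric] by (simp only: prod.case *[symmetric])
    qed
    moreover have "e \<in> {-1, 1}" by (simp add: e_def)
    ultimately show "s \<in> g ` (I \<times> I \<times> {-1, 1})" by blast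
  qed
  then have fin: "finite (billiard (Some x) (Some y))"
    using \<open>finite I\<close> by (meson finite.emptyI finite.insertI finite_SigmaI finite_imageI finite_subset)
  have "segment_length s < \<infinity>" if "s \<in> billiard (Some x) (Some y)" for s
    using irrational_billiard_segment[OF xy irr that] segment_length_finite by metis
  then show ?thesis unfolding periodic_def using fin by simp
qed

section \<open>Infinitely many segments of the third billiard\<close>

lemma billiard_chain_step:
  fixes v X :: real and M :: int
  assumes "v \<noteq> X" "v \<noteq> of_int M" "X \<noteq> of_int M"
  shows "billiard (Some (1 / (M - v))) (Some (1 / (M - X))) = billiard (Some v) (Some X)"
  using billiard_inverse[of "of_int M - v" "of_int M - X"] billiard_shift[of "- v" "- X" M] billiard_neg[of v X] assms
  by simp

text \<open>Each step past the 6 yields a new left endpoint for the same billiard.\<close>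

lemma billiard_C3_tail: "billiard (Some (tail_frac j)) (Some (4 + 2 * kap)) = billiard_C3"
proof (induction j)
  case 0
  show ?case
    using billiard_chain_step[of "1 - 2 * kap" "5 + 2 * kap" 6] kap_bounds
    by (simp add: billiard_C3_kap kap_inverse)
next
  case (Suc j)
  have "billiard (Some (1 / (5 - tail_frac j))) (Some (1 / (5 - (4 + 2 * kap)))) = billiard (Some (tail_frac j)) (Some (4 + 2 * kap))"
    using billiard_chain_step[of "tail_frac j" "4 + 2 * kap" 5] tail_frac_numeric[of j] kap_bounds by simp
  then show ?case using Suc by (simp add: kap_inverse)
qed

lemma not_periodic_C3: "\<not> periodic billiard_C3"
proof -
  note k = kap_bounds
  define b where "b = 2 + 2 * kap"
  \<comment> \<open>Shifted by 2, the arcs run from about -1.8 to 2.8 and cross the triangle from Re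
    z = 0 at \<open>z0\<close> to Re z = 1 / 2 at \<open>z1\<close>.\<close>
  define a where "a j = tail_frac j - 2" for j
  define s where "s j = geodesic (Some (a j)) (Some b) \<inter> (mod_triangle \<times> mod_triangle)" for j
  define z0 where "z0 j = Complex 0 (sqrt (- a j * b))" for j
  define z1 where "z1 j = Complex (1 / 2) (sqrt ((1 / 2 - a j) * (b - 1 / 2)))" for j
  have num: "- 2 \<le> a j" "a j \<le> - 1" for j
    using tail_frac_numeric[of j] by (simp_all add: a_def)
  have b: "2 \<le> b" "b \<le> 3" using k by (simp_all add: b_def)
  have ab: "a j < b" for j using num[of j] b by simp
  have bil: "billiard (Some (a j)) (Some b) = billiard_C3" for j
    using billiard_shift[of "tail_frac j" "4 + 2 * kap" "- 2"] ab[of j] billiard_C3_tail[of j]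
    by (simp add: a_def b_def)
  have i0: "1 \<le> - a j * b" "- a j * b \<le> 6" for j
    using mult_mono[of 1 "- a j" 1 b] mult_mono[of "- a j" 2 b 3] num[of j] b by auto
  have i1: "1 \<le> (1 / 2 - a j) * (b - 1 / 2)" "(1 / 2 - a j) * (b - 1 / 2) \<le> 9" for j
    using mult_mono[of 1 "1 / 2 - a j" 1 "b - 1 / 2"] mult_mono[of "1 / 2 - a j" 3 "b - 1 / 2" 3] num[of j] b by auto
  have z0: "z0 j \<in> semicircle (a j) b" "z0 j \<in> mod_triangle" for j
    using i0[of j] by (auto simp: semicircle_iff mod_triangle_def upper_half_plane_def z0_def complex_norm)
  have z1: "z1 j \<in> semicircle (a j) b" "z1 j \<in> mod_triangle" for j
    using i1[of j] by (auto simp: semicircle_iff mod_triangle_def upper_half_plane_def z1_def complex_norm intro: add_increasing)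
  have mem: "(z0 j, z1 j) \<in> s j" for j
    using z0[of j] z1[of j] ab[of j] by (simp add: s_def z0_def z1_def)
  have sB: "s j \<in> billiard_C3" for j
  proof -
    have "s j = geo (lin (mat 1) (a j, 1)) (lin (mat 1) (b, 1)) \<inter> (mod_triangle \<times> mod_triangle)"
      using geo_semicircle[of "a j" b] ab[of j] by (simp only: s_def mat_1_GL2Z less_imp_neq not_False_eq_True)
    then have "s j \<in> vec_billiard (a j, 1) (b, 1)"
      unfolding vec_billiard_def using mem[of j] mat_1_GL2Z(1) by blast
    then show ?thesis using billiard_eq_vec_billiard[of "Some (a j)" "Some b"] ab[of j] bil[of j] by simp
  qed
  have "inj s"
  proof (rule injI)
    fix i j assume "s i = s j"
    then have "z0 i \<in> semicircle (a j) b" using mem[of i] geodesic_cut_memD(1) unfolding s_def by metis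
    then have "- a j * b = - a i * b" using i0[of i] by (simp add: semicircle_iff z0_def)
    then have "a i = a j" using b by auto
    then show "i = j" using strict_mono_eq[OF strict_mono_tail_frac] by (simp add: a_def)
  qed
  then have inf: "infinite (range s)" by (simp add: finite_image_iff)
  \<comment> \<open>Points at horizontal distance 1 / 2 with heights at most 3 have cosh of the
    distance at least 1 + (1 / 4) / (2 * 3 * 3).\<close>
  define L where "L = arcosh (1 + 1 / 72 :: real)"
  have "L \<noteq> 0"
  proof
    assume "L = 0"
    then have "cosh (arcosh (1 + 1 / 72 :: real)) = cosh 0" by (simp only: L_def)
    then show False by simp
  qed
  then have L: "L > 0" using arcosh_nonneg_real[of "1 + 1 / 72"] by (simp add: L_def)
  have len: "ennreal L \<le> segment_length (s j)" for j
  proof -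
    have pos: "Im (z0 j) > 0" "Im (z1 j) > 0" using i0[of j] i1[of j] by (auto simp: z0_def z1_def)
    have "sqrt (- a j * b) \<le> 3" "sqrt ((1 / 2 - a j) * (b - 1 / 2)) \<le> 3"
      using i0[of j] i1[of j] by (auto intro!: real_le_lsqrt)
    then have le: "2 * Im (z0 j) * Im (z1 j) \<le> 2 * 3 * 3" using pos by (intro mult_mono) (auto simp: z0_def z1_def)
    have "(1 / 4) / (2 * 3 * 3) \<le> (norm (z0 j - z1 j))\<^sup>2 / (2 * Im (z0 j) * Im (z1 j))"
    proof (rule frac_le)
      show "1 / 4 \<le> (norm (z0 j - z1 j))\<^sup>2" unfolding cmod_power2 by (simp add: z0_def z1_def power2_eq_square)
    qed (use pos le in auto)
    then have "cosh L \<le> cosh (hyp_dist (z0 j) (z1 j))" by (simp add: cosh_hyp_dist(1)[OF pos] L_def)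
    then have "L \<le> hyp_dist (z0 j) (z1 j)"
      using L cosh_hyp_dist(2)[OF pos] by (simp add: cosh_real_nonneg_le_iff)
    then have "ennreal L \<le> (case (z0 j, z1 j) of (z, w) \<Rightarrow> ennreal (hyp_dist z w))" by (simp add: ennreal_leI)
    also have "\<dots> \<le> segment_length (s j)" unfolding segment_length_def by (rule SUP_upper[OF mem])
    finally show ?thesis .
  qed
  have "infsum segment_length (range s) = \<infinity>"
    by (rule infsum_superconst_infinite_ennreal[OF _ _ inf, of "ennreal L"]) (use len L in auto)
  moreover have "infsum segment_length (range s) \<le> infsum segment_length billiard_C3"
    using sB by (intro infsum_mono_neutral nonneg_summable_on_complete) auto
  ultimately show ?thesis unfolding periodic_def by (simp add: top_unique)
qed

lemma non_orientable_symmetric: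
  assumes "x \<noteq> y" "x + y = of_int n"
  shows "non_orientable (billiard (Some x) (Some y))"
  unfolding non_orientable_def using reversal_eq[of "Some x" "Some y"] billiard_symmetric[OF assms] assms by simp

lemma extremal_values_less: "sqrt 21 / 2 < 2 / 3 * sqrt 14" "2 / 3 * sqrt 14 < (3 + sqrt 21) / 3"
proof -
  have "4.58 < sqrt 21" "sqrt 21 < 4.59"
    by (rule real_less_rsqrt, simp add: power2_eq_square) (rule real_less_lsqrt, simp_all add: power2_eq_square)
  moreover have "3.741 < sqrt 14" "sqrt 14 < 3.742"
    by (rule real_less_rsqrt, simp add: power2_eq_square) (rule real_less_lsqrt, simp_all add: power2_eq_square)
  ultimately show "sqrt 21 / 2 < 2 / 3 * sqrt 14" "2 / 3 * sqrt 14 < (3 + sqrt 21) / 3" by simp_all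
qed

theorem theorem1p3:
  "sqrt 21 / 2 < 2 / 3 * sqrt 14 \<and> 2 / 3 * sqrt 14 < (3 + sqrt 21) / 3 \<and>
   {ereal (sqrt 21 / 2), ereal (2 / 3 * sqrt 14), ereal ((3 + sqrt 21) / 3)}
     \<subseteq> lambda_spectrum \<i> \<and>
   (\<forall>v \<in> lambda_spectrum \<i> -
        {ereal (sqrt 21 / 2), ereal (2 / 3 * sqrt 14), ereal ((3 + sqrt 21) / 3)}.
      ereal ((3 + sqrt 21) / 3) < v) \<and>
   {B \<in> modular_billiards. lambda \<i> B = ereal (sqrt 21 / 2)} = {billiard_C1} \<and>
   {B \<in> modular_billiards. lambda \<i> B = ereal (2 / 3 * sqrt 14)} = {billiard_C2} \<and>
   {B \<in> modular_billiards. lambda \<i> B = ereal ((3 + sqrt 21) / 3)} = {billiard_C3} \<and>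
   proper billiard_C1 \<and> proper billiard_C2 \<and> proper billiard_C3 \<and>
   non_orientable billiard_C1 \<and> non_orientable billiard_C2 \<and> non_orientable billiard_C3 \<and>
   periodic billiard_C1 \<and> periodic billiard_C2 \<and> \<not> periodic billiard_C3 \<and>
   ereal ((3 + sqrt 21) / 3) islimpt lambda_spectrum \<i>"
proof -
  note k = kap_bounds and less = extremal_values_less and irr = irrational_endpoints
  have modular: "billiard_C1 \<in> modular_billiards" "billiard_C2 \<in> modular_billiards" "billiard_C3 \<in> modular_billiards"
    unfolding billiard_C1_kap billiard_C2_reduced billiard_C3_kap modular_billiards_def using k by force+
  have small: "B = billiard_C1 \<or> B = billiard_C2 \<or> B = billiard_C3"
    if "B \<in> modular_billiards" "lambda \<i> B \<le> ereal ((3 + sqrt 21) / 3)" for B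
    using small_lambda_billiards[OF that(1)] that(2) by (simp only: inverse_kap)
  have attained: "{ereal (sqrt 21 / 2), ereal (2 / 3 * sqrt 14), ereal ((3 + sqrt 21) / 3)} \<subseteq> lambda_spectrum \<i>"
    unfolding lambda_spectrum_def lambda_C1[symmetric] lambda_C2[symmetric] lambda_C3[symmetric]
    using modular by blast
  have gap: "\<forall>v \<in> lambda_spectrum \<i> - {ereal (sqrt 21 / 2), ereal (2 / 3 * sqrt 14), ereal ((3 + sqrt 21) / 3)}.
      ereal ((3 + sqrt 21) / 3) < v"
  proof (rule ballI, rule ccontr)
    fix v assume v: "v \<in> lambda_spectrum \<i> - {ereal (sqrt 21 / 2), ereal (2 / 3 * sqrt 14), ereal ((3 + sqrt 21) / 3)}"
      and "\<not> ereal ((3 + sqrt 21) / 3) < v"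
    then obtain B where "B \<in> modular_billiards" "v = lambda \<i> B" "lambda \<i> B \<le> ereal ((3 + sqrt 21) / 3)"
      unfolding lambda_spectrum_def by force
    then show False using small[of B] v lambda_C1 lambda_C2 lambda_C3 by auto
  qed
  have unique: "{B \<in> modular_billiards. lambda \<i> B = ereal (sqrt 21 / 2)} = {billiard_C1}"
    "{B \<in> modular_billiards. lambda \<i> B = ereal (2 / 3 * sqrt 14)} = {billiard_C2}"
    "{B \<in> modular_billiards. lambda \<i> B = ereal ((3 + sqrt 21) / 3)} = {billiard_C3}"
    using small modular lambda_C1 lambda_C2 lambda_C3 less by fastforce+
  have proper: "proper billiard_C1" "proper billiard_C2" "proper billiard_C3"
    unfolding billiard_C1_kap billiard_C2_reduced billiard_C3_kap using k irr
    by (auto intro!: proper_irrational)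
  have non_orientable: "non_orientable billiard_C1" "non_orientable billiard_C2" "non_orientable billiard_C3"
  proof -
    show "non_orientable billiard_C1"
      unfolding billiard_C1_kap using k by (intro non_orientable_symmetric[where n = 5]) simp_all
    show "non_orientable billiard_C2"
      unfolding billiard_C2_reduced by (intro non_orientable_symmetric[where n = 4]) (simp_all add: field_simps)
    show "non_orientable billiard_C3"
      unfolding billiard_C3_kap using k by (intro non_orientable_symmetric[where n = 6]) simp_all
  qed
  have periodic: "periodic billiard_C1" "periodic billiard_C2"
  proof -
    show "periodic billiard_C1"
      unfolding billiard_C1_kap
      by (rule periodic_quadratic[where A = 1 and B = 5 and C = 1])
        (use k irr kap_square in \<open>simp_all add: algebra_simps\<close>)
    show "periodic billiard_C2"
      unfolding billiard_C2_reduced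
      by (rule periodic_quadratic[where A = 2 and B = 8 and C = 1]) (use irr in \<open>simp_all add: field_simps\<close>)
  qed
  have limit: "ereal ((3 + sqrt 21) / 3) islimpt lambda_spectrum \<i>"
    using third_value_islimpt by (simp only: inverse_kap)
  show ?thesis
    by (intro conjI) (fact less attained gap unique proper non_orientable periodic not_periodic_C3 limit)+
qed

end
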